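(* Let $(Z_1,Z_2)\sim MPH^*(\alpha,Q,R)$, i.e. let $(Z_1,Z_2)$ have Kulkarni's bivariate phase-type distribution as defined in the context, and let $E_0,E_+$, $Q_{00},Q_{0+},Q_{+0},Q_{++}$, $\alpha_0,\alpha_+$, $\eta_0,\eta_+$, $R_+,D_+,D_0$ be as defined in the context. Then $$\mathbb{E}\left(e^{-sZ_2}\,1_{\{Z_1=0\}}\right)=\alpha_0\,(sD_0-Q_{00})^{-1}\,\eta_0$$ for $s\ge 0$, and $$\mathbb{E}\left(e^{-sZ_2}\,1_{\{Z_1\in dy\}}\right)=\alpha(s)\,e^{W(s)y}\,\eta(s)\,dy$$ for $y>0$ and $s\ge 0$, where $$\alpha(s):=\alpha_0\,(sD_0-Q_{00})^{-1}Q_{0+}+\alpha_+,$$ $$W(s):=R_+^{-1}\left((Q_{++}-sD_+)-Q_{+0}\,(Q_{00}-sD_0)^{-1}Q_{0+}\right),$$ $$\eta(s):=R_+^{-1}\left(Q_{+0}\,(sD_0-Q_{00})^{-1}\eta_0+\eta_+\right).$$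
   Context: Let $m\in\mathbb{N}$ and let $\mathcal{J}=(J_t:t\ge 0)$ be a (continuous-time) Markov process on the finite state space $E'=\{1,\dots,m+1\}$ with generator matrix $$\begin{pmatrix} Q & -Q\mathbf{1}\\ \mathbf{0} & 0\end{pmatrix},$$ where $Q$ is an invertible $m\times m$ matrix, $\mathbf{1}$ is the column vector of ones and $\mathbf{0}$ is a zero row vector. Thus $m+1$ is absorbing and the states in $E:=\{1,\dots,m\}$ are transient. The initial distribution of $\mathcal{J}$ is $(\alpha,\alpha_{m+1})$, where $\alpha=(\alpha_1,\dots,\alpha_m)$ is a row vector, $\alpha_i=\mathbb{P}(J_0=i)$ for $i\in E'$, and it is assumed that $\alpha_{m+1}<1$. Let $R=(r_{ij})_{i\le 2,\,j\le m}$ be a $2\times m$ reward matrix with $r_{ij}\ge 0$ for all $i,j$. Write $r_i(j):=r_{ij}$ for $j\in E$ and $r_i(m+1):=0$. Let $\tau:=\min\{t\ge 0: J_t=m+1\}$ be the time of absorption, and define $$Z_i:=\int_0^\tau r_i(J_t)\,dt,\qquad i=1,2.$$ The distribution of $(Z_1,Z_2)$ is denoted $MPH^*(\alpha,Q,R)$. To avoid trivial singularities it is assumed that $\sum_{j=1}^m r_{ij}>0$, i.e. $\mathbb{P}(Z_i>0)>0$, for $i=1,2$. Partition $E=E_0\cup E_+$ with $E_0:=\{i\in E: r_{1i}=0\}$ and $E_+:=\{i\in E: r_{1i}>0\}$. According to this partition (states of $E_0$ listed first), write in block form $$Q=\begin{pmatrix}Q_{00}&Q_{0+}\\ Q_{+0}&Q_{++}\end{pmatrix},\qquad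 \alpha=(\alpha_0,\alpha_+),\qquad \eta:=-Q\mathbf{1}=\begin{pmatrix}\eta_0\\ \eta_+\end{pmatrix}.$$ (Here $\alpha_0$ denotes the subvector of $\alpha$ indexed by $E_0$.) Define the diagonal matrices $$R_+:=\mathrm{diag}(r_{1i}:i\in E_+),\qquad D_+:=\mathrm{diag}(r_{2i}:i\in E_+),\qquad D_0:=\mathrm{diag}(r_{2i}:i\in E_0).$$ The expression $\mathbb{E}(e^{-sZ_2}1_{\{Z_1\in dy\}})$ denotes a density function for $Z_1$ joint with a Laplace transform (with argument $s$) for $Z_2$.
   Formalization: The first formula is false when α_{m+1}>0, since it omits the event J_0=m+1 on which Z_1=Z_2=0; the formal statement adds α_{m+1} to its right-hand side, which gives the printed formula when α_{m+1}=0. *)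

theory Defs
  imports
    "HOL-Probability.Probability"
    "Jordan_Normal_Form.DL_Submatrix"
    "Jordan_Normal_Form.Gauss_Jordan_Elimination"
begin

text \<open>Matrices are those of Jordan_Normal_Form: dimensions are natural numbers (possibly 0,
  which is needed because the block of zero-reward states may be empty) and indices start at 0.
  Hence the states 1, ..., m + 1 of the mathematical text are 0, ..., m here, the absorbing
  state being m. Row vectors are 1-by-n and column vectors n-by-1 matrices, and 1-by-1 products
  are read off at entry (0, 0).\<close>

definition mat_exp :: "real mat \<Rightarrow> real mat" where
  "mat_exp A = Matrix.mat (dim_row A) (dim_row A) (\<lambda>(i, j). \<Sum>k. (A ^\<^sub>m k) $$ (i, j) / fact k)"

text \<open>Meaningful for invertible matrices only (the library function returns None otherwise).\<close>

definition mat_inv :: "real mat \<Rightarrow> real mat" where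
  "mat_inv A = the (mat_inverse A)"

definition ones_col :: "nat \<Rightarrow> real mat" where
  "ones_col n = Matrix.mat n 1 (\<lambda>_. 1)"

definition generator_matrix :: "nat \<Rightarrow> real mat \<Rightarrow> bool" where
  "generator_matrix n G \<longleftrightarrow>
     G \<in> carrier_mat n n \<and>
     (\<forall>i<n. \<forall>j<n. i \<noteq> j \<longrightarrow> 0 \<le> G $$ (i, j)) \<and>
     (\<forall>i<n. (\<Sum>j<n. G $$ (i, j)) = 0)"

definition absorbing_generator :: "real mat \<Rightarrow> real mat" where
  "absorbing_generator Q =
     (let m = dim_row Q in four_block_mat Q (- (Q * ones_col m)) (0\<^sub>m 1 m) (0\<^sub>m 1 1))"

text \<open>A time-homogeneous continuous-time Markov process J on the finite state space {..<n} with
  right-continuous paths and transition function exp(tG). The conditional probability in the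
  Markov property is only required where the conditioning event has positive probability,
  since the library's conditional probability is 0 otherwise. Right-continuity is with respect
  to the discrete topology.\<close>

definition markov_process ::
    "'w measure \<Rightarrow> (real \<Rightarrow> 'w \<Rightarrow> nat) \<Rightarrow> nat \<Rightarrow> real mat \<Rightarrow> bool" where
  "markov_process M J n G \<longleftrightarrow>
     prob_space M \<and> generator_matrix n G \<and>
     (\<forall>t\<ge>0. J t \<in> measurable M (count_space {..<n})) \<and>
     (\<forall>\<omega>\<in>space M. \<forall>t\<ge>0. eventually (\<lambda>u. J u \<omega> = J t \<omega>) (at_right t)) \<and>
     (\<forall>(k::nat) (t::nat \<Rightarrow> real) (x::nat \<Rightarrow> nat).
        0 \<le> t 0 \<longrightarrow> (\<forall>l\<le>k. t l < t (Suc l)) \<longrightarrow> (\<forall>l\<le>Suc k. x l < n) \<longrightarrow>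
        \<P>(\<omega> in M. \<forall>l\<le>k. J (t l) \<omega> = x l) > 0 \<longrightarrow>
        \<P>(\<omega> in M. J (t (Suc k)) \<omega> = x (Suc k) \<bar> \<forall>l\<le>k. J (t l) \<omega> = x l)
          = mat_exp ((t (Suc k) - t k) \<cdot>\<^sub>m G) $$ (x k, x (Suc k)))"

text \<open>The infimum is a minimum by right-continuity if the state a is reached, and infinity
  if it is not.\<close>

definition absorption_time :: "nat \<Rightarrow> (real \<Rightarrow> 'w \<Rightarrow> nat) \<Rightarrow> 'w \<Rightarrow> ereal" where
  "absorption_time a J \<omega> = (INF t\<in>{t. 0 \<le> t \<and> J t \<omega> = a}. ereal t)"

text \<open>Rewards in state j at rate R(i, j) for j < m and at rate 0 in the absorbing state m.\<close>

definition reward_rate :: "real mat \<Rightarrow> nat \<Rightarrow> nat \<Rightarrow> real" where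
  "reward_rate R i j = (if j < dim_col R then R $$ (i, j) else 0)"

definition total_reward :: "real mat \<Rightarrow> (real \<Rightarrow> 'w \<Rightarrow> nat) \<Rightarrow> nat \<Rightarrow> 'w \<Rightarrow> real" where
  "total_reward R J i \<omega> =
     (LBINT t=0..absorption_time (dim_col R) J \<omega>. reward_rate R i (J t \<omega>))"

text \<open>The diagonal matrix with entries R(i, j), for j in I in increasing order.\<close>

definition reward_diag :: "real mat \<Rightarrow> nat \<Rightarrow> nat set \<Rightarrow> real mat" where
  "reward_diag R i I = mat_diag (card I) (\<lambda>k. R $$ (i, pick I k))"

end

theory Submission
  imports Defs "Jordan_Normal_Form.Determinant"
begin

text \<open>For \<open>\<theta>, s \<ge> 0\<close> let \<open>r = \<theta> r\<^sub>1 + s r\<^sub>2\<close>. If \<open>h\<close> satisfies \<open>G h = r h\<close> and \<open>h = 1\<close> at the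
  absorbing state, then \<open>h (J t) exp (- \<integral>\<^sub>0\<^sup>t r (J u) du)\<close> has constant expectation (Feynman-Kac), and
  letting \<open>t \<rightarrow> \<infinity>\<close> gives \<open>E (exp (- \<theta> Z1 - s Z2)) = E (h (J 0))\<close>. Solving \<open>G h = r h\<close> blockwise,
  first for the states in \<open>E0\<close>, leaves \<open>(\<theta> - W s) h\<^sub>+ = \<eta> s\<close> on the others. For large \<open>\<theta>\<close> the inverse of
  \<open>\<theta> - W s\<close> is the Laplace transform of \<open>y \<mapsto> exp (y W s)\<close>, so \<open>E (h (J 0))\<close> is the Laplace transform in
  \<open>\<theta>\<close> of an atom at \<open>0\<close> plus the claimed density. Uniqueness of Laplace transforms identifies the
  law; the transforms need to agree for large \<open>\<theta>\<close> only, so no spectral information about \<open>W s\<close> is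
  used, and nonnegativity and integrability of the density come out of the identification.\<close>

section \<open>The matrix exponential\<close>

text \<open>\<open>markov_process\<close> offers transition probabilities along finite increasing
  grids and right-continuous paths, but neither a jump chain nor the strong Markov property. The
  integrated rewards are therefore reached through Riemann sums on a grid, with errors controlled by
  second-order bounds for exp(dG). Invertibility of \<open>Q\<close> acts twice. It makes
  \<open>Q x = -1\<close> solvable, which forces almost sure absorption, and it excludes closed
  classes of states with zero row sums, which makes \<open>s D0 - Q00\<close> invertible even at s =
  0 or where the second reward vanishes. Any solution of G h = r h that is 1 at absorption serves,
  so h is simply built from the formulas to be proved; the constant part of E (h (J 0)) as a
  function of \<theta> is the atom. A path that starts in the absorbing state has both rewards equal
  to 0, so it contributes to the atom for every s. Hence the formal identity has the summand
  \<open>\<alpha>_abs\<close> beside the product displayed in the English formula; the two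
  right-hand sides agree exactly when \<open>\<alpha>_abs\<close> is 0.\<close>

lemma mat_mult_index_sum:
  fixes A B :: "real mat"
  assumes "A \<in> carrier_mat n k" "B \<in> carrier_mat k l" "i < n" "j < l"
  shows "(A * B) $$ (i, j) = (\<Sum>p<k. A $$ (i, p) * B $$ (p, j))"
  using assms by (auto simp: scalar_prod_def lessThan_atLeast0 intro!: sum.cong)

lemma pow_mat_Suc_index:
  fixes A :: "real mat"
  assumes A: "A \<in> carrier_mat n n" and "i < n" "j < n"
  shows "(A ^\<^sub>m Suc k) $$ (i, j) = (\<Sum>p<n. (A ^\<^sub>m k) $$ (i, p) * A $$ (p, j))"
  using mat_mult_index_sum[OF pow_carrier_mat[OF A] A assms(2,3), of k] by simp

text \<open>\<open>pow_mat\<close> appends factors on the right; the resolvent equation and the zero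
  row of an absorbing state need the new factor on the left.\<close>

lemma pow_mat_Suc_index':
  fixes A :: "real mat"
  assumes A: "A \<in> carrier_mat n n" and i: "i < n" and j: "j < n"
  shows "(A ^\<^sub>m Suc k) $$ (i, j) = (\<Sum>p<n. A $$ (i, p) * (A ^\<^sub>m k) $$ (p, j))"
proof -
  have "A ^\<^sub>m Suc k = A * A ^\<^sub>m k"
  proof (induction k)
    case 0
    then show ?case using A by simp
  next
    case (Suc k)
    have "A ^\<^sub>m Suc (Suc k) = (A * A ^\<^sub>m k) * A" using Suc by simp
    also have "\<dots> = A * (A ^\<^sub>m k * A)"
      by (rule assoc_mult_mat[OF A pow_carrier_mat[OF A] A])
    finally show ?case by simp
  qed
  then show ?thesis using mat_mult_index_sum[OF A pow_carrier_mat[OF A] i j] by simp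
qed

lemma pow_mat_smult_index:
  fixes A :: "real mat"
  assumes A: "A \<in> carrier_mat n n" and "i < n" "j < n"
  shows "((y \<cdot>\<^sub>m A) ^\<^sub>m k) $$ (i, j) = y ^ k * (A ^\<^sub>m k) $$ (i, j)"
  using \<open>j < n\<close>
proof (induction k arbitrary: j)
  case 0
  then show ?case using assms by simp
next
  case (Suc k)
  have yA: "y \<cdot>\<^sub>m A \<in> carrier_mat n n" using A by simp
  have "((y \<cdot>\<^sub>m A) ^\<^sub>m Suc k) $$ (i, j) = (\<Sum>p<n. y ^ k * (A ^\<^sub>m k) $$ (i, p) * (y * A $$ (p, j)))"
    unfolding pow_mat_Suc_index[OF yA \<open>i < n\<close> Suc.prems]
    by (rule sum.cong) (use Suc A in auto)
  also have "\<dots> = y ^ Suc k * (\<Sum>p<n. (A ^\<^sub>m k) $$ (i, p) * A $$ (p, j))"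
    by (simp add: sum_distrib_left mult_ac)
  finally show ?case unfolding pow_mat_Suc_index[OF A \<open>i < n\<close> Suc.prems] .
qed

text \<open>A crude constant whose powers dominate the entries of the powers of \<open>A\<close>:
  the factor \<open>dim_row A\<close> pays for the sum over the intermediate index of a product. It
  is also the threshold beyond which the Laplace transforms below converge.\<close>

definition mat_bound :: "real mat \<Rightarrow> real" where
  "mat_bound A = real (dim_row A) * (\<Sum>i<dim_row A. \<Sum>j<dim_row A. \<bar>A $$ (i, j)\<bar>)"

lemma mat_bound_nonneg: "0 \<le> mat_bound A"
  unfolding mat_bound_def by (intro mult_nonneg_nonneg sum_nonneg) auto

lemma pow_mat_entry_bound:
  assumes A: "A \<in> carrier_mat n n" and "i < n" "j < n"
  shows "\<bar>(A ^\<^sub>m k) $$ (i, j)\<bar> \<le> mat_bound A ^ k"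
  using \<open>j < n\<close>
proof (induction k arbitrary: j)
  case 0
  then show ?case using assms by simp
next
  case (Suc k)
  define K where "K = (\<Sum>i<n. \<Sum>j<n. \<bar>A $$ (i, j)\<bar>)"
  have K: "\<bar>A $$ (p, j)\<bar> \<le> K" if "p < n" for p
  proof -
    have "\<bar>A $$ (p, j)\<bar> \<le> (\<Sum>j<n. \<bar>A $$ (p, j)\<bar>)"
      by (rule member_le_sum) (use Suc.prems in auto)
    also have "\<dots> \<le> K" unfolding K_def
      by (rule member_le_sum[where f="\<lambda>i. \<Sum>j<n. \<bar>A $$ (i, j)\<bar>"]) (use that in \<open>auto intro: sum_nonneg\<close>)
    finally show ?thesis .
  qed
  have nb: "mat_bound A = real n * K" using A by (simp add: mat_bound_def K_def)
  have "\<bar>(A ^\<^sub>m Suc k) $$ (i, j)\<bar> \<le> (\<Sum>p<n. \<bar>(A ^\<^sub>m k) $$ (i, p) * A $$ (p, j)\<bar>)"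
    unfolding pow_mat_Suc_index[OF A \<open>i < n\<close> Suc.prems] by (rule sum_abs)
  also have "\<dots> \<le> (\<Sum>p<n. mat_bound A ^ k * K)"
    by (rule sum_mono) (use Suc K mat_bound_nonneg in \<open>auto simp: abs_mult intro!: mult_mono\<close>)
  also have "\<dots> = mat_bound A ^ Suc k" by (simp add: nb)
  finally show ?case .
qed

lemma mat_exp_index:
  assumes A: "A \<in> carrier_mat n n" and ij: "i < n" "j < n"
  shows "mat_exp (y \<cdot>\<^sub>m A) $$ (i, j) = (\<Sum>k. y ^ k * (A ^\<^sub>m k) $$ (i, j) / fact k)"
    and "summable (\<lambda>k. y ^ k * (A ^\<^sub>m k) $$ (i, j) / fact k)"
proof -
  show "mat_exp (y \<cdot>\<^sub>m A) $$ (i, j) = (\<Sum>k. y ^ k * (A ^\<^sub>m k) $$ (i, j) / fact k)"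
    unfolding mat_exp_def using A ij by (simp add: pow_mat_smult_index[OF A ij])
  show "summable (\<lambda>k. y ^ k * (A ^\<^sub>m k) $$ (i, j) / fact k)"
  proof (rule summable_comparison_test')
    show "summable (\<lambda>k. (\<bar>y\<bar> * mat_bound A) ^ k / fact k)"
      using summable_exp[of "\<bar>y\<bar> * mat_bound A"] by (simp add: field_simps)
    show "norm (y ^ k * (A ^\<^sub>m k) $$ (i, j) / fact k) \<le> (\<bar>y\<bar> * mat_bound A) ^ k / fact k" for k
      using pow_mat_entry_bound[OF A ij, of k]
      by (auto simp: abs_mult power_mult_distrib power_abs intro!: divide_right_mono mult_left_mono)
  qed
qed

lemma mat_exp_dim [simp]: "dim_row (mat_exp A) = dim_row A" "dim_col (mat_exp A) = dim_row A"
  by (simp_all add: mat_exp_def)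

text \<open>After the first two terms of the series, d \<le> 1 allows \<open>d\<^sup>2\<close> to be
  pulled out of every term, and a tail of the exponential series at \<open>mat_bound A\<close>
  remains. The constant is uniform in d, so the errors of t/d steps add up to order d.\<close>

lemma mat_exp_second_order:
  assumes A: "A \<in> carrier_mat n n" and ij: "i < n" "j < n" and d: "0 \<le> d" "d \<le> 1"
  shows "\<bar>mat_exp (d \<cdot>\<^sub>m A) $$ (i, j) - (if i = j then 1 else 0) - d * A $$ (i, j)\<bar>
    \<le> d\<^sup>2 * exp (mat_bound A)"
proof -
  let ?c = "mat_bound A"
  let ?f = "\<lambda>k. d ^ k * (A ^\<^sub>m k) $$ (i, j) / fact k"
  have A1: "A ^\<^sub>m 1 = A" using A by simp
  have "mat_exp (d \<cdot>\<^sub>m A) $$ (i, j) - (if i = j then 1 else 0) - d * A $$ (i, j)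
      = suminf ?f - sum ?f {..<2}"
    using A1 A ij by (simp add: mat_exp_index[OF A ij] numeral_2_eq_2)
  also have "\<dots> = (\<Sum>k. ?f (k + 2))"
    using suminf_split_initial_segment[OF mat_exp_index(2)[OF A ij], of d 2] by simp
  also have "\<bar>\<dots>\<bar> \<le> (\<Sum>k. d\<^sup>2 * (?c ^ (k + 2) / fact (k + 2)))"
  proof -
    have s: "summable (\<lambda>k. d\<^sup>2 * (?c ^ (k + 2) / fact (k + 2)))"
      using summable_mult[OF summable_ignore_initial_segment[OF summable_exp[of ?c], of 2], of "d\<^sup>2"]
      by (simp add: field_simps)
    have b: "norm (?f (k + 2)) \<le> d\<^sup>2 * (?c ^ (k + 2) / fact (k + 2))" for k
    proof -
      have "d ^ (k + 2) * \<bar>(A ^\<^sub>m (k + 2)) $$ (i, j)\<bar> \<le> d\<^sup>2 * ?c ^ (k + 2)"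
        using pow_mat_entry_bound[OF A ij, of "k + 2"] d
        by (intro mult_mono power_decreasing) auto
      then have "d ^ (k + 2) * \<bar>(A ^\<^sub>m (k + 2)) $$ (i, j)\<bar> / fact (k + 2) \<le> d\<^sup>2 * ?c ^ (k + 2) / fact (k + 2)"
        by (rule divide_right_mono) simp
      moreover have "norm (?f (k + 2)) = d ^ (k + 2) * \<bar>(A ^\<^sub>m (k + 2)) $$ (i, j)\<bar> / fact (k + 2)"
        using d by (simp add: abs_mult abs_divide power_abs del: fact_Suc power_Suc pow_mat.simps)
      ultimately show ?thesis by simp
    qed
    show ?thesis using norm_suminf_le[OF b s] by simp
  qed
  also have "\<dots> = d\<^sup>2 * (\<Sum>k. ?c ^ (k + 2) / fact (k + 2))"
  proof (rule suminf_mult)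
    show "summable (\<lambda>k. ?c ^ (k + 2) / fact (k + 2))"
      using summable_ignore_initial_segment[OF summable_exp[of ?c], of 2] by (simp add: field_simps)
  qed
  also have "(\<Sum>k. ?c ^ (k + 2) / fact (k + 2)) \<le> exp ?c"
  proof -
    have s: "summable (\<lambda>k. ?c ^ k / fact k)" using summable_exp[of ?c] by (simp add: field_simps)
    have e: "exp ?c = (\<Sum>k. ?c ^ k / fact k)" unfolding exp_def by (simp add: field_simps)
    have "(\<Sum>k<2. ?c ^ k / fact k) \<ge> 0" by (intro sum_nonneg) (simp add: mat_bound_nonneg)
    then show ?thesis using suminf_split_initial_segment[OF s, of 2] e by simp
  qed
  finally show ?thesis by (simp add: mult_left_mono)
qed

section \<open>Laplace transform of the matrix exponential\<close>

lemma laplace_monomial: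
  fixes \<theta> :: real
  assumes "0 < \<theta>"
  shows "has_bochner_integral lborel (\<lambda>y. indicator {0<..} y * (exp (- \<theta> * y) * (y ^ k / fact k))) (1 / \<theta> ^ Suc k)"
proof -
  \<comment> \<open>The Gamma integral is read off from the total mass 1 of the Erlang
    density.\<close>
  interpret D: prob_space "density lborel (erlang_density k \<theta>)"
    by (rule prob_space_erlang_density) (use assms in auto)
  have "has_bochner_integral lborel (erlang_density k \<theta>) 1"
  proof (rule has_bochner_integral_nn_integral)
    show "(\<integral>\<^sup>+ x. ennreal (erlang_density k \<theta> x) \<partial>lborel) = ennreal 1"
      using D.emeasure_space_1 by (simp add: emeasure_density)
  qed (use assms in \<open>auto simp: erlang_density_def\<close>)
  then have "has_bochner_integral lborel (\<lambda>y. (1 / \<theta> ^ Suc k) * erlang_density k \<theta> y) ((1 / \<theta> ^ Suc k) * 1)"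
    by (rule has_bochner_integral_mult_right)
  moreover have "AE y in lborel. 1 / \<theta> ^ Suc k * erlang_density k \<theta> y = indicator {0<..} y * (exp (- \<theta> * y) * (y ^ k / fact k))"
    using AE_lborel_singleton[of 0]
    by eventually_elim (use assms in \<open>auto simp: erlang_density_def indicator_def field_simps\<close>)
  ultimately show ?thesis
    by (subst (asm) has_bochner_integral_cong_AE) auto
qed

text \<open>The Neumann series for the inverse of \<theta> - A.\<close>

definition laplace_mat :: "real mat \<Rightarrow> real \<Rightarrow> nat \<Rightarrow> nat \<Rightarrow> real" where
  "laplace_mat A \<theta> i j = (\<Sum>k. (A ^\<^sub>m k) $$ (i, j) / \<theta> ^ Suc k)"

lemma laplace_mat_summable:
  assumes A: "A \<in> carrier_mat n n" and ij: "i < n" "j < n" and \<theta>: "mat_bound A < \<theta>"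
  shows "summable (\<lambda>k. \<bar>(A ^\<^sub>m k) $$ (i, j)\<bar> / \<theta> ^ Suc k)"
proof -
  have pos: "0 < \<theta>" using mat_bound_nonneg[of A] \<theta> by linarith
  show ?thesis
  proof (rule summable_comparison_test')
    show "summable (\<lambda>k. (1 / \<theta>) * (mat_bound A / \<theta>) ^ k)"
      by (intro summable_mult summable_geometric) (use pos \<theta> mat_bound_nonneg[of A] in auto)
    show "norm (\<bar>(A ^\<^sub>m k) $$ (i, j)\<bar> / \<theta> ^ Suc k) \<le> (1 / \<theta>) * (mat_bound A / \<theta>) ^ k" for k
    proof -
      have "\<bar>(A ^\<^sub>m k) $$ (i, j)\<bar> / \<theta> ^ Suc k \<le> mat_bound A ^ k / \<theta> ^ Suc k"
        by (rule divide_right_mono[OF pow_mat_entry_bound[OF A ij]]) (use pos in auto)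
      then show ?thesis using pos by (simp add: power_divide)
    qed
  qed
qed

text \<open>The exponential series is integrated term by term. The interchange rests on
  \<open>s2\<close>: the integrals of the moduli form the Neumann series with absolute values,
  dominated by a geometric series of ratio \<open>mat_bound A / \<theta>\<close>.\<close>

lemma laplace_mat_exp:
  assumes A: "A \<in> carrier_mat n n" and ij: "i < n" "j < n" and \<theta>: "mat_bound A < \<theta>"
  shows "has_bochner_integral lborel
    (\<lambda>y. indicator {0<..} y * (exp (- \<theta> * y) * mat_exp (y \<cdot>\<^sub>m A) $$ (i, j))) (laplace_mat A \<theta> i j)"
proof -
  have pos: "0 < \<theta>" using mat_bound_nonneg[of A] \<theta> by linarith
  let ?a = "\<lambda>k. (A ^\<^sub>m k) $$ (i, j)"
  let ?g = "\<lambda>k y. indicator {0<..} y * (exp (- \<theta> * y) * (y ^ k / fact k)) :: real"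
  let ?f = "\<lambda>k y. ?a k * ?g k y"
  have I: "has_bochner_integral lborel (?g k) (1 / \<theta> ^ Suc k)" for k
    by (rule laplace_monomial[OF pos])
  have int: "integrable lborel (?f k)" for k
    by (rule integrable_mult_right) (use I[of k] in \<open>simp only: has_bochner_integral_iff\<close>)
  have nm: "norm (?f k y) = \<bar>?a k\<bar> * ?g k y" for k y
    by (auto simp: abs_mult indicator_def)
  have sm0: "(\<lambda>k. exp (- \<theta> * y) * (y ^ k * ?a k / fact k)) sums (exp (- \<theta> * y) * mat_exp (y \<cdot>\<^sub>m A) $$ (i, j))" for y
    unfolding mat_exp_index(1)[OF A ij] by (intro sums_mult summable_sums mat_exp_index(2)[OF A ij])
  have sm: "(\<lambda>k. ?f k y) sums (indicator {0<..} y * (exp (- \<theta> * y) * mat_exp (y \<cdot>\<^sub>m A) $$ (i, j)))" for y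
  proof -
    have "(\<lambda>k. ?f k y) = (\<lambda>k. indicator {0<..} y * (exp (- \<theta> * y) * (y ^ k * ?a k / fact k)))"
      by (rule ext) simp
    then show ?thesis by (simp only:) (rule sums_mult[OF sm0])
  qed
  have eq: "(\<lambda>y. \<Sum>k. ?f k y) = (\<lambda>y. indicator {0<..} y * (exp (- \<theta> * y) * mat_exp (y \<cdot>\<^sub>m A) $$ (i, j)))"
    using sm by (auto simp: sums_iff)
  have s1: "AE y in lborel. summable (\<lambda>k. norm (?f k y))"
  proof (rule AE_I2)
    fix y :: real
    have "summable (\<lambda>k. (y * mat_bound A) ^ k / fact k)" for y
      using summable_exp[of "y * mat_bound A"] by (simp add: field_simps)
    then have "summable (\<lambda>k. indicator {0<..} y * (exp (- \<theta> * y) * ((y * mat_bound A) ^ k / fact k)))"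
      by (intro summable_mult) auto
    then show "summable (\<lambda>k. norm (?f k y))"
    proof (rule summable_comparison_test'[where N=0])
      fix k
      have "\<bar>?a k\<bar> * ?g k y \<le> mat_bound A ^ k * ?g k y"
        by (rule mult_right_mono[OF pow_mat_entry_bound[OF A ij]]) (auto simp: indicator_def)
      then show "norm (norm (?f k y)) \<le> indicator {0<..} y * (exp (- \<theta> * y) * ((y * mat_bound A) ^ k / fact k))"
        unfolding nm[symmetric] by (simp add: power_mult_distrib mult_ac)
    qed
  qed
  have s2: "summable (\<lambda>k. \<integral>y. norm (?f k y) \<partial>lborel)"
    unfolding nm integral_mult_right_zero has_bochner_integral_integral_eq[OF I]
    using laplace_mat_summable[OF A ij \<theta>] by simp
  have v: "(\<Sum>k. integral\<^sup>L lborel (?f k)) = laplace_mat A \<theta> i j"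
    unfolding laplace_mat_def integral_mult_right_zero has_bochner_integral_integral_eq[OF I] by simp
  show ?thesis unfolding has_bochner_integral_iff eq[symmetric]
    using integrable_suminf[OF int s1 s2] integral_suminf[OF int s1 s2] v by simp
qed

text \<open>Multiplication by A shifts the index of the Neumann series by one, so the difference
  telescopes to the term k = 0, the identity matrix.\<close>

lemma laplace_mat_resolvent:
  assumes A: "A \<in> carrier_mat n n" and ij: "i < n" "j < n" and \<theta>: "mat_bound A < \<theta>"
  shows "\<theta> * laplace_mat A \<theta> i j - (\<Sum>p<n. A $$ (i, p) * laplace_mat A \<theta> p j) = (if i = j then 1 else 0)"
proof -
  have pos: "0 < \<theta>" using mat_bound_nonneg[of A] \<theta> by linarith
  have s: "summable (\<lambda>k. (A ^\<^sub>m k) $$ (p, j) / \<theta> ^ Suc k)" if "p < n" for p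
    using laplace_mat_summable[OF A that ij(2) \<theta>] pos
    by (intro summable_norm_cancel[of "\<lambda>k. (A ^\<^sub>m k) $$ (p, j) / \<theta> ^ Suc k"]) (simp add: abs_divide)
  have "(\<Sum>p<n. A $$ (i, p) * laplace_mat A \<theta> p j)
      = (\<Sum>p<n. \<Sum>k. A $$ (i, p) * ((A ^\<^sub>m k) $$ (p, j) / \<theta> ^ Suc k))"
    unfolding laplace_mat_def by (intro sum.cong refl suminf_mult[symmetric]) (use s in auto)
  also have "\<dots> = (\<Sum>k. \<Sum>p<n. A $$ (i, p) * ((A ^\<^sub>m k) $$ (p, j) / \<theta> ^ Suc k))"
    by (rule suminf_sum[symmetric], rule summable_mult) (use s in blast)
  also have "\<dots> = (\<Sum>k. (A ^\<^sub>m Suc k) $$ (i, j) / \<theta> ^ Suc k)"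
    unfolding pow_mat_Suc_index'[OF A ij] by (simp add: sum_divide_distrib)
  finally have 1: "(\<Sum>p<n. A $$ (i, p) * laplace_mat A \<theta> p j) = (\<Sum>k. (A ^\<^sub>m Suc k) $$ (i, j) / \<theta> ^ Suc k)" .
  have s': "summable (\<lambda>k. (A ^\<^sub>m k) $$ (i, j) / \<theta> ^ k)"
    using summable_mult[OF s[OF ij(1)], of \<theta>] pos by simp
  have "\<theta> * laplace_mat A \<theta> i j = (\<Sum>k. \<theta> * ((A ^\<^sub>m k) $$ (i, j) / \<theta> ^ Suc k))"
    unfolding laplace_mat_def by (rule suminf_mult[symmetric]) (use s ij in auto)
  also have "\<dots> = (\<Sum>k. (A ^\<^sub>m k) $$ (i, j) / \<theta> ^ k)" using pos by simp
  also have "\<dots> = (\<Sum>k. (A ^\<^sub>m Suc k) $$ (i, j) / \<theta> ^ Suc k) + (A ^\<^sub>m 0) $$ (i, j)"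
    using suminf_split_initial_segment[OF s', of 1] by simp
  finally show ?thesis using 1 ij A by simp
qed

section \<open>Uniqueness of Laplace transforms\<close>

lemma integrable_mult_bounded:
  fixes w g :: "'a \<Rightarrow> real"
  assumes "integrable M w" "g \<in> borel_measurable M" "\<And>x. x \<in> space M \<Longrightarrow> \<bar>g x\<bar> \<le> K"
  shows "integrable M (\<lambda>x. w x * g x)"
proof (rule Bochner_Integration.integrable_bound)
  show "integrable M (\<lambda>x. K * w x)" using assms(1) by simp
  show "(\<lambda>x. w x * g x) \<in> borel_measurable M" using assms by measurable
  show "AE x in M. norm (w x * g x) \<le> norm (K * w x)"
  proof (rule AE_I2)
    fix x assume "x \<in> space M"
    then have "\<bar>g x\<bar> \<le> \<bar>K\<bar>" using assms(3)[of x] by simp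
    then show "norm (w x * g x) \<le> norm (K * w x)"
      by (simp add: abs_mult mult.commute mult_right_mono)
  qed
qed

lemma integral_mult_uniformly_close:
  fixes w f g :: "'a \<Rightarrow> real"
  assumes w: "integrable M w" and f: "f \<in> borel_measurable M" and g: "g \<in> borel_measurable M"
    and bf: "\<And>x. x \<in> space M \<Longrightarrow> \<bar>f x\<bar> \<le> K" and bg: "\<And>x. x \<in> space M \<Longrightarrow> \<bar>f x - g x\<bar> \<le> e"
  shows "\<bar>(\<integral>x. w x * f x \<partial>M) - (\<integral>x. w x * g x \<partial>M)\<bar> \<le> e * (\<integral>x. \<bar>w x\<bar> \<partial>M)"
proof -
  have d: "integrable M (\<lambda>x. w x * (f x - g x))"
    by (rule integrable_mult_bounded[OF w _ bg]) (use f g in measurable)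
  have i: "integrable M (\<lambda>x. w x * f x)" by (rule integrable_mult_bounded[OF w f bf])
  have "integrable M (\<lambda>x. w x * f x - w x * (f x - g x))"
    by (rule Bochner_Integration.integrable_diff[OF i d])
  then have j: "integrable M (\<lambda>x. w x * g x)" by (simp add: algebra_simps)
  have "(\<integral>x. w x * f x \<partial>M) - (\<integral>x. w x * g x \<partial>M) = (\<integral>x. w x * (f x - g x) \<partial>M)"
    using i j by (simp add: right_diff_distrib)
  also have "\<bar>\<dots>\<bar> \<le> (\<integral>x. \<bar>w x * (f x - g x)\<bar> \<partial>M)"
    using integral_norm_bound[of M "\<lambda>x. w x * (f x - g x)"] by simp
  also have "\<dots> \<le> (\<integral>x. e * \<bar>w x\<bar> \<partial>M)"
  proof (rule integral_mono)
    fix x assume "x \<in> space M"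
    from bg[OF this] show "\<bar>w x * (f x - g x)\<bar> \<le> e * \<bar>w x\<bar>"
      by (simp add: abs_mult mult.commute[of e] mult_left_mono)
  qed (use d w in auto)
  finally show ?thesis by simp
qed

text \<open>Weierstrass' theorem in the variable \<open>x = exp (- z)\<close>; the indicators of \<open>{..a}\<close> are then
  pointwise limits of continuous functions of \<open>x\<close>.\<close>

lemma laplace_transform_unique:
  fixes w Z :: "'a \<Rightarrow> real" and w' Z' :: "'b \<Rightarrow> real"
  assumes w: "integrable M w" and Z: "Z \<in> borel_measurable M" "\<And>x. x \<in> space M \<Longrightarrow> 0 \<le> Z x"
    and w': "integrable M' w'" and Z': "Z' \<in> borel_measurable M'" "\<And>x. x \<in> space M' \<Longrightarrow> 0 \<le> Z' x"
    and eq: "\<And>k::nat. (\<integral>x. w x * exp (- real k * Z x) \<partial>M) = (\<integral>x. w' x * exp (- real k * Z' x) \<partial>M')"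
    and B: "B \<in> sets borel"
  shows "(\<integral>x. w x * indicator B (Z x) \<partial>M) = (\<integral>x. w' x * indicator B (Z' x) \<partial>M')"
proof -
  note [measurable] = Z(1) Z'(1)
  have [measurable]: "w \<in> borel_measurable M" "w' \<in> borel_measurable M'"
    using w w' by auto
  have poly: "(\<integral>x. w x * p (exp (- Z x)) \<partial>M) = (\<integral>x. w' x * p (exp (- Z' x)) \<partial>M')"
    and pm: "p \<in> borel_measurable borel"
    if "real_polynomial_function p" for p
  proof -
    obtain a n where p: "p = (\<lambda>x. \<Sum>i\<le>n. a i * x ^ i)"
      using \<open>real_polynomial_function p\<close> real_polynomial_function_iff_sum by blast
    show "p \<in> borel_measurable borel" unfolding p by measurable
    have ex: "exp (- z) ^ i = exp (- real i * z)" for z :: real and i using exp_of_nat_mult[of i "- z"] by simp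
    have 1: "integrable M (\<lambda>x. w x * exp (- real i * Z x))" for i :: nat
      by (rule integrable_mult_bounded[OF w, where K=1]) (use Z(2) in auto)
    have 2: "integrable M' (\<lambda>x. w' x * exp (- real i * Z' x))" for i :: nat
      by (rule integrable_mult_bounded[OF w', where K=1]) (use Z'(2) in auto)
    have "(\<integral>x. w x * p (exp (- Z x)) \<partial>M) = (\<integral>x. (\<Sum>i\<le>n. a i * (w x * exp (- real i * Z x))) \<partial>M)"
      unfolding p ex by (simp add: sum_distrib_left mult_ac)
    also have "\<dots> = (\<Sum>i\<le>n. a i * (\<integral>x. w x * exp (- real i * Z x) \<partial>M))"
      by (subst Bochner_Integration.integral_sum) (use 1 in auto)
    also have "\<dots> = (\<Sum>i\<le>n. a i * (\<integral>x. w' x * exp (- real i * Z' x) \<partial>M'))"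
      by (simp only: eq)
    also have "\<dots> = (\<integral>x. (\<Sum>i\<le>n. a i * (w' x * exp (- real i * Z' x))) \<partial>M')"
      by (subst Bochner_Integration.integral_sum) (use 2 in auto)
    also have "\<dots> = (\<integral>x. w' x * p (exp (- Z' x)) \<partial>M')"
      unfolding p ex by (simp add: sum_distrib_left mult_ac)
    finally show "(\<integral>x. w x * p (exp (- Z x)) \<partial>M) = (\<integral>x. w' x * p (exp (- Z' x)) \<partial>M')" .
  qed
  have cont: "(\<integral>x. w x * f (exp (- Z x)) \<partial>M) = (\<integral>x. w' x * f (exp (- Z' x)) \<partial>M')"
    if f: "continuous_on UNIV f" and fb: "\<And>x. \<bar>f x\<bar> \<le> 1" for f :: "real \<Rightarrow> real"
  proof -
    let ?I = "\<integral>x. w x * f (exp (- Z x)) \<partial>M" and ?I' = "\<integral>x. w' x * f (exp (- Z' x)) \<partial>M'"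
    define K where "K = (\<integral>x. \<bar>w x\<bar> \<partial>M) + (\<integral>x. \<bar>w' x\<bar> \<partial>M') + 1"
    have K: "K > 0" unfolding K_def by (simp add: add_nonneg_pos)
    have [measurable]: "f \<in> borel_measurable borel" by (rule borel_measurable_continuous_onI[OF f])
    have "\<bar>?I - ?I'\<bar> \<le> d" if "d > 0" for d
    proof -
      define e where "e = d / K"
      have e: "e > 0" unfolding e_def using that K by simp
      obtain p where p: "real_polynomial_function p" and fp: "\<And>x. x \<in> {0..1} \<Longrightarrow> \<bar>f x - p x\<bar> < e"
        using Stone_Weierstrass_real_polynomial_function[of "{0..1}" f e] f e
        by (metis compact_Icc continuous_on_subset subset_UNIV)
      note [measurable] = pm[OF p]
      have "\<bar>?I - (\<integral>x. w x * p (exp (- Z x)) \<partial>M)\<bar> \<le> e * (\<integral>x. \<bar>w x\<bar> \<partial>M)"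
        by (rule integral_mult_uniformly_close[OF w _ _ fb]) (use Z(2) fp in \<open>auto intro!: less_imp_le\<close>)
      moreover have "\<bar>?I' - (\<integral>x. w' x * p (exp (- Z' x)) \<partial>M')\<bar> \<le> e * (\<integral>x. \<bar>w' x\<bar> \<partial>M')"
        by (rule integral_mult_uniformly_close[OF w' _ _ fb]) (use Z'(2) fp in \<open>auto intro!: less_imp_le\<close>)
      ultimately have "\<bar>?I - ?I'\<bar> \<le> e * (\<integral>x. \<bar>w x\<bar> \<partial>M) + e * (\<integral>x. \<bar>w' x\<bar> \<partial>M')"
        using poly[OF p] by linarith
      also have "\<dots> \<le> e * K" unfolding K_def using e by (simp add: algebra_simps)
      also have "\<dots> = d" unfolding e_def using K by simp
      finally show ?thesis .
    qed
    then have "\<bar>?I - ?I'\<bar> \<le> 0" by (rule field_le_epsilon[of _ 0, simplified])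
    then show ?thesis by simp
  qed
  have at_most: "(\<integral>x. w x * indicator {..a} (Z x) \<partial>M) = (\<integral>x. w' x * indicator {..a} (Z' x) \<partial>M')" for a
  proof -
    \<comment> \<open>In the variable x = exp (- z), z \<le> a means x \<ge> exp (- a). The ramp of
      slope n lies to the left of exp (- a), so it is 1 on that whole half-line and the limit is the
      indicator with its endpoint included.\<close>
    define f where "f n x = min 1 (max 0 (1 + real n * (x - exp (- a))))" for n :: nat and x :: real
    have fc: "continuous_on UNIV (f n)" for n unfolding f_def by (intro continuous_intros)
    have [measurable]: "f n \<in> borel_measurable borel" for n
      by (rule borel_measurable_continuous_onI[OF fc])
    have fb: "\<bar>f n x\<bar> \<le> 1" for n x by (auto simp: f_def)
    have lim: "(\<lambda>n. f n (exp (- z))) \<longlonglongrightarrow> indicator {..a} z" for z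
    proof (cases "z \<le> a")
      case True
      then have "f n (exp (- z)) = 1" for n by (simp add: f_def)
      then show ?thesis using True by simp
    next
      case False
      define d where "d = exp (- a) - exp (- z)"
      have d: "d > 0" using False by (simp add: d_def)
      have "f n (exp (- z)) = 0" if "n \<ge> nat \<lceil>1 / d\<rceil>" for n
      proof -
        have "1 / d \<le> real n" using that by linarith
        then have "1 \<le> real n * d" using d by (simp add: field_simps)
        then have "1 + real n * (exp (- z) - exp (- a)) \<le> 0" by (simp add: d_def algebra_simps)
        then show ?thesis by (simp add: f_def)
      qed
      then have "eventually (\<lambda>n. f n (exp (- z)) = 0) sequentially"
        unfolding eventually_sequentially by blast
      then show ?thesis using False by (simp add: tendsto_eventually)
    qed
    have 1: "(\<lambda>n. \<integral>x. w x * f n (exp (- Z x)) \<partial>M) \<longlonglongrightarrow> (\<integral>x. w x * indicator {..a} (Z x) \<partial>M)"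
      by (rule integral_dominated_convergence[where w="\<lambda>x. \<bar>w x\<bar>"])
        (use w fb lim in \<open>auto intro!: tendsto_mult_left simp: abs_mult mult_left_le\<close>)
    have 2: "(\<lambda>n. \<integral>x. w' x * f n (exp (- Z' x)) \<partial>M') \<longlonglongrightarrow> (\<integral>x. w' x * indicator {..a} (Z' x) \<partial>M')"
      by (rule integral_dominated_convergence[where w="\<lambda>x. \<bar>w' x\<bar>"])
        (use w' fb lim in \<open>auto intro!: tendsto_mult_left simp: abs_mult mult_left_le\<close>)
    show ?thesis
      using 1 2 unfolding cont[OF fc fb] by (rule LIMSEQ_unique)
  qed
  have int: "integrable M (\<lambda>x. w x * indicator A (Z x))" if "A \<in> sets borel" for A
    by (rule integrable_mult_bounded[OF w, where K=1]) (use that in \<open>auto simp: indicator_def\<close>)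
  have int': "integrable M' (\<lambda>x. w' x * indicator A (Z' x))" if "A \<in> sets borel" for A
    by (rule integrable_mult_bounded[OF w', where K=1]) (use that in \<open>auto simp: indicator_def\<close>)
  have total: "(\<integral>x. w x \<partial>M) = (\<integral>x. w' x \<partial>M')" using eq[of 0] by simp
  \<comment> \<open>The weights may change sign, so both sides are signed measures in B. Dynkin's
    induction is therefore run on the integrals themselves; the complement case uses
    \<open>total\<close>, the transform at k = 0.\<close>
  have "Int_stable (range (\<lambda>a::real. {..a}))" by (auto simp: Int_stable_def)
  moreover have "range (\<lambda>a::real. {..a}) \<subseteq> Pow UNIV" by simp
  moreover have "B \<in> sigma_sets UNIV (range (\<lambda>a::real. {..a}))"
    using B unfolding borel_eq_atMost by simp
  ultimately show ?thesis
  proof (induction rule: sigma_sets_induct_disjoint[consumes 3])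
    case (basic A)
    then show ?case using at_most by auto
  next
    case empty
    show ?case by simp
  next
    case (compl A)
    then have A: "A \<in> sets borel" unfolding borel_eq_atMost by simp
    have c: "v * indicator (UNIV - A) z = v - v * indicator A z" for v z :: real
      by (auto simp: indicator_def)
    show ?case unfolding c using compl.IH int[OF A] int'[OF A] w w' total by simp
  next
    case (union A)
    then have A: "A i \<in> sets borel" for i unfolding borel_eq_atMost by auto
    have U: "(\<lambda>n. \<integral>x. v x * indicator (\<Union>i<n. A i) (Y x) \<partial>N) \<longlonglongrightarrow> (\<integral>x. v x * indicator (\<Union>i. A i) (Y x) \<partial>N)"
      if v: "integrable N v" and [measurable]: "Y \<in> borel_measurable N" for v Y :: "'c \<Rightarrow> real" and N
    proof (rule integral_dominated_convergence[where w="\<lambda>x. \<bar>v x\<bar>"])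
      have [measurable]: "v \<in> borel_measurable N" using v by auto
      have [measurable]: "(\<Union>i. A i) \<in> sets borel" "(\<Union>i<n. A i) \<in> sets borel" for n
        using A by auto
      show "(\<lambda>x. v x * indicator (\<Union>i. A i) (Y x)) \<in> borel_measurable N"
        "(\<lambda>x. v x * indicator (\<Union>i<n. A i) (Y x)) \<in> borel_measurable N" for n by measurable
      show "AE x in N. (\<lambda>n. v x * indicator (\<Union>i<n. A i) (Y x)) \<longlonglongrightarrow> v x * indicator (\<Union>i. A i) (Y x)"
        by (intro AE_I2 tendsto_mult_left LIMSEQ_indicator_UN)
    qed (use v in \<open>auto simp: indicator_def\<close>)
    have fin: "(\<integral>x. v x * indicator (\<Union>i<n. A i) (Y x) \<partial>N) = (\<Sum>i<n. \<integral>x. v x * indicator (A i) (Y x) \<partial>N)"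
      if v: "\<And>i. integrable N (\<lambda>x. v x * indicator (A i) (Y x))" for v Y :: "'c \<Rightarrow> real" and N and n :: nat
    proof -
      have ind: "indicator (\<Union>i<n. A i) z = (\<Sum>i<n. indicator (A i) z :: real)" for z
        by (rule indicator_UN_disjoint) (use union.hyps(1) in \<open>auto intro: disjoint_family_on_mono\<close>)
      show ?thesis
        unfolding ind sum_distrib_left by (rule Bochner_Integration.integral_sum) (rule v)
    qed
    have e: "(\<integral>x. w x * indicator (\<Union>i<n. A i) (Z x) \<partial>M) = (\<integral>x. w' x * indicator (\<Union>i<n. A i) (Z' x) \<partial>M')" for n
      by (simp only: fin[OF int[OF A]] fin[OF int'[OF A]] union.IH)
    show ?case
      using U[OF w Z(1)] U[OF w' Z'(1)] unfolding e by (rule LIMSEQ_unique)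
  qed
qed

text \<open>The weight \<open>exp (- N y)\<close> keeps both sides finite as long as \<open>f\<close> is not known to be nonnegative.\<close>

lemma weighted_law_imp_density:
  fixes g Z :: "'a \<Rightarrow> real" and f :: "real \<Rightarrow> real"
  assumes g: "integrable M g" "\<And>\<omega>. \<omega> \<in> space M \<Longrightarrow> 0 \<le> g \<omega>"
    and Z: "Z \<in> borel_measurable M" "\<And>\<omega>. \<omega> \<in> space M \<Longrightarrow> 0 \<le> Z \<omega>" and N: "0 \<le> N"
    and fi: "integrable lborel (\<lambda>y. indicator {0<..} y * (exp (- N * y) * f y))"
    and eq: "\<And>B. B \<in> sets borel \<Longrightarrow> B \<subseteq> {0<..} \<Longrightarrow>
      (\<integral>\<omega>. g \<omega> * exp (- N * Z \<omega>) * indicator B (Z \<omega>) \<partial>M)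
      = (\<integral>y. indicator B y * (exp (- N * y) * f y) \<partial>lborel)"
  shows "set_integrable lborel {0<..} f"
    and "\<And>B. B \<in> sets borel \<Longrightarrow> B \<subseteq> {0<..} \<Longrightarrow>
      (\<integral>\<omega>. g \<omega> * indicator B (Z \<omega>) \<partial>M) = (LBINT y:B. f y)"
proof -
  have [measurable]: "g \<in> borel_measurable M" using g by auto
  note [measurable] = Z(1)
  let ?F = "\<lambda>y. indicator {0<..} y * (exp (- N * y) * f y)"
  have Fm[measurable]: "?F \<in> borel_measurable lborel" using fi by auto
  have Fe: "(\<lambda>y. ennreal (?F y)) \<in> borel_measurable lborel"
    by (rule measurable_compose[OF Fm measurable_ennreal])
  have fm[measurable]: "(\<lambda>y. indicator {0<..} y * f y) \<in> borel_measurable borel"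
  proof -
    have "(\<lambda>y. exp (N * y) * ?F y) = (\<lambda>y. indicator {0<..} y * f y)"
      by (rule ext) (simp add: exp_minus)
    moreover have "(\<lambda>y. exp (N * y) * ?F y) \<in> borel_measurable borel" using Fm by measurable
    ultimately show ?thesis by (simp only:)
  qed
  have int: "integrable lborel (\<lambda>y. indicator B y * (exp (- N * y) * f y))"
    if "B \<in> sets borel" "B \<subseteq> {0<..}" for B
  proof -
    have "integrable lborel (\<lambda>y. ?F y * indicator B y)"
      by (rule integrable_mult_bounded[OF fi, where K=1]) (use that in auto)
    moreover have "(\<lambda>y. ?F y * indicator B y) = (\<lambda>y. indicator B y * (exp (- N * y) * f y))"
      by (rule ext) (use that(2) in \<open>auto simp: indicator_def\<close>)
    ultimately show ?thesis by (simp only:)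
  qed
  have int': "integrable M (\<lambda>\<omega>. g \<omega> * exp (- N * Z \<omega>) * indicator B (Z \<omega>))" if [measurable]: "B \<in> sets borel" for B
    unfolding mult.assoc
  proof (rule integrable_mult_bounded[OF g(1), where K=1])
    show "\<bar>exp (- N * Z \<omega>) * indicator B (Z \<omega>)\<bar> \<le> 1" if "\<omega> \<in> space M" for \<omega>
      using Z(2)[OF that] N by (auto simp: indicator_def)
  qed measurable
  have pos: "AE y in lborel. 0 \<le> indicator {0<..} y * f y"
  proof -
    \<comment> \<open>Test with the set where f is negative: the left side of \<open>eq\<close> is
      nonnegative and the right side is the integral of a function \<le> 0, so this set is
      null.\<close>
    let ?B = "{y. indicator {0<..} y * f y < 0}"
    have Bm: "?B \<in> sets borel" by measurable
    have Bs: "?B \<subseteq> {0<..}" by (auto simp: indicator_def split: if_splits)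
    let ?h = "\<lambda>y. indicator ?B y * (exp (- N * y) * f y)"
    have "0 \<le> (\<integral>\<omega>. g \<omega> * exp (- N * Z \<omega>) * indicator ?B (Z \<omega>) \<partial>M)"
      by (rule Bochner_Integration.integral_nonneg) (use g(2) in auto)
    then have "(\<integral>y. - ?h y \<partial>lborel) \<le> 0" using eq[OF Bm Bs] by simp
    moreover have h: "0 \<le> - ?h y" for y
    proof (cases "y \<in> ?B")
      case True
      then have "f y < 0" by (cases "0 < y") auto
      then have "exp (- N * y) * f y \<le> 0" by (intro mult_nonneg_nonpos) auto
      then show ?thesis unfolding indicator_simps(1)[OF True] by simp
    next
      case False
      show ?thesis unfolding indicator_simps(2)[OF False] by simp
    qed
    ultimately have "(\<integral>y. - ?h y \<partial>lborel) = 0"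
      using Bochner_Integration.integral_nonneg[of lborel "\<lambda>y. - ?h y"] by (intro antisym) auto
    then have "AE y in lborel. - ?h y = 0"
      by (subst (asm) integral_nonneg_eq_0_iff_AE) (use h int[OF Bm Bs] in auto)
    then show ?thesis
    proof eventually_elim
      case (elim y)
      then show ?case by (cases "y \<in> ?B") auto
    qed
  qed
  \<comment> \<open>With f \<ge> 0 almost everywhere, the tilted identity is an equality of two
    measures. Integrating \<open>exp (N * y)\<close> over B against both removes the tilt.
    Nonnegative integrals allow this before integrability of f is known, and the finite value on the
    side of M then yields integrability.\<close>
  define \<mu> where "\<mu> = distr (density M (\<lambda>\<omega>. ennreal (g \<omega> * exp (- N * Z \<omega>) * indicator {0<..} (Z \<omega>)))) borel Z"
  define \<nu> where "\<nu> = density lborel (\<lambda>y. ennreal (?F y))"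
  have "\<mu> = \<nu>"
  proof (rule measure_eqI)
    fix A assume "A \<in> sets \<mu>"
    then have [measurable]: "A \<in> sets borel" by (simp add: \<mu>_def)
    let ?B = "A \<inter> {0<..}"
    have Bm: "?B \<in> sets borel" and Bs: "?B \<subseteq> {0<..}" by auto
    have "emeasure \<mu> A = (\<integral>\<^sup>+\<omega>. ennreal (g \<omega> * exp (- N * Z \<omega>) * indicator {0<..} (Z \<omega>)) * indicator (Z -` A \<inter> space M) \<omega> \<partial>M)"
      unfolding \<mu>_def by (simp add: emeasure_distr emeasure_density)
    also have "\<dots> = (\<integral>\<^sup>+\<omega>. ennreal (g \<omega> * exp (- N * Z \<omega>) * indicator ?B (Z \<omega>)) \<partial>M)"
      by (intro nn_integral_cong) (auto simp: indicator_def)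
    also have "\<dots> = ennreal (\<integral>\<omega>. g \<omega> * exp (- N * Z \<omega>) * indicator ?B (Z \<omega>) \<partial>M)"
      by (rule nn_integral_eq_integral[OF int'[OF Bm]]) (use g(2) in auto)
    also have "\<dots> = ennreal (\<integral>y. indicator ?B y * (exp (- N * y) * f y) \<partial>lborel)"
      by (simp only: eq[OF Bm Bs])
    also have "\<dots> = (\<integral>\<^sup>+y. ennreal (indicator ?B y * (exp (- N * y) * f y)) \<partial>lborel)"
    proof (rule nn_integral_eq_integral[OF int[OF Bm Bs], symmetric])
      show "AE y in lborel. 0 \<le> indicator ?B y * (exp (- N * y) * f y)"
        using pos by eventually_elim (auto simp: indicator_def split: if_splits)
    qed
    also have "\<dots> = (\<integral>\<^sup>+y. ennreal (?F y) * indicator A y \<partial>lborel)"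
      by (intro nn_integral_cong) (auto simp: indicator_def)
    also have "\<dots> = emeasure \<nu> A"
      unfolding \<nu>_def by (rule emeasure_density[OF Fe, symmetric]) simp
    finally show "emeasure \<mu> A = emeasure \<nu> A" .
  qed (simp add: \<mu>_def \<nu>_def)
  have nn: "(\<integral>\<^sup>+\<omega>. ennreal (g \<omega> * indicator B (Z \<omega>)) \<partial>M) = (\<integral>\<^sup>+y. ennreal (indicator B y * f y) \<partial>lborel)"
    if [measurable]: "B \<in> sets borel" and Bs: "B \<subseteq> {0<..}" for B
  proof -
    let ?k = "\<lambda>y. ennreal (exp (N * y)) * indicator B y"
    have "(\<integral>\<^sup>+y. ?k y \<partial>\<mu>) = (\<integral>\<^sup>+\<omega>. ennreal (g \<omega> * exp (- N * Z \<omega>) * indicator {0<..} (Z \<omega>)) * ?k (Z \<omega>) \<partial>M)"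
      unfolding \<mu>_def by (simp add: nn_integral_distr nn_integral_density)
    also have "\<dots> = (\<integral>\<^sup>+\<omega>. ennreal (g \<omega> * indicator B (Z \<omega>)) \<partial>M)"
    proof (rule nn_integral_cong)
      fix \<omega> assume \<omega>: "\<omega> \<in> space M"
      show "ennreal (g \<omega> * exp (- N * Z \<omega>) * indicator {0<..} (Z \<omega>)) * ?k (Z \<omega>) = ennreal (g \<omega> * indicator B (Z \<omega>))"
      proof (cases "Z \<omega> \<in> B")
        case True
        then have "0 < Z \<omega>" using Bs by auto
        then show ?thesis using True g(2)[OF \<omega>] by (simp add: exp_minus flip: ennreal_mult'')
      qed simp
    qed
    finally have 1: "(\<integral>\<^sup>+y. ?k y \<partial>\<mu>) = (\<integral>\<^sup>+\<omega>. ennreal (g \<omega> * indicator B (Z \<omega>)) \<partial>M)" .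
    have "(\<integral>\<^sup>+y. ?k y \<partial>\<nu>) = (\<integral>\<^sup>+y. ennreal (?F y) * ?k y \<partial>lborel)"
      unfolding \<nu>_def by (rule nn_integral_density[OF Fe]) measurable
    also have "\<dots> = (\<integral>\<^sup>+y. ennreal (indicator B y * f y) \<partial>lborel)"
    proof (rule nn_integral_cong)
      fix y
      show "ennreal (?F y) * ?k y = ennreal (indicator B y * f y)"
      proof (cases "y \<in> B")
        case True
        then have "0 < y" using Bs by auto
        then have "ennreal (?F y) * ?k y = ennreal (exp (- (N * y)) * f y * exp (N * y))"
          using True by (simp flip: ennreal_mult'')
        also have "exp (- (N * y)) * f y * exp (N * y) = f y" by (simp add: exp_minus field_simps)
        finally show ?thesis using True by simp
      qed simp
    qed
    finally show ?thesis using 1 \<open>\<mu> = \<nu>\<close> by simp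
  qed
  have gi: "integrable M (\<lambda>\<omega>. g \<omega> * indicator B (Z \<omega>))" if [measurable]: "B \<in> sets borel" for B
    by (rule integrable_mult_bounded[OF g(1), where K=1]) (auto simp: indicator_def)
  have fin: "(\<integral>\<^sup>+\<omega>. ennreal (g \<omega> * indicator B (Z \<omega>)) \<partial>M) = ennreal (\<integral>\<omega>. g \<omega> * indicator B (Z \<omega>) \<partial>M)"
    if "B \<in> sets borel" for B
    by (rule nn_integral_eq_integral[OF gi[OF that]]) (use g(2) in auto)
  have posB: "AE y in lborel. 0 \<le> indicator B y * f y" if "B \<subseteq> {0<..}" for B
    using pos by eventually_elim (use that in \<open>auto simp: indicator_def split: if_splits\<close>)
  have fmB: "(\<lambda>y. indicator B y * f y) \<in> borel_measurable lborel" if [measurable]: "B \<in> sets borel" and "B \<subseteq> {0<..}" for B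
  proof -
    have "(\<lambda>y. indicator B y * (indicator {0<..} y * f y)) \<in> borel_measurable lborel" by measurable
    moreover have "(\<lambda>y. indicator B y * (indicator {0<..} y * f y)) = (\<lambda>y. indicator B y * f y)"
      by (rule ext) (use \<open>B \<subseteq> {0<..}\<close> in \<open>auto simp: indicator_def\<close>)
    ultimately show ?thesis by (simp only:)
  qed
  show "set_integrable lborel {0<..} f"
    unfolding set_integrable_def real_scaleR_def
  proof (rule integrableI_nn_integral_finite[OF fmB posB])
    show "(\<integral>\<^sup>+y. ennreal (indicator {0<..} y * f y) \<partial>lborel) = ennreal (\<integral>\<omega>. g \<omega> * indicator {0<..} (Z \<omega>) \<partial>M)"
      using nn[of "{0<..}"] fin[of "{0<..}"] by simp
  qed auto
  show "(\<integral>\<omega>. g \<omega> * indicator B (Z \<omega>) \<partial>M) = (LBINT y:B. f y)" if B: "B \<in> sets borel" "B \<subseteq> {0<..}" for B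
  proof -
    have "(LBINT y:B. f y) = enn2real (\<integral>\<^sup>+y. ennreal (indicator B y * f y) \<partial>lborel)"
      unfolding set_lebesgue_integral_def real_scaleR_def
      by (rule integral_eq_nn_integral[OF fmB[OF B] posB[OF B(2)]])
    also have "\<dots> = (\<integral>\<omega>. g \<omega> * indicator B (Z \<omega>) \<partial>M)"
      unfolding nn[OF B, symmetric] fin[OF B(1)]
      by (rule enn2real_ennreal, rule Bochner_Integration.integral_nonneg) (use g(2) in auto)
    finally show ?thesis by simp
  qed
qed

section \<open>Finite-state Markov processes\<close>

text \<open>Formulated with fibres being events, so that it applies to tuples and to whole grid
  paths without choosing a sigma-algebra on their type.\<close>

lemma (in prob_space) expectation_finite_valued:
  fixes f :: "'b \<Rightarrow> real"
  assumes S: "finite S" "\<And>\<omega>. \<omega> \<in> space M \<Longrightarrow> X \<omega> \<in> S"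
    and ev: "\<And>x. x \<in> S \<Longrightarrow> {\<omega>\<in>space M. X \<omega> = x} \<in> events"
  shows "integrable M (\<lambda>\<omega>. f (X \<omega>))"
    and "expectation (\<lambda>\<omega>. f (X \<omega>)) = (\<Sum>x\<in>S. f x * prob {\<omega>\<in>space M. X \<omega> = x})"
proof -
  have eq: "f (X \<omega>) = (\<Sum>x\<in>S. f x * indicator {\<omega>\<in>space M. X \<omega> = x} \<omega>)" if "\<omega> \<in> space M" for \<omega>
  proof -
    have "(\<Sum>x\<in>S. f x * indicator {\<omega>\<in>space M. X \<omega> = x} \<omega>) = (\<Sum>x\<in>S. if x = X \<omega> then f x else 0)"
      by (rule sum.cong) (use that in \<open>auto simp: indicator_def\<close>)
    then show ?thesis using S that by simp
  qed
  have i: "integrable M (\<lambda>\<omega>. f x * indicator {\<omega>\<in>space M. X \<omega> = x} \<omega>)" if "x \<in> S" for x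
    using ev[OF that] by (intro integrable_mult_right) (simp add: emeasure_eq_measure)
  have int: "integrable M (\<lambda>\<omega>. \<Sum>x\<in>S. f x * indicator {\<omega>\<in>space M. X \<omega> = x} \<omega>)"
    using i by (rule Bochner_Integration.integrable_sum)
  show "integrable M (\<lambda>\<omega>. f (X \<omega>))"
    using int by (subst Bochner_Integration.integrable_cong[OF refl eq]) auto
  have "expectation (\<lambda>\<omega>. f (X \<omega>)) = expectation (\<lambda>\<omega>. \<Sum>x\<in>S. f x * indicator {\<omega>\<in>space M. X \<omega> = x} \<omega>)"
    by (rule Bochner_Integration.integral_cong[OF refl eq])
  also have "\<dots> = (\<Sum>x\<in>S. expectation (\<lambda>\<omega>. f x * indicator {\<omega>\<in>space M. X \<omega> = x} \<omega>))"
    using i by (rule Bochner_Integration.integral_sum)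
  also have "\<dots> = (\<Sum>x\<in>S. f x * prob {\<omega>\<in>space M. X \<omega> = x})"
    using ev by (intro sum.cong) (auto simp: sets.sets_into_space Int_absorb2)
  finally show "expectation (\<lambda>\<omega>. f (X \<omega>)) = (\<Sum>x\<in>S. f x * prob {\<omega>\<in>space M. X \<omega> = x})" .
qed

text \<open>Transfers the error of a Riemann sum of the nonnegative reward rate to the exponential
  discount factor.\<close>

lemma exp_minus_lipschitz:
  fixes a b :: real
  assumes "0 \<le> a" "0 \<le> b"
  shows "\<bar>exp (- a) - exp (- b)\<bar> \<le> \<bar>a - b\<bar>"
proof -
  have *: "\<bar>exp (- x) - exp (- y)\<bar> \<le> \<bar>x - y\<bar>" if "0 \<le> x" "x \<le> y" for x y :: real
  proof -
    have "exp (- x) - exp (- y) = exp (- x) * (1 - exp (- (y - x)))"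
      by (simp add: algebra_simps flip: exp_add)
    also have "\<dots> \<le> 1 * (y - x)"
    proof (rule mult_mono)
      show "1 - exp (- (y - x)) \<le> y - x" using exp_ge_add_one_self[of "- (y - x)"] by linarith
    qed (use that in auto)
    finally show ?thesis using that by simp
  qed
  show ?thesis using *[of a b] *[of b a] assms by (cases "a \<le> b") (auto simp: abs_minus_commute)
qed

text \<open>One step of the Feynman-Kac argument: with x = d r, the discount exp (- x) cancels the
  growth factor 1 + x, which comes from G h = r h, up to second order.\<close>

lemma exp_minus_times_one_plus:
  fixes x :: real
  assumes "0 \<le> x"
  shows "\<bar>exp (- x) * (1 + x) - 1\<bar> \<le> x\<^sup>2"
proof -
  have "1 + x \<le> exp x" by (rule exp_ge_add_one_self)
  then have "exp (- x) * (1 + x) \<le> exp (- x) * exp x" by (rule mult_left_mono) simp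
  then have 1: "exp (- x) * (1 + x) \<le> 1" by (simp flip: exp_add)
  have "(1 - x) * (1 + x) \<le> exp (- x) * (1 + x)"
    using exp_ge_add_one_self[of "- x"] assms by (intro mult_right_mono) auto
  then have "1 - x\<^sup>2 \<le> exp (- x) * (1 + x)" by (simp add: algebra_simps power2_eq_square)
  then show ?thesis using 1 by linarith
qed

section \<open>The Markov property along a finite grid\<close>

locale finite_markov =
  fixes M :: "'w measure" and J :: "real \<Rightarrow> 'w \<Rightarrow> nat" and n :: nat and G :: "real mat"
  assumes markov: "markov_process M J n G"

sublocale finite_markov \<subseteq> prob_space M
  using markov unfolding markov_process_def by blast

context finite_markov
begin

lemma G_carrier: "G \<in> carrier_mat n n"
  using markov unfolding markov_process_def generator_matrix_def by blast

lemma J_measurable: "0 \<le> t \<Longrightarrow> J t \<in> measurable M (count_space {..<n})"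
  using markov unfolding markov_process_def by blast

lemma J_less: "0 \<le> t \<Longrightarrow> \<omega> \<in> space M \<Longrightarrow> J t \<omega> < n"
  using measurable_space[OF J_measurable] by fastforce

lemma J_right_continuous: "0 \<le> t \<Longrightarrow> \<omega> \<in> space M \<Longrightarrow> eventually (\<lambda>u. J u \<omega> = J t \<omega>) (at_right t)"
  using markov unfolding markov_process_def by blast

lemma J_pred: "0 \<le> t \<Longrightarrow> Measurable.pred M (\<lambda>\<omega>. P (J t \<omega>))"
  by (rule measurable_compose[OF J_measurable]) auto

lemma J_fun_measurable: "0 \<le> t \<Longrightarrow> (\<lambda>\<omega>. f (J t \<omega>) :: real) \<in> borel_measurable M"
  by (rule measurable_compose[OF J_measurable]) auto

lemma fun_bound: "i < n \<Longrightarrow> \<bar>f i :: real\<bar> \<le> (\<Sum>j<n. \<bar>f j\<bar>)"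
  by (rule member_le_sum) auto

lemma J_fun_bound: "0 \<le> t \<Longrightarrow> \<omega> \<in> space M \<Longrightarrow> \<bar>f (J t \<omega>) :: real\<bar> \<le> (\<Sum>j<n. \<bar>f j\<bar>)"
  by (intro fun_bound J_less)

lemma J_fun_integrable: "0 \<le> t \<Longrightarrow> integrable M (\<lambda>\<omega>. f (J t \<omega>) :: real)"
  by (rule integrable_const_bound[where B="\<Sum>j<n. \<bar>f j\<bar>"]) (auto simp: J_fun_bound J_fun_measurable)

definition trans_prob :: "real \<Rightarrow> nat \<Rightarrow> nat \<Rightarrow> real" where
  "trans_prob d i j = mat_exp (d \<cdot>\<^sub>m G) $$ (i, j)"

lemma J_event: "0 \<le> t \<Longrightarrow> {\<omega>\<in>space M. P (J t \<omega>)} \<in> events"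
  using J_pred[of t P] by (simp add: pred_def)

lemma path_event:
  assumes "\<And>l. l \<le> (k::nat) \<Longrightarrow> 0 \<le> t l"
  shows "{\<omega>\<in>space M. \<forall>l\<le>k. J (t l) \<omega> = x l} \<in> events"
proof -
  have "{\<omega>\<in>space M. \<forall>l\<le>k. J (t l) \<omega> = x l} = (\<Inter>l\<in>{..k}. {\<omega>\<in>space M. J (t l) \<omega> = x l})"
    by auto
  moreover have "\<dots> \<in> events"
    by (rule sets.finite_INT) (use assms in \<open>auto intro: J_event\<close>)
  ultimately show ?thesis by simp
qed

lemma increasing_nonneg:
  fixes t :: "nat \<Rightarrow> real"
  assumes "0 \<le> t 0" "\<And>l. l \<le> k \<Longrightarrow> t l < t (Suc l)" "l \<le> Suc k"
  shows "0 \<le> t l"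
  using assms(3)
proof (induction l)
  case 0
  then show ?case using assms(1) by simp
next
  case (Suc l)
  then show ?case using assms(2)[of l] by simp
qed

text \<open>The product form extends the Markov property to conditioning events of probability 0,
  about which \<open>markov_process\<close> says nothing: there both sides vanish.\<close>

lemma path_prob_Suc:
  assumes t: "0 \<le> t 0" "\<And>l. l \<le> k \<Longrightarrow> t l < t (Suc l)" and x: "\<And>l. l \<le> Suc k \<Longrightarrow> x l < n"
  shows "prob {\<omega>\<in>space M. \<forall>l\<le>Suc k. J (t l) \<omega> = x l}
    = prob {\<omega>\<in>space M. \<forall>l\<le>k. J (t l) \<omega> = x l} * trans_prob (t (Suc k) - t k) (x k) (x (Suc k))"
proof -
  let ?P = "{\<omega>\<in>space M. \<forall>l\<le>k. J (t l) \<omega> = x l}"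
  let ?P' = "{\<omega>\<in>space M. \<forall>l\<le>Suc k. J (t l) \<omega> = x l}"
  have nn: "l \<le> Suc k \<Longrightarrow> 0 \<le> t l" for l by (rule increasing_nonneg[of t k, OF t])
  have ev: "?P \<in> events" by (rule path_event) (simp add: nn)
  have sub: "?P' \<subseteq> ?P" by auto
  show ?thesis
  proof (cases "prob ?P > 0")
    case True
    have c: "\<P>(\<omega> in M. J (t (Suc k)) \<omega> = x (Suc k) \<bar> \<forall>l\<le>k. J (t l) \<omega> = x l)
        = trans_prob (t (Suc k) - t k) (x k) (x (Suc k))"
      unfolding trans_prob_def
      using markov[unfolded markov_process_def, THEN conjunct2, THEN conjunct2, THEN conjunct2, THEN conjunct2,
          THEN spec[of _ k], THEN spec[of _ t], THEN spec[of _ x], THEN mp, THEN mp, THEN mp, THEN mp] t x True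
      by simp
    have "{\<omega>\<in>space M. J (t (Suc k)) \<omega> = x (Suc k) \<and> (\<forall>l\<le>k. J (t l) \<omega> = x l)} = ?P'"
      by (auto simp: le_Suc_eq)
    with c True show ?thesis unfolding cond_prob_def by (simp add: field_simps)
  next
    case False
    then have z: "prob ?P = 0" using measure_nonneg[of M ?P] by linarith
    have "prob ?P' \<le> prob ?P" by (rule finite_measure_mono[OF sub ev])
    then show ?thesis using z measure_nonneg[of M ?P'] by simp
  qed
qed

text \<open>Restricting the path to the grid indices makes it an element of the finite set of
  functions from \<open>{..k}\<close> to states, so the expectations are finite sums over paths and
  the product formula applies to each summand.\<close>

lemma markov_expectation:
  fixes F :: "(nat \<Rightarrow> nat) \<Rightarrow> real" and g :: "nat \<Rightarrow> real"
  assumes t: "0 \<le> t 0" "\<And>l. l \<le> k \<Longrightarrow> t l < t (Suc l)"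
  defines "X \<equiv> \<lambda>\<omega>. restrict (\<lambda>l. J (t l) \<omega>) {..k}"
  shows "integrable M (\<lambda>\<omega>. F (X \<omega>) * g (J (t (Suc k)) \<omega>))"
    and "integrable M (\<lambda>\<omega>. F (X \<omega>) * g (J (t k) \<omega>))"
    and "expectation (\<lambda>\<omega>. F (X \<omega>) * g (J (t (Suc k)) \<omega>))
      = expectation (\<lambda>\<omega>. F (X \<omega>) * (\<Sum>y<n. trans_prob (t (Suc k) - t k) (J (t k) \<omega>) y * g y))"
proof -
  let ?d = "t (Suc k) - t k"
  let ?S = "PiE {..k} (\<lambda>_. {..<n})"
  have nn: "l \<le> Suc k \<Longrightarrow> 0 \<le> t l" for l by (rule increasing_nonneg[of t k, OF t])
  have finS: "finite ?S" by (intro finite_PiE) auto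
  have XS: "X \<omega> \<in> ?S" if "\<omega> \<in> space M" for \<omega>
    using that nn by (simp add: X_def restrict_PiE_iff J_less)
  have Xeq: "X \<omega> = x \<longleftrightarrow> (\<forall>l\<le>k. J (t l) \<omega> = x l)" if "x \<in> ?S" for \<omega> x
  proof
    assume "\<forall>l\<le>k. J (t l) \<omega> = x l"
    then show "X \<omega> = x" using that unfolding X_def by (intro extensionalityI[of _ "{..k}"]) (auto simp: PiE_def)
  next
    assume "X \<omega> = x"
    then show "\<forall>l\<le>k. J (t l) \<omega> = x l" unfolding X_def by (metis atMost_iff restrict_apply')
  qed
  have evX: "{\<omega>\<in>space M. X \<omega> = x} \<in> events" if "x \<in> ?S" for x
    unfolding Xeq[OF that] by (rule path_event) (simp add: nn)
  have pair: "{\<omega>\<in>space M. (X \<omega>, J (t (Suc k)) \<omega>) = (x, y)}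
      = {\<omega>\<in>space M. \<forall>l\<le>Suc k. J (t l) \<omega> = (if l = Suc k then y else x l)}" if "x \<in> ?S" for x y
    using Xeq[OF that] by (auto simp: le_Suc_eq)
  have evP: "{\<omega>\<in>space M. (X \<omega>, J (t (Suc k)) \<omega>) = z} \<in> events" if "z \<in> ?S \<times> {..<n}" for z
  proof -
    have x: "fst z \<in> ?S" using that by (simp add: mem_Times_iff)
    show ?thesis
      using pair[OF x, of "snd z"] path_event[of "Suc k" t "\<lambda>l. if l = Suc k then snd z else fst z l"] nn
      by (simp only: prod.collapse)
  qed
  have probP: "prob {\<omega>\<in>space M. (X \<omega>, J (t (Suc k)) \<omega>) = (x, y)} = prob {\<omega>\<in>space M. X \<omega> = x} * trans_prob ?d (x k) y"
    if x: "x \<in> ?S" and y: "y < n" for x y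
  proof -
    have "prob {\<omega>\<in>space M. \<forall>l\<le>k. J (t l) \<omega> = (if l = Suc k then y else x l)} = prob {\<omega>\<in>space M. X \<omega> = x}"
      unfolding Xeq[OF x] by (rule arg_cong[where f=prob]) auto
    moreover have "(if l = Suc k then y else x l) < n" if "l \<le> Suc k" for l
      using x y that by (auto simp: le_Suc_eq PiE_def Pi_def)
    ultimately show ?thesis
      unfolding pair[OF x] by (subst path_prob_Suc[OF t]) auto
  qed
  note E2 = expectation_finite_valued[where X="\<lambda>\<omega>. (X \<omega>, J (t (Suc k)) \<omega>)" and S="?S \<times> {..<n}"
      and f="\<lambda>z. F (fst z) * g (snd z)"]
  note E1 = expectation_finite_valued[where X=X and S="?S"]
  show "integrable M (\<lambda>\<omega>. F (X \<omega>) * g (J (t (Suc k)) \<omega>))"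
    using E2(1) finS XS evP J_less nn by simp
  have Xk: "X \<omega> k = J (t k) \<omega>" for \<omega> by (simp add: X_def)
  show "integrable M (\<lambda>\<omega>. F (X \<omega>) * g (J (t k) \<omega>))"
    using E1(1)[where f="\<lambda>x. F x * g (x k)", OF finS XS evX] by (simp add: Xk)
  have "expectation (\<lambda>\<omega>. F (X \<omega>) * g (J (t (Suc k)) \<omega>))
      = (\<Sum>z\<in>?S \<times> {..<n}. F (fst z) * g (snd z) * prob {\<omega>\<in>space M. (X \<omega>, J (t (Suc k)) \<omega>) = z})"
    using E2(2) finS XS evP J_less nn by simp
  also have "\<dots> = (\<Sum>x\<in>?S. \<Sum>y<n. F x * g y * (prob {\<omega>\<in>space M. X \<omega> = x} * trans_prob ?d (x k) y))"
    unfolding sum.cartesian_product' fst_conv snd_conv by (intro sum.cong refl) (simp only: probP lessThan_iff)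
  also have "\<dots> = (\<Sum>x\<in>?S. (F x * (\<Sum>y<n. trans_prob ?d (x k) y * g y)) * prob {\<omega>\<in>space M. X \<omega> = x})"
    by (simp add: sum_distrib_left sum_distrib_right mult_ac)
  also have "\<dots> = expectation (\<lambda>\<omega>. F (X \<omega>) * (\<Sum>y<n. trans_prob ?d (X \<omega> k) y * g y))"
    by (rule E1(2)[where f="\<lambda>x. F x * (\<Sum>y<n. trans_prob ?d (x k) y * g y)", OF finS XS evX, symmetric])
  finally show "expectation (\<lambda>\<omega>. F (X \<omega>) * g (J (t (Suc k)) \<omega>))
      = expectation (\<lambda>\<omega>. F (X \<omega>) * (\<Sum>y<n. trans_prob ?d (J (t k) \<omega>) y * g y))"
    unfolding Xk .
qed

definition taylor_const where "taylor_const = exp (mat_bound G)"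

lemma taylor_const_pos: "taylor_const > 0" by (simp add: taylor_const_def)

lemma trans_prob_second_order:
  assumes "0 \<le> d" "d \<le> 1" "i < n"
  shows "\<bar>(\<Sum>y<n. trans_prob d i y * g y) - (g i + d * (\<Sum>y<n. G $$ (i, y) * g y))\<bar> \<le> d\<^sup>2 * (taylor_const * (\<Sum>y<n. \<bar>g y\<bar>))"
proof -
  have gi: "g i = (\<Sum>y<n. (if i = y then 1 else 0) * g y)"
    using assms(3) by (simp add: if_distrib[where f="\<lambda>x. x * _"] cong: if_cong)
  have "(\<Sum>y<n. trans_prob d i y * g y) - (g i + d * (\<Sum>y<n. G $$ (i, y) * g y))
      = (\<Sum>y<n. (trans_prob d i y - (if i = y then 1 else 0) - d * G $$ (i, y)) * g y)"
    unfolding gi by (simp add: algebra_simps sum_distrib_left sum_subtractf sum.distrib)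
  also have "\<bar>\<dots>\<bar> \<le> (\<Sum>y<n. \<bar>(trans_prob d i y - (if i = y then 1 else 0) - d * G $$ (i, y)) * g y\<bar>)"
    by (rule sum_abs)
  also have "\<dots> \<le> (\<Sum>y<n. (d\<^sup>2 * taylor_const) * \<bar>g y\<bar>)"
    unfolding abs_mult trans_prob_def taylor_const_def
    by (intro sum_mono mult_right_mono mat_exp_second_order[OF G_carrier]) (use assms in auto)
  finally show ?thesis by (simp add: sum_distrib_left mult_ac)
qed

text \<open>The infinitesimal form of the Markov property: replace g at the next time by g + d G g
  at the present one. The error does not depend on the functional F of the past, as long as F is
  bounded by 1.\<close>

lemma markov_expectation_approx:
  fixes F :: "(nat \<Rightarrow> nat) \<Rightarrow> real" and g :: "nat \<Rightarrow> real"
  assumes t: "0 \<le> t 0" "\<And>l. l \<le> k \<Longrightarrow> t l < t (Suc l)" and F: "\<And>x. \<bar>F x\<bar> \<le> 1"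
    and d: "d = t (Suc k) - t k" "d \<le> 1"
  defines "X \<equiv> \<lambda>\<omega>. restrict (\<lambda>l. J (t l) \<omega>) {..k}"
  shows "\<bar>expectation (\<lambda>\<omega>. F (X \<omega>) * g (J (t (Suc k)) \<omega>))
      - expectation (\<lambda>\<omega>. F (X \<omega>) * (g (J (t k) \<omega>) + d * (\<Sum>y<n. G $$ (J (t k) \<omega>, y) * g y)))\<bar>
      \<le> d\<^sup>2 * (taylor_const * (\<Sum>y<n. \<bar>g y\<bar>))"
proof -
  have d0: "0 \<le> d" using t(2)[of k] d by simp
  have nn: "0 \<le> t k" using increasing_nonneg[of t k k, OF t] by simp
  define u v where "u i = (\<Sum>y<n. trans_prob d i y * g y)" and "v i = g i + d * (\<Sum>y<n. G $$ (i, y) * g y)" for i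
  have int: "integrable M (\<lambda>\<omega>. F (X \<omega>) * w (J (t k) \<omega>))" for w :: "nat \<Rightarrow> real"
    unfolding X_def by (rule markov_expectation(2)[of t k F w, OF t])
  note iu = int[of u] and iv = int[of v]
  have "\<bar>expectation (\<lambda>\<omega>. F (X \<omega>) * u (J (t k) \<omega>)) - expectation (\<lambda>\<omega>. F (X \<omega>) * v (J (t k) \<omega>))\<bar>
      = \<bar>expectation (\<lambda>\<omega>. F (X \<omega>) * u (J (t k) \<omega>) - F (X \<omega>) * v (J (t k) \<omega>))\<bar>"
    using iu iv by simp
  also have "\<dots> \<le> expectation (\<lambda>\<omega>. \<bar>F (X \<omega>) * u (J (t k) \<omega>) - F (X \<omega>) * v (J (t k) \<omega>)\<bar>)"
    by (rule integral_abs_bound)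
  also have "\<dots> \<le> expectation (\<lambda>\<omega>. d\<^sup>2 * (taylor_const * (\<Sum>y<n. \<bar>g y\<bar>)))"
  proof (rule integral_mono)
    fix \<omega> assume "\<omega> \<in> space M"
    then have "J (t k) \<omega> < n" using J_less nn by blast
    have "\<bar>F (X \<omega>) * u (J (t k) \<omega>) - F (X \<omega>) * v (J (t k) \<omega>)\<bar> = \<bar>F (X \<omega>)\<bar> * \<bar>u (J (t k) \<omega>) - v (J (t k) \<omega>)\<bar>"
      by (simp add: abs_mult flip: right_diff_distrib)
    also have "\<dots> \<le> 1 * (d\<^sup>2 * (taylor_const * (\<Sum>y<n. \<bar>g y\<bar>)))"
      unfolding u_def v_def
      by (intro mult_mono F trans_prob_second_order d0 d \<open>J (t k) \<omega> < n\<close>) auto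
    finally show "\<bar>F (X \<omega>) * u (J (t k) \<omega>) - F (X \<omega>) * v (J (t k) \<omega>)\<bar> \<le> d\<^sup>2 * (taylor_const * (\<Sum>y<n. \<bar>g y\<bar>))" by simp
  qed (use iu iv in auto)
  finally have "\<bar>expectation (\<lambda>\<omega>. F (X \<omega>) * u (J (t k) \<omega>)) - expectation (\<lambda>\<omega>. F (X \<omega>) * v (J (t k) \<omega>))\<bar>
      \<le> d\<^sup>2 * (taylor_const * (\<Sum>y<n. \<bar>g y\<bar>))" by (simp add: prob_space)
  then show ?thesis
    unfolding X_def u_def v_def d(1) by (subst markov_expectation(3)[OF t]) auto
qed

section \<open>Jumps and integrals along paths\<close>

lemma two_point_prob:
  assumes "0 \<le> u" "u < v" "i < n" "j < n"
  shows "prob {\<omega>\<in>space M. J u \<omega> = i \<and> J v \<omega> = j} = prob {\<omega>\<in>space M. J u \<omega> = i} * trans_prob (v - u) i j"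
proof -
  have e1: "{\<omega>\<in>space M. \<forall>l\<le>Suc 0. J (if l = 0 then u else v) \<omega> = (if l = 0 then i else j)}
    = {\<omega>\<in>space M. J u \<omega> = i \<and> J v \<omega> = j}"
    by (auto simp: le_Suc_eq)
  show ?thesis
    using path_prob_Suc[where k=0 and t="\<lambda>l. if l = 0 then u else v" and x="\<lambda>l. if l = 0 then i else j"] assms
    unfolding e1 by simp
qed

lemma two_point_expectation:
  assumes "0 \<le> u" "u < v"
  shows "expectation (\<lambda>\<omega>. f (J u \<omega>) (J v \<omega>)) = (\<Sum>i<n. \<Sum>j<n. f i j * (prob {\<omega>\<in>space M. J u \<omega> = i} * trans_prob (v - u) i j))"
proof -
  have v: "0 \<le> v" using assms by simp
  have ev: "{\<omega>\<in>space M. (J u \<omega>, J v \<omega>) = (i, j)} \<in> events" for i j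
  proof -
    have "{\<omega>\<in>space M. (J u \<omega>, J v \<omega>) = (i, j)} = {\<omega>\<in>space M. J u \<omega> = i} \<inter> {\<omega>\<in>space M. J v \<omega> = j}" by auto
    then show ?thesis using J_event[OF assms(1), of "\<lambda>x. x = i"] J_event[OF v, of "\<lambda>x. x = j"]
      by (simp only: sets.Int)
  qed
  have "expectation (\<lambda>\<omega>. f (J u \<omega>) (J v \<omega>))
      = (\<Sum>z\<in>{..<n} \<times> {..<n}. f (fst z) (snd z) * prob {\<omega>\<in>space M. (J u \<omega>, J v \<omega>) = z})"
    by (rule expectation_finite_valued(2)[where X="\<lambda>\<omega>. (J u \<omega>, J v \<omega>)" and S="{..<n} \<times> {..<n}"
      and f="\<lambda>z. f (fst z) (snd z)", unfolded fst_conv snd_conv])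
      (use J_less[OF assms(1)] J_less[OF v] ev in \<open>auto simp del: prod.inject\<close>)
  also have "\<dots> = (\<Sum>i<n. \<Sum>j<n. f i j * prob {\<omega>\<in>space M. J u \<omega> = i \<and> J v \<omega> = j})"
    by (simp add: sum.cartesian_product')
  also have "\<dots> = (\<Sum>i<n. \<Sum>j<n. f i j * (prob {\<omega>\<in>space M. J u \<omega> = i} * trans_prob (v - u) i j))"
    by (auto intro!: sum.cong simp: two_point_prob[OF assms])
  finally show ?thesis .
qed

definition C_jump where "C_jump = (\<Sum>i<n. \<Sum>j<n. \<bar>G $$ (i, j)\<bar> + taylor_const)"

lemma C_jump_nonneg: "0 \<le> C_jump"
  unfolding C_jump_def using taylor_const_pos by (intro sum_nonneg) auto

text \<open>Off the diagonal the identity matrix drops out of the expansion of exp((v - u)G),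
  leaving entries of order v - u. Only the two endpoints are compared, so nothing about the path in
  between enters.\<close>

lemma jump_prob:
  assumes "0 \<le> u" "u < v" "v \<le> u + 1"
  shows "expectation (\<lambda>\<omega>. if J u \<omega> = J v \<omega> then 0 else 1) \<le> C_jump * (v - u)"
proof -
  let ?d = "v - u"
  have "expectation (\<lambda>\<omega>. if J u \<omega> = J v \<omega> then 0 else 1)
     = (\<Sum>i<n. \<Sum>j<n. (if i = j then 0 else 1) * (prob {\<omega>\<in>space M. J u \<omega> = i} * trans_prob ?d i j))"
    by (rule two_point_expectation[OF assms(1,2)])
  also have "\<dots> \<le> (\<Sum>i<n. \<Sum>j<n. (\<bar>G $$ (i, j)\<bar> + taylor_const) * ?d)"
  proof (intro sum_mono)
    fix i j assume ij: "i \<in> {..<n}" "j \<in> {..<n}"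
    show "(if i = j then 0 else 1) * (prob {\<omega>\<in>space M. J u \<omega> = i} * trans_prob ?d i j) \<le> (\<bar>G $$ (i, j)\<bar> + taylor_const) * ?d"
    proof (cases "i = j")
      case True
      then show ?thesis using assms taylor_const_pos by simp
    next
      case False
      have "\<bar>trans_prob ?d i j - (if i = j then 1 else 0) - ?d * G $$ (i, j)\<bar> \<le> ?d\<^sup>2 * taylor_const"
        unfolding trans_prob_def taylor_const_def by (rule mat_exp_second_order[OF G_carrier]) (use assms ij in auto)
      moreover have "?d\<^sup>2 * taylor_const \<le> ?d * taylor_const"
        using assms taylor_const_pos by (intro mult_right_mono) (auto simp: power2_eq_square mult_left_le)
      moreover have "?d * G $$ (i, j) \<le> ?d * \<bar>G $$ (i, j)\<bar>"
        using assms by (intro mult_left_mono) auto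
      ultimately have pb: "trans_prob ?d i j \<le> (\<bar>G $$ (i, j)\<bar> + taylor_const) * ?d"
        using False by (simp add: algebra_simps)
      have "prob {\<omega>\<in>space M. J u \<omega> = i} * trans_prob ?d i j \<le> prob {\<omega>\<in>space M. J u \<omega> = i} * ((\<bar>G $$ (i, j)\<bar> + taylor_const) * ?d)"
        by (rule mult_left_mono[OF pb]) simp
      also have "\<dots> \<le> 1 * ((\<bar>G $$ (i, j)\<bar> + taylor_const) * ?d)"
        using assms taylor_const_pos by (intro mult_right_mono) auto
      finally show ?thesis using False by simp
    qed
  qed
  finally show ?thesis by (simp add: C_jump_def sum_distrib_right)
qed

text \<open>Sampling at the times \<open>(\<lfloor>k u\<rfloor> + 1) / k\<close>, which decrease to \<open>u\<close>, reduces joint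
  measurability to the measurability of countably many of the \<open>J t\<close>.\<close>

lemma J_joint_measurable:
  fixes f :: "nat \<Rightarrow> real"
  shows "(\<lambda>z. f (J (max 0 (snd z)) (fst z))) \<in> borel_measurable (M \<Otimes>\<^sub>M borel)"
proof (rule borel_measurable_LIMSEQ_real)
  define T where "T j u = (real (nat \<lfloor>max 0 u * real (Suc j)\<rfloor>) + 1) / real (Suc j)" for j :: nat and u :: real
  show "(\<lambda>j. f (J (T j (snd z)) (fst z))) \<longlonglongrightarrow> f (J (max 0 (snd z)) (fst z))"
    if "z \<in> space (M \<Otimes>\<^sub>M borel)" for z
  proof -
    have w: "fst z \<in> space M" using that by (auto simp: space_pair_measure)
    let ?u = "max 0 (snd z)"
    have T1: "T j (snd z) > ?u" for j
    proof -
      have "?u * real (Suc j) < real (nat \<lfloor>?u * real (Suc j)\<rfloor>) + 1" by linarith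
      then show ?thesis unfolding T_def
        by (subst pos_less_divide_eq[OF of_nat_0_less_iff[THEN iffD2, OF zero_less_Suc]])
    qed
    have T2: "T j (snd z) \<le> ?u + 1 / real (Suc j)" for j
    proof -
      have "0 \<le> ?u * real (Suc j)" by simp
      then have "real (nat \<lfloor>?u * real (Suc j)\<rfloor>) + 1 \<le> ?u * real (Suc j) + 1" by linarith
      then have "T j (snd z) \<le> (?u * real (Suc j) + 1) / real (Suc j)"
        unfolding T_def by (rule divide_right_mono) simp
      also have "\<dots> = ?u + 1 / real (Suc j)" by (simp add: add_divide_distrib)
      finally show ?thesis .
    qed
    obtain b where b: "b > ?u" "\<And>y. ?u < y \<Longrightarrow> y < b \<Longrightarrow> J y (fst z) = J ?u (fst z)"
      using J_right_continuous[of ?u "fst z"] w unfolding eventually_at_right_field by auto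
    have "eventually (\<lambda>j. inverse (real (Suc j)) < b - ?u) sequentially"
      using order_tendstoD(2)[OF LIMSEQ_inverse_real_of_nat] b(1) by simp
    then have "eventually (\<lambda>j. f (J (T j (snd z)) (fst z)) = f (J ?u (fst z))) sequentially"
    proof eventually_elim
      case (elim j)
      then have "T j (snd z) < b" using T2[of j] unfolding inverse_eq_divide by linarith
      then show ?case using b(2)[OF T1[of j]] by simp
    qed
    then show ?thesis by (rule tendsto_eventually)
  qed
  show "(\<lambda>z. f (J (T j (snd z)) (fst z))) \<in> borel_measurable (M \<Otimes>\<^sub>M borel)" for j
    unfolding T_def
  proof (rule measurable_compose_countable[where f="\<lambda>k z. f (J ((real k + 1) / real (Suc j)) (fst z))"])
    show "(\<lambda>z. f (J ((real k + 1) / real (Suc j)) (fst z))) \<in> borel_measurable (M \<Otimes>\<^sub>M borel)" for k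
      by (rule measurable_compose[OF measurable_fst J_fun_measurable]) simp
    show "(\<lambda>z. nat \<lfloor>max 0 (snd z) * real (Suc j)\<rfloor>) \<in> measurable (M \<Otimes>\<^sub>M borel) (count_space UNIV)"
      by measurable
  qed
qed

lemma J_joint_measurable':
  fixes f :: "nat \<Rightarrow> real"
  assumes "g \<in> measurable N M" "h \<in> borel_measurable N"
  shows "(\<lambda>z. f (J (max 0 (h z)) (g z))) \<in> borel_measurable N"
  using measurable_compose[OF measurable_Pair[OF assms] J_joint_measurable] by simp

lemma J_path_measurable:
  fixes f :: "nat \<Rightarrow> real"
  assumes "\<omega> \<in> space M"
  shows "(\<lambda>u. f (J (max 0 u) \<omega>)) \<in> borel_measurable borel"
  by (rule J_joint_measurable') (use assms in auto)

text \<open>The argument \<open>max 0 u\<close> keeps the integrand measurable, since nothing is known about \<open>J\<close> at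
  negative times.\<close>

definition acc :: "(nat \<Rightarrow> real) \<Rightarrow> real \<Rightarrow> real \<Rightarrow> 'w \<Rightarrow> real" where
  "acc f a b \<omega> = (\<integral>u. indicator {a..<b} u * f (J (max 0 u) \<omega>) \<partial>lborel)"

lemma acc_measurable [measurable]: "acc f a b \<in> borel_measurable M"
proof -
  note [measurable (raw)] = J_joint_measurable'[where f=f]
  show ?thesis unfolding acc_def by measurable
qed

lemma acc_integrable:
  fixes f :: "nat \<Rightarrow> real"
  assumes "\<omega> \<in> space M"
  shows "integrable lborel (\<lambda>u. indicator {a..<b} u * f (J (max 0 u) \<omega>))"
proof (rule integrableI_bounded_set[where A="{a..<b}" and B="\<Sum>j<n. \<bar>f j\<bar>"])
  note [measurable] = J_path_measurable[OF assms, of f]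
  show "(\<lambda>u. indicator {a..<b} u * f (J (max 0 u) \<omega>)) \<in> borel_measurable lborel" by measurable
  show "AE x in lborel. x \<in> {a..<b} \<longrightarrow> norm (indicator {a..<b} x * f (J (max 0 x) \<omega>)) \<le> (\<Sum>j<n. \<bar>f j\<bar>)"
    using assms by (auto simp: J_fun_bound)
  show "emeasure lborel {a..<b} < \<infinity>" by (cases "a \<le> b") auto
qed auto

lemma acc_add:
  assumes "\<omega> \<in> space M" "a \<le> b" "b \<le> c"
  shows "acc f a c \<omega> = acc f a b \<omega> + acc f b c \<omega>"
proof -
  have "indicator {a..<c} u * f (J (max 0 u) \<omega>)
      = indicator {a..<b} u * f (J (max 0 u) \<omega>) + indicator {b..<c} u * f (J (max 0 u) \<omega>)" for u
    using assms(2,3) by (auto simp: indicator_def)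
  then show ?thesis
    unfolding acc_def by (simp add: Bochner_Integration.integral_add acc_integrable[OF assms(1)])
qed

lemma acc_linear:
  assumes "\<omega> \<in> space M"
  shows "acc (\<lambda>i. x * f i + y * g i) a b \<omega> = x * acc f a b \<omega> + y * acc g a b \<omega>"
proof -
  have "indicator {a..<b} u * (x * f (J (max 0 u) \<omega>) + y * g (J (max 0 u) \<omega>))
      = x * (indicator {a..<b} u * f (J (max 0 u) \<omega>)) + y * (indicator {a..<b} u * g (J (max 0 u) \<omega>))" for u
    by (simp add: algebra_simps)
  then show ?thesis
    unfolding acc_def by (simp add: Bochner_Integration.integral_add acc_integrable[OF assms(1)])
qed

lemma acc_nonneg:
  assumes "\<omega> \<in> space M" "\<And>i. i < n \<Longrightarrow> 0 \<le> f i"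
  shows "0 \<le> acc f a b \<omega>"
  unfolding acc_def by (rule Bochner_Integration.integral_nonneg) (use assms in \<open>auto simp: indicator_def J_less\<close>)

lemma acc_bound:
  assumes "\<omega> \<in> space M" "a \<le> b"
  shows "\<bar>acc f a b \<omega>\<bar> \<le> (b - a) * (\<Sum>j<n. \<bar>f j\<bar>)"
proof -
  have "\<bar>acc f a b \<omega>\<bar> \<le> (\<integral>u. \<bar>indicator {a..<b} u * f (J (max 0 u) \<omega>)\<bar> \<partial>lborel)"
    unfolding acc_def by (rule integral_abs_bound)
  also have "\<dots> \<le> (\<integral>u. indicator {a..<b} u * (\<Sum>j<n. \<bar>f j\<bar>) \<partial>lborel)"
  proof (rule integral_mono)
    show "integrable lborel (\<lambda>u. \<bar>indicator {a..<b} u * f (J (max 0 u) \<omega>)\<bar>)"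
      by (rule integrable_abs[OF acc_integrable[OF assms(1)]])
    show "integrable lborel (\<lambda>u. indicator {a..<b} u * (\<Sum>j<n. \<bar>f j\<bar>))"
      by (intro integrable_mult_left) (use assms in auto)
    show "\<bar>indicator {a..<b} u * f (J (max 0 u) \<omega>)\<bar> \<le> indicator {a..<b} u * (\<Sum>j<n. \<bar>f j\<bar>)" for u
      using J_fun_bound[of "max 0 u" \<omega> f] assms(1) by (auto simp: indicator_def)
  qed
  finally show ?thesis using assms(2) by simp
qed

lemma acc_integrable_M:
  assumes "a \<le> b"
  shows "integrable M (acc f a b)"
  by (rule integrable_const_bound[where B="(b - a) * (\<Sum>j<n. \<bar>f j\<bar>)"]) (auto simp: acc_bound assms)

text \<open>By Fubini the error is at most the integral over u of the expectation of |f (J u) - f (J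
  a)|. This difference is at most 2K and nonzero only if J has changed, an event of probability at
  most \<open>C_jump * d\<close>; the interval contributes another factor d.\<close>

lemma acc_approx:
  assumes a: "0 \<le> a" and d: "0 < d" "d \<le> 1"
  shows "expectation (\<lambda>\<omega>. \<bar>acc f a (a + d) \<omega> - d * f (J a \<omega>)\<bar>) \<le> 2 * (\<Sum>j<n. \<bar>f j\<bar>) * C_jump * d\<^sup>2"
proof -
  define K where "K = (\<Sum>j<n. \<bar>f j\<bar>)"
  have K: "0 \<le> K" unfolding K_def by (intro sum_nonneg) auto
  define q where "q \<omega> u = indicator {a..<a+d} u * \<bar>f (J (max 0 u) \<omega>) - f (J a \<omega>)\<bar>" for \<omega> u
  interpret P: pair_sigma_finite M lborel ..
  note [measurable (raw)] = J_joint_measurable'[where f=f]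
  have Ja: "J a \<omega> = J (max 0 a) \<omega>" for \<omega> using a by simp
  have [measurable]: "case_prod q \<in> borel_measurable (M \<Otimes>\<^sub>M lborel)"
    unfolding q_def Ja by measurable
  have qb: "q \<omega> u \<le> indicator {a..<a+d} u * (2 * K)" if "\<omega> \<in> space M" for \<omega> u
    using J_fun_bound[of "max 0 u" \<omega> f] J_fun_bound[of a \<omega> f] that a
    by (auto simp: q_def indicator_def K_def)
  have q0: "0 \<le> q \<omega> u" for \<omega> u by (auto simp: q_def)
  have int: "integrable (M \<Otimes>\<^sub>M lborel) (case_prod q)"
  proof (rule integrableI_bounded_set[where A="space M \<times> {a..<a+d}" and B="2 * K"])
    show "emeasure (M \<Otimes>\<^sub>M lborel) (space M \<times> {a..<a + d}) < \<infinity>"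
      by (subst lborel.emeasure_pair_measure_Times) (use d in \<open>auto simp: emeasure_space_1\<close>)
    show "AE x in M \<Otimes>\<^sub>M lborel. x \<in> space M \<times> {a..<a + d} \<longrightarrow> norm (case x of (\<omega>, u) \<Rightarrow> q \<omega> u) \<le> 2 * K"
    proof (rule AE_I2, clarify)
      fix \<omega> u assume "\<omega> \<in> space M" "u \<in> {a..<a + d}"
      then show "norm (q \<omega> u) \<le> 2 * K" using qb[of \<omega> u] q0[of \<omega> u] by simp
    qed
    show "AE x in M \<Otimes>\<^sub>M lborel. x \<notin> space M \<times> {a..<a + d} \<longrightarrow> (case x of (\<omega>, u) \<Rightarrow> q \<omega> u) = 0"
      by (rule AE_I2) (auto simp: space_pair_measure q_def indicator_def)
  qed (auto intro!: pair_measureI)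
  have pw: "\<bar>acc f a (a + d) \<omega> - d * f (J a \<omega>)\<bar> \<le> (\<integral>u. q \<omega> u \<partial>lborel)" if \<omega>: "\<omega> \<in> space M" for \<omega>
  proof -
    have i2: "integrable lborel (\<lambda>u. indicator {a..<a+d} u * f (J a \<omega>))" by (intro integrable_mult_left) (use d in auto)
    have "d * f (J a \<omega>) = (\<integral>u. indicator {a..<a+d} u * f (J a \<omega>) \<partial>lborel)" using d by simp
    then have diff: "acc f a (a + d) \<omega> - d * f (J a \<omega>)
        = (\<integral>u. indicator {a..<a+d} u * f (J (max 0 u) \<omega>) - indicator {a..<a+d} u * f (J a \<omega>) \<partial>lborel)"
      unfolding acc_def by (subst Bochner_Integration.integral_diff[OF acc_integrable[OF \<omega>] i2]) simp
    have "\<bar>acc f a (a + d) \<omega> - d * f (J a \<omega>)\<bar>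
        \<le> (\<integral>u. \<bar>indicator {a..<a+d} u * f (J (max 0 u) \<omega>) - indicator {a..<a+d} u * f (J a \<omega>)\<bar> \<partial>lborel)"
      unfolding diff by (rule integral_abs_bound)
    also have "\<dots> = (\<integral>u. q \<omega> u \<partial>lborel)"
    proof (rule Bochner_Integration.integral_cong[OF refl])
      fix u
      show "\<bar>indicator {a..<a+d} u * f (J (max 0 u) \<omega>) - indicator {a..<a+d} u * f (J a \<omega>)\<bar> = q \<omega> u"
        by (cases "u \<in> {a..<a+d}") (simp_all add: q_def)
    qed
    finally show ?thesis .
  qed
  have "expectation (\<lambda>\<omega>. \<bar>acc f a (a + d) \<omega> - d * f (J a \<omega>)\<bar>) \<le> expectation (\<lambda>\<omega>. \<integral>u. q \<omega> u \<partial>lborel)"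
  proof (rule integral_mono)
    show "integrable M (\<lambda>\<omega>. \<bar>acc f a (a + d) \<omega> - d * f (J a \<omega>)\<bar>)"
      by (intro integrable_abs Bochner_Integration.integrable_diff acc_integrable_M integrable_mult_right J_fun_integrable) (use a d in auto)
    show "integrable M (\<lambda>\<omega>. \<integral>u. q \<omega> u \<partial>lborel)"
      using P.integrable_fst[OF int] by simp
  qed (rule pw)
  also have "\<dots> = (\<integral>u. expectation (\<lambda>\<omega>. q \<omega> u) \<partial>lborel)"
    by (rule P.Fubini_integral[OF int, symmetric])
  also have "\<dots> \<le> (\<integral>u. indicator {a..<a+d} u * (2 * K * C_jump * d) \<partial>lborel)"
  proof (rule integral_mono)
    show "integrable lborel (\<lambda>u. expectation (\<lambda>\<omega>. q \<omega> u))"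
      using P.integrable_snd[OF int] by simp
    show "integrable lborel (\<lambda>u. indicator {a..<a+d} u * (2 * K * C_jump * d))"
      by (intro integrable_mult_left) (use d in auto)
    fix u :: real
    show "expectation (\<lambda>\<omega>. q \<omega> u) \<le> indicator {a..<a+d} u * (2 * K * C_jump * d)"
    \<comment> \<open>The integrand vanishes at u = a and off the interval; \<open>jump_prob\<close>
      asks for a < u.\<close>
    proof (cases "u \<in> {a<..<a+d}")
      case False
      then have "q \<omega> u = 0" for \<omega> using a by (auto simp: q_def indicator_def)
      then show ?thesis using K C_jump_nonneg d by simp
    next
      case True
      then have u: "a < u" "u < a + d" "0 \<le> u" using a by auto
      note [measurable] = J_fun_measurable[OF a, of real] J_fun_measurable[OF u(3), of real]
      have "expectation (\<lambda>\<omega>. q \<omega> u) \<le> expectation (\<lambda>\<omega>. 2 * K * (if J a \<omega> = J u \<omega> then 0 else 1))"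
      proof (rule integral_mono)
        have [measurable]: "(\<lambda>\<omega>. q \<omega> u) \<in> borel_measurable M"
          unfolding q_def Ja by measurable
        show "integrable M (\<lambda>\<omega>. q \<omega> u)"
        proof (rule integrable_const_bound[where B="2 * K"])
          show "AE \<omega> in M. norm (q \<omega> u) \<le> 2 * K"
          proof (rule AE_I2)
            fix \<omega> assume "\<omega> \<in> space M"
            from qb[OF this, of u] u show "norm (q \<omega> u) \<le> 2 * K" using q0[of \<omega> u] by simp
          qed
        qed measurable
        have [measurable]: "Measurable.pred M (\<lambda>\<omega>. J a \<omega> = J u \<omega>)"
        proof -
          have "Measurable.pred M (\<lambda>\<omega>. real (J a \<omega>) = real (J u \<omega>))" by measurable
          then show ?thesis by simp
        qed
        show "integrable M (\<lambda>\<omega>. 2 * K * (if J a \<omega> = J u \<omega> then 0 else 1))"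
          by (intro integrable_mult_right integrable_const_bound[where B=1]) auto
        show "q \<omega> u \<le> 2 * K * (if J a \<omega> = J u \<omega> then 0 else 1)" if "\<omega> \<in> space M" for \<omega>
          using qb[OF that, of u] u K by (auto simp: q_def indicator_def)
      qed
      also have "\<dots> \<le> 2 * K * (C_jump * (u - a))"
        using jump_prob[OF a u(1)] u d K by (simp add: mult_left_mono)
      also have "\<dots> \<le> 2 * K * (C_jump * d)"
        using u K C_jump_nonneg by (intro mult_left_mono) auto
      finally show ?thesis using u by simp
    qed
  qed
  also have "\<dots> = 2 * K * C_jump * d\<^sup>2" using d by (simp add: power2_eq_square)
  finally show ?thesis unfolding K_def .
qed

end

context finite_markov
begin

text \<open>The integral is replaced by Riemann sums with step \<open>d = t / N\<close>. By the Markov property each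
  step changes the expectation by \<open>O(d\<^sup>2)\<close>, and the Riemann sums are within \<open>O(d)\<close> in \<open>L\<^sup>1\<close>.\<close>

lemma feynman_kac:
  fixes r h :: "nat \<Rightarrow> real"
  assumes r: "\<And>i. i < n \<Longrightarrow> 0 \<le> r i"
    and h: "\<And>i. i < n \<Longrightarrow> (\<Sum>j<n. G $$ (i, j) * h j) = r i * h i"
    and t: "0 \<le> t"
  shows "expectation (\<lambda>\<omega>. h (J t \<omega>) * exp (- acc r 0 t \<omega>)) = expectation (\<lambda>\<omega>. h (J 0 \<omega>))"
    (is "?L = ?R")
proof (cases "t = 0")
  case True
  then show ?thesis by (simp add: acc_def)
next
  case False
  with t have t: "0 < t" by simp
  define H K where "H = (\<Sum>j<n. \<bar>h j\<bar>)" and "K = (\<Sum>j<n. \<bar>r j\<bar>)"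
  have HK: "0 \<le> H" "0 \<le> K" unfolding H_def K_def by (auto intro: sum_nonneg)
  \<comment> \<open>The one-step error in units of \<open>d\<^sup>2\<close>: the first summand comes
    from expanding the transition matrix, the second from \<open>exp_minus_times_one_plus\<close>
    with x \<le> d K.\<close>
  define D where "D = taylor_const * H + H * K\<^sup>2"
  \<comment> \<open>The condition on N makes the step d at most 1, as the second-order expansion
    requires.\<close>
  have main: "\<bar>?L - ?R\<bar> \<le> ((H * (2 * K * C_jump) + D) * t\<^sup>2) / real N" if N: "real N \<ge> t" for N
  proof -
    have N0: "0 < real N" using N t by linarith
    define d where "d = t / real N"
    have d: "0 < d" "d \<le> 1" and Nd: "real N * d = t" using N t N0 by (auto simp: d_def)
    define T where "T l = real l * d" for l
    have T0: "0 \<le> T l" for l using d by (simp add: T_def)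
    have TS: "T l < T (Suc l)" for l using d by (simp add: T_def algebra_simps)
    have Td: "T (Suc l) - T l = d" for l by (simp add: T_def algebra_simps)
    define X where "X k \<omega> = (\<Prod>l<k. exp (- (d * r (J (T l) \<omega>))))" for k \<omega>
    define E where "E k = expectation (\<lambda>\<omega>. X k \<omega> * h (J (T k) \<omega>))" for k
    have rJ: "0 \<le> r (J (T l) \<omega>)" "r (J (T l) \<omega>) \<le> K" if "\<omega> \<in> space M" for l \<omega>
      using r J_less[OF T0 that] J_fun_bound[OF T0 that, of r] by (auto simp: K_def)
    have X01: "0 \<le> X k \<omega>" "X k \<omega> \<le> 1" if "\<omega> \<in> space M" for k \<omega>
      unfolding X_def using rJ[OF that] d by (auto intro!: prod_nonneg prod_le_1)
    have Xm: "(\<lambda>\<omega>. X k \<omega> * h (J (T k) \<omega>)) \<in> borel_measurable M" for k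
      unfolding X_def using J_fun_measurable[OF T0] by measurable
    have Xi: "integrable M (\<lambda>\<omega>. X k \<omega> * h (J (T k) \<omega>))" for k
    proof (rule integrable_const_bound[OF AE_I2 Xm])
      show "norm (X k \<omega> * h (J (T k) \<omega>)) \<le> 1 * H" if "\<omega> \<in> space M" for \<omega>
        unfolding real_norm_def abs_mult H_def
        by (intro mult_mono J_fun_bound T0 that) (use X01[OF that] in auto)
    qed
    have step: "\<bar>E (Suc k) - E k\<bar> \<le> d\<^sup>2 * D" for k
    proof -
      \<comment> \<open>\<open>max 0\<close> keeps F between 0 and 1 for every function x, also for
        values beyond the state space, where the sign of r is unknown; on actual paths it changes
        nothing.\<close>
      define F where "F x = (\<Prod>l<Suc k. exp (- (d * max 0 (r (x l)))))" for x :: "nat \<Rightarrow> nat"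
      have F1: "\<bar>F x\<bar> \<le> 1" for x
      proof -
        have "0 \<le> F x" unfolding F_def by (rule prod_nonneg) simp
        moreover have "F x \<le> 1" unfolding F_def by (rule prod_le_1) (use d in simp)
        ultimately show ?thesis by simp
      qed
      have FX: "F (restrict (\<lambda>l. J (T l) \<omega>) {..k}) = X (Suc k) \<omega>" if "\<omega> \<in> space M" for \<omega>
        unfolding F_def X_def using rJ[OF that] by (intro prod.cong) (auto simp: max_def)
      \<comment> \<open>\<open>X (Suc k)\<close> involves the times up to \<open>T k\<close> only,
        so it counts as past for the step to \<open>T (Suc k)\<close>. The Markov property turns E
        (Suc k) into the expectation of \<open>?Y\<close> up to a second-order error, and its last
        discount factor then cancels 1 + d r.\<close>
      let ?Y = "\<lambda>\<omega>. X (Suc k) \<omega> * (h (J (T k) \<omega>) + d * (r (J (T k) \<omega>) * h (J (T k) \<omega>)))"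
      have "\<bar>expectation (\<lambda>\<omega>. F (restrict (\<lambda>l. J (T l) \<omega>) {..k}) * h (J (T (Suc k)) \<omega>))
        - expectation (\<lambda>\<omega>. F (restrict (\<lambda>l. J (T l) \<omega>) {..k}) * (h (J (T k) \<omega>) + d * (\<Sum>y<n. G $$ (J (T k) \<omega>, y) * h y)))\<bar>
        \<le> d\<^sup>2 * (taylor_const * (\<Sum>y<n. \<bar>h y\<bar>))"
        by (rule markov_expectation_approx[of T k F d h]) (use F1 d T0 TS Td in auto)
      moreover have "expectation (\<lambda>\<omega>. F (restrict (\<lambda>l. J (T l) \<omega>) {..k}) * h (J (T (Suc k)) \<omega>)) = E (Suc k)"
        unfolding E_def by (intro Bochner_Integration.integral_cong) (auto simp only: FX)
      moreover have "expectation (\<lambda>\<omega>. F (restrict (\<lambda>l. J (T l) \<omega>) {..k}) * (h (J (T k) \<omega>) + d * (\<Sum>y<n. G $$ (J (T k) \<omega>, y) * h y)))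
          = expectation ?Y"
        by (intro Bochner_Integration.integral_cong refl) (simp only: FX h J_less[OF T0])
      ultimately have 1: "\<bar>E (Suc k) - expectation ?Y\<bar> \<le> d\<^sup>2 * (taylor_const * H)" by (simp add: H_def)
      have pw: "\<bar>?Y \<omega> - X k \<omega> * h (J (T k) \<omega>)\<bar> \<le> d\<^sup>2 * (H * K\<^sup>2)" if \<omega>: "\<omega> \<in> space M" for \<omega>
      proof -
        let ?x = "d * r (J (T k) \<omega>)"
        have x: "0 \<le> ?x" "?x \<le> d * K" using rJ[OF \<omega>] d by auto
        have "?Y \<omega> - X k \<omega> * h (J (T k) \<omega>) = X k \<omega> * h (J (T k) \<omega>) * (exp (- ?x) * (1 + ?x) - 1)"
          by (simp add: X_def algebra_simps)
        also have "\<bar>\<dots>\<bar> = \<bar>X k \<omega>\<bar> * \<bar>h (J (T k) \<omega>)\<bar> * \<bar>exp (- ?x) * (1 + ?x) - 1\<bar>"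
          by (simp only: abs_mult)
        also have "\<dots> \<le> 1 * H * (d * K)\<^sup>2"
        proof (intro mult_mono)
          have "\<bar>exp (- ?x) * (1 + ?x) - 1\<bar> \<le> ?x\<^sup>2" by (rule exp_minus_times_one_plus[OF x(1)])
          also have "\<dots> \<le> (d * K)\<^sup>2" using x by (intro power_mono)
          finally show "\<bar>exp (- ?x) * (1 + ?x) - 1\<bar> \<le> (d * K)\<^sup>2" .
          show "\<bar>h (J (T k) \<omega>)\<bar> \<le> H" unfolding H_def by (rule J_fun_bound[OF T0 \<omega>])
        qed (use X01[OF \<omega>] HK in auto)
        finally show ?thesis by (simp add: power_mult_distrib mult_ac)
      qed
      have Yi: "integrable M ?Y"
      proof (rule integrable_const_bound[where B="d\<^sup>2 * (H * K\<^sup>2) + H"])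
        show "?Y \<in> borel_measurable M"
          unfolding X_def using J_fun_measurable[OF T0, where f=r] J_fun_measurable[OF T0, where f=h] by measurable
        show "AE \<omega> in M. norm (?Y \<omega>) \<le> d\<^sup>2 * (H * K\<^sup>2) + H"
        proof (rule AE_I2)
          fix \<omega> assume \<omega>: "\<omega> \<in> space M"
          have "\<bar>X k \<omega> * h (J (T k) \<omega>)\<bar> \<le> 1 * H"
            unfolding abs_mult H_def by (intro mult_mono J_fun_bound T0 \<omega>) (use X01[OF \<omega>] in auto)
          then show "norm (?Y \<omega>) \<le> d\<^sup>2 * (H * K\<^sup>2) + H" using pw[OF \<omega>] by simp
        qed
      qed
      have diff: "expectation ?Y - E k = expectation (\<lambda>\<omega>. ?Y \<omega> - X k \<omega> * h (J (T k) \<omega>))"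
        unfolding E_def by (rule Bochner_Integration.integral_diff[OF Yi Xi, symmetric])
      have "\<bar>expectation ?Y - E k\<bar> \<le> expectation (\<lambda>\<omega>. \<bar>?Y \<omega> - X k \<omega> * h (J (T k) \<omega>)\<bar>)"
        unfolding diff by (rule integral_abs_bound)
      also have "\<dots> \<le> expectation (\<lambda>\<omega>. d\<^sup>2 * (H * K\<^sup>2))"
        by (rule integral_mono) (use pw Yi Xi in \<open>auto intro!: integrable_abs Bochner_Integration.integrable_diff\<close>)
      finally have "\<bar>expectation ?Y - E k\<bar> \<le> d\<^sup>2 * (H * K\<^sup>2)" by (simp add: prob_space)
      then show ?thesis using 1 by (simp add: D_def distrib_left)
    qed
    have sum_step: "\<bar>E k - E 0\<bar> \<le> real k * (d\<^sup>2 * D)" for k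
    proof (induction k)
      case (Suc k)
      have "\<bar>E (Suc k) - E 0\<bar> \<le> \<bar>E (Suc k) - E k\<bar> + \<bar>E k - E 0\<bar>" by linarith
      then show ?case using Suc step[of k] by (simp add: distrib_right)
    qed simp
    define S where "S \<omega> = (\<Sum>l<N. d * r (J (T l) \<omega>))" for \<omega>
    have XS: "X N \<omega> = exp (- S \<omega>)" for \<omega>
      unfolding X_def S_def by (simp add: exp_sum flip: sum_negf)
    have accS: "acc r 0 (T k) \<omega> = (\<Sum>l<k. acc r (T l) (T l + d) \<omega>)" if "\<omega> \<in> space M" for k \<omega>
    proof (induction k)
      case 0
      then show ?case by (simp add: acc_def T_def)
    next
      case (Suc k)
      have "T (Suc k) = T k + d" using Td[of k] by simp
      then show ?case using Suc acc_add[OF that, of 0 "T k" "T k + d" r] T0[of k] d by simp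
    qed
    have TN: "T N = t" using Nd by (simp add: T_def)
    have diff_i: "integrable M (\<lambda>\<omega>. \<bar>acc r (T l) (T l + d) \<omega> - d * r (J (T l) \<omega>)\<bar>)" for l
      by (intro integrable_abs Bochner_Integration.integrable_diff acc_integrable_M integrable_mult_right J_fun_integrable T0)
        (use d in simp)
    have pw: "\<bar>h (J t \<omega>) * exp (- acc r 0 t \<omega>) - X N \<omega> * h (J (T N) \<omega>)\<bar>
        \<le> H * (\<Sum>l<N. \<bar>acc r (T l) (T l + d) \<omega> - d * r (J (T l) \<omega>)\<bar>)" if \<omega>: "\<omega> \<in> space M" for \<omega>
    proof -
      have "\<bar>h (J t \<omega>) * exp (- acc r 0 t \<omega>) - X N \<omega> * h (J (T N) \<omega>)\<bar>
          = \<bar>h (J t \<omega>)\<bar> * \<bar>exp (- acc r 0 t \<omega>) - exp (- S \<omega>)\<bar>"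
        unfolding XS TN by (simp add: algebra_simps flip: abs_mult)
      also have "\<dots> \<le> H * \<bar>acc r 0 t \<omega> - S \<omega>\<bar>"
      proof (intro mult_mono exp_minus_lipschitz)
        show "\<bar>h (J t \<omega>)\<bar> \<le> H" unfolding H_def using t by (intro J_fun_bound \<omega>) simp
        show "0 \<le> acc r 0 t \<omega>" by (rule acc_nonneg[OF \<omega> r])
        show "0 \<le> S \<omega>" unfolding S_def using rJ[OF \<omega>] d by (intro sum_nonneg) simp
      qed (use HK in auto)
      also have "acc r 0 t \<omega> - S \<omega> = (\<Sum>l<N. acc r (T l) (T l + d) \<omega> - d * r (J (T l) \<omega>))"
        using accS[OF \<omega>, of N] unfolding TN S_def by (simp add: sum_subtractf)
      also have "H * \<bar>\<dots>\<bar> \<le> H * (\<Sum>l<N. \<bar>acc r (T l) (T l + d) \<omega> - d * r (J (T l) \<omega>)\<bar>)"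
        by (intro mult_left_mono sum_abs HK)
      finally show ?thesis .
    qed
    have Li: "integrable M (\<lambda>\<omega>. h (J t \<omega>) * exp (- acc r 0 t \<omega>))"
    proof (rule integrable_mult_bounded[where K=1])
      show "integrable M (\<lambda>\<omega>. h (J t \<omega>))" using t by (intro J_fun_integrable) simp
      show "(\<lambda>\<omega>. exp (- acc r 0 t \<omega>)) \<in> borel_measurable M" by measurable
      show "\<bar>exp (- acc r 0 t \<omega>)\<bar> \<le> 1" if "\<omega> \<in> space M" for \<omega>
        using acc_nonneg[OF that r] by simp
    qed
    have diff: "?L - E N = expectation (\<lambda>\<omega>. h (J t \<omega>) * exp (- acc r 0 t \<omega>) - X N \<omega> * h (J (T N) \<omega>))"
      unfolding E_def by (rule Bochner_Integration.integral_diff[OF Li Xi, symmetric])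
    have "\<bar>?L - E N\<bar> \<le> expectation (\<lambda>\<omega>. \<bar>h (J t \<omega>) * exp (- acc r 0 t \<omega>) - X N \<omega> * h (J (T N) \<omega>)\<bar>)"
      unfolding diff by (rule integral_abs_bound)
    also have "\<dots> \<le> expectation (\<lambda>\<omega>. H * (\<Sum>l<N. \<bar>acc r (T l) (T l + d) \<omega> - d * r (J (T l) \<omega>)\<bar>))"
      by (rule integral_mono[OF _ _ pw])
        (intro integrable_abs Bochner_Integration.integrable_diff Li Xi integrable_mult_right Bochner_Integration.integrable_sum diff_i)+
    also have "\<dots> = H * (\<Sum>l<N. expectation (\<lambda>\<omega>. \<bar>acc r (T l) (T l + d) \<omega> - d * r (J (T l) \<omega>)\<bar>))"
      using diff_i by (simp add: Bochner_Integration.integral_sum)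
    also have "\<dots> \<le> H * (\<Sum>l<N. 2 * K * C_jump * d\<^sup>2)"
      unfolding K_def by (intro mult_left_mono sum_mono acc_approx T0 d HK)
    also have "\<dots> = real N * (d\<^sup>2 * (H * (2 * K * C_jump)))" by simp
    finally have 2: "\<bar>?L - E N\<bar> \<le> real N * (d\<^sup>2 * (H * (2 * K * C_jump)))" .
    have "E 0 = ?R" by (simp add: E_def X_def T_def)
    then have "\<bar>?L - ?R\<bar> \<le> \<bar>?L - E N\<bar> + \<bar>E N - E 0\<bar>" by linarith
    also have "\<dots> \<le> real N * (d\<^sup>2 * (H * (2 * K * C_jump))) + real N * (d\<^sup>2 * D)"
      using 2 sum_step[of N] by linarith
    also have "\<dots> = (real N * d\<^sup>2) * (H * (2 * K * C_jump) + D)"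
      by (simp add: algebra_simps)
    also have "real N * d\<^sup>2 = t\<^sup>2 / real N"
      using N0 by (simp add: d_def power2_eq_square)
    finally show ?thesis by (simp add: mult.commute)
  qed
  let ?c = "(H * (2 * K * C_jump) + D) * t\<^sup>2"
  have "\<bar>?L - ?R\<bar> \<le> 0"
  proof (rule tendsto_lowerbound[OF lim_const_over_n[of ?c]])
    show "eventually (\<lambda>N. \<bar>?L - ?R\<bar> \<le> ?c / real N) sequentially"
      unfolding eventually_sequentially
      by (intro exI[of _ "nat \<lceil>t\<rceil>"] allI impI main) linarith
  qed simp
  then show ?thesis by simp
qed

end

section \<open>Absorption\<close>

locale absorbing_markov = finite_markov +
  fixes a :: nat
  assumes a_less: "a < n" and a_row: "\<And>j. j < n \<Longrightarrow> G $$ (a, j) = 0"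
begin

lemma trans_prob_absorbing:
  assumes "j < n" "j \<noteq> a"
  shows "trans_prob d a j = 0"
proof -
  have "(G ^\<^sub>m k) $$ (a, j) = 0" for k
  proof (cases k)
    case 0
    then show ?thesis using G_carrier assms a_less by simp
  next
    case (Suc l)
    then show ?thesis
      unfolding Suc pow_mat_Suc_index'[OF G_carrier a_less assms(1)] by (simp add: a_row)
  qed
  then show ?thesis unfolding trans_prob_def mat_exp_index(1)[OF G_carrier a_less assms(1)] by simp
qed

lemma AE_stays:
  assumes "0 \<le> u" "u < v"
  shows "AE \<omega> in M. J u \<omega> = a \<longrightarrow> J v \<omega> = a"
proof -
  have v: "0 \<le> v" using assms by simp
  have "AE \<omega> in M. \<not> (J u \<omega> = a \<and> J v \<omega> = j)" if "j \<in> {..<n} - {a}" for j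
  proof -
    have "{\<omega>\<in>space M. J u \<omega> = a \<and> J v \<omega> = j} = {\<omega>\<in>space M. J u \<omega> = a} \<inter> {\<omega>\<in>space M. J v \<omega> = j}"
      by auto
    then have ev: "{\<omega>\<in>space M. J u \<omega> = a \<and> J v \<omega> = j} \<in> events"
      using J_event[OF assms(1), of "\<lambda>x. x = a"] J_event[OF v, of "\<lambda>x. x = j"] by (simp only: sets.Int)
    have "prob {\<omega>\<in>space M. J u \<omega> = a \<and> J v \<omega> = j} = 0"
      using two_point_prob[OF assms a_less, of j] trans_prob_absorbing[of j] that by simp
    then have "{\<omega>\<in>space M. J u \<omega> = a \<and> J v \<omega> = j} \<in> null_sets M"
      using ev by (simp add: null_sets_def emeasure_eq_measure)
    then show ?thesis by (rule AE_I') auto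
  qed
  then have "AE \<omega> in M. \<forall>j\<in>{..<n} - {a}. \<not> (J u \<omega> = a \<and> J v \<omega> = j)"
    by (intro AE_finite_allI) auto
  then show ?thesis
  proof (rule AE_mp, intro AE_I2 impI)
    fix \<omega> assume "\<omega> \<in> space M" "\<forall>j\<in>{..<n} - {a}. \<not> (J u \<omega> = a \<and> J v \<omega> = j)" "J u \<omega> = a"
    then show "J v \<omega> = a" using J_less[OF v, of \<omega>] by auto
  qed
qed

text \<open>\<open>AE_stays\<close> has its own null set for each pair of times. Countably many
  rational pairs share one, and right-continuity supplies rationals just after t and just after u at
  which the path has the same states as at t and u.\<close>

lemma AE_absorbed: "AE \<omega> in M. \<forall>t\<ge>0. \<forall>u\<ge>t. J t \<omega> = a \<longrightarrow> J u \<omega> = a"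
proof -
  have "AE \<omega> in M. \<forall>q q' :: rat. 0 \<le> q \<longrightarrow> q < q' \<longrightarrow> J (of_rat q) \<omega> = a \<longrightarrow> J (of_rat q') \<omega> = a"
    unfolding AE_all_countable
  proof (intro allI)
    fix q q' :: rat
    show "AE \<omega> in M. 0 \<le> q \<longrightarrow> q < q' \<longrightarrow> J (of_rat q) \<omega> = a \<longrightarrow> J (of_rat q') \<omega> = a"
      using AE_stays[of "of_rat q" "of_rat q'"] by (cases "0 \<le> q \<and> q < q'") (auto simp: of_rat_less)
  qed
  then show ?thesis
  proof (rule AE_mp, intro AE_I2 impI allI)
    fix \<omega> t u
    assume \<omega>: "\<omega> \<in> space M" and t: "0 \<le> t" "t \<le> u" "J t \<omega> = a"
      and q: "\<forall>q q' :: rat. 0 \<le> q \<longrightarrow> q < q' \<longrightarrow> J (of_rat q) \<omega> = a \<longrightarrow> J (of_rat q') \<omega> = a"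
    show "J u \<omega> = a"
    proof (cases "t = u")
      case False
      then have tu: "t < u" "0 \<le> u" using t by auto
      obtain b where b: "b > t" "\<And>y. t < y \<Longrightarrow> y < b \<Longrightarrow> J y \<omega> = J t \<omega>"
        using J_right_continuous[OF t(1) \<omega>] unfolding eventually_at_right_field by auto
      obtain c where c: "c > u" "\<And>y. u < y \<Longrightarrow> y < c \<Longrightarrow> J y \<omega> = J u \<omega>"
        using J_right_continuous[OF tu(2) \<omega>] unfolding eventually_at_right_field by auto
      obtain q1 where q1: "t < real_of_rat q1" "real_of_rat q1 < min b u"
        using of_rat_dense[of t "min b u"] b tu by auto
      obtain q2 where q2: "u < real_of_rat q2" "real_of_rat q2 < c"
        using of_rat_dense[of u c] c by auto
      have "0 < real_of_rat q1" using q1(1) t(1) by linarith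
      moreover have "real_of_rat q1 < real_of_rat q2" using q1 q2 by linarith
      ultimately have "0 \<le> q1" "q1 < q2" by (simp_all add: of_rat_less)
      then have "J (of_rat q2) \<omega> = a" using q b(2)[of "of_rat q1"] q1 t by auto
      then show ?thesis using c(2)[OF q2] by simp
    qed (use t in simp)
  qed
qed

text \<open>Since \<open>G g = -1\<close> off \<open>a\<close>, the bounded quantity \<open>E (g (J t))\<close> decreases at rate \<open>P (J t \<noteq> a)\<close>.\<close>

lemma alive_prob_small:
  fixes g :: "nat \<Rightarrow> real"
  assumes g: "\<And>i. i < n \<Longrightarrow> i \<noteq> a \<Longrightarrow> (\<Sum>j<n. G $$ (i, j) * g j) = - 1" and e: "0 < e"
  shows "\<exists>t\<ge>0. prob {\<omega>\<in>space M. J t \<omega> \<noteq> a} \<le> e"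
proof -
  define K where "K = (\<Sum>j<n. \<bar>g j\<bar>)"
  have K: "0 \<le> K" unfolding K_def by (auto intro: sum_nonneg)
  have CK: "0 \<le> taylor_const * K" using taylor_const_pos K by simp
  \<comment> \<open>Let C be \<open>taylor_const * K\<close>. Over N steps E falls by at least N d q
    N, up to an error of N d (d C), while E stays in [-K, K]. The choice of d gives d C \<le> e/2
    and that of N gives 2 K \<le> N d e/2, hence q N \<le> e. Adding 1 to C keeps the divisor
    positive.\<close>
  define d where "d = min 1 (e / (2 * (taylor_const * K + 1)))"
  have d: "0 < d" "d \<le> 1" using e CK by (auto simp: d_def)
  have dCK: "d * (taylor_const * K) \<le> e / 2"
  proof -
    have "d * (taylor_const * K) \<le> (e / (2 * (taylor_const * K + 1))) * (taylor_const * K + 1)"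
      using e CK d by (intro mult_mono) (auto simp: d_def)
    also have "\<dots> = e / 2" using CK by (simp add: field_simps)
    finally show ?thesis .
  qed
  define N where "N = nat \<lceil>4 * K / (d * e)\<rceil> + 1"
  have N: "4 * K / (d * e) \<le> real N" "0 < real N" unfolding N_def by linarith+
  define T where "T l = real l * d" for l
  have T0: "0 \<le> T l" for l using d by (simp add: T_def)
  have TS: "T l < T (Suc l)" for l using d by (simp add: T_def algebra_simps)
  have Td: "T (Suc l) - T l = d" for l by (simp add: T_def algebra_simps)
  define q where "q k = prob {\<omega>\<in>space M. J (T k) \<omega> \<noteq> a}" for k
  define E where "E k = expectation (\<lambda>\<omega>. g (J (T k) \<omega>))" for k
  have q_mono: "q N \<le> q k" if "k \<le> N" for k
  proof (cases "k = N")
    case False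
    then have "T k < T N" using that d by (simp add: T_def)
    show ?thesis unfolding q_def
    proof (rule finite_measure_mono_AE)
      show "AE \<omega> in M. \<omega> \<in> {\<omega>\<in>space M. J (T N) \<omega> \<noteq> a} \<longrightarrow> \<omega> \<in> {\<omega>\<in>space M. J (T k) \<omega> \<noteq> a}"
        using AE_stays[OF T0 \<open>T k < T N\<close>] by eventually_elim auto
    qed (rule J_event[OF T0])
  qed simp
  have step: "E (Suc k) \<le> E k - d * q k + d\<^sup>2 * (taylor_const * K)" for k
  proof -
    have "\<bar>expectation (\<lambda>\<omega>. 1 * g (J (T (Suc k)) \<omega>))
        - expectation (\<lambda>\<omega>. 1 * (g (J (T k) \<omega>) + d * (\<Sum>y<n. G $$ (J (T k) \<omega>, y) * g y)))\<bar>
        \<le> d\<^sup>2 * (taylor_const * (\<Sum>y<n. \<bar>g y\<bar>))"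
      by (rule markov_expectation_approx[of T k "\<lambda>_. 1" d g]) (use d T0 TS Td in auto)
    moreover have "expectation (\<lambda>\<omega>. 1 * (g (J (T k) \<omega>) + d * (\<Sum>y<n. G $$ (J (T k) \<omega>, y) * g y)))
        = expectation (\<lambda>\<omega>. g (J (T k) \<omega>) + - d * indicator {\<omega>\<in>space M. J (T k) \<omega> \<noteq> a} \<omega>)"
    proof (rule Bochner_Integration.integral_cong[OF refl])
      fix \<omega> assume \<omega>: "\<omega> \<in> space M"
      show "1 * (g (J (T k) \<omega>) + d * (\<Sum>y<n. G $$ (J (T k) \<omega>, y) * g y))
        = g (J (T k) \<omega>) + - d * indicator {\<omega>\<in>space M. J (T k) \<omega> \<noteq> a} \<omega>"
        using g[OF J_less[OF T0 \<omega>]] \<omega> by (cases "J (T k) \<omega> = a") (auto simp: a_row)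
    qed
    moreover have "\<dots> = E k + - d * q k"
      unfolding E_def q_def using J_event[OF T0, of "\<lambda>x. x \<noteq> a" k]
      by (subst Bochner_Integration.integral_add)
        (auto intro!: J_fun_integrable T0 integrable_mult_right simp: emeasure_eq_measure sets.sets_into_space Int_absorb2)
    ultimately show ?thesis unfolding E_def K_def by (simp add: abs_if split: if_splits)
  qed
  have "E k \<le> E 0 - real k * (d * q N) + real k * (d\<^sup>2 * (taylor_const * K))" if "k \<le> N" for k
    using that
  proof (induction k)
    case (Suc k)
    have "d * q N \<le> d * q k" using q_mono[of k] Suc.prems d by simp
    then show ?case using Suc step[of k] by (simp add: distrib_right)
  qed simp
  then have 1: "E N \<le> E 0 - real N * (d * q N) + real N * (d\<^sup>2 * (taylor_const * K))" by simp
  have Eb: "\<bar>E k\<bar> \<le> K" for k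
  proof -
    have "\<bar>E k\<bar> \<le> expectation (\<lambda>\<omega>. \<bar>g (J (T k) \<omega>)\<bar>)"
      unfolding E_def by (rule integral_abs_bound)
    also have "\<dots> \<le> expectation (\<lambda>\<omega>. K)"
      by (rule integral_mono) (auto intro!: integrable_abs J_fun_integrable J_fun_bound T0 simp: K_def)
    finally show ?thesis by (simp add: prob_space)
  qed
  have "real N * d * q N \<le> 2 * K + real N * d * (d * (taylor_const * K))"
    using 1 Eb[of N] Eb[of 0] by (simp add: power2_eq_square mult_ac)
  also have "\<dots> \<le> real N * d * (e / 2) + real N * d * (e / 2)"
  proof (rule add_mono)
    show "2 * K \<le> real N * d * (e / 2)" using N(1) d e by (simp add: field_simps)
    show "real N * d * (d * (taylor_const * K)) \<le> real N * d * (e / 2)" using dCK N d by (intro mult_left_mono) auto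
  qed
  finally have "real N * d * q N \<le> real N * d * e"
    unfolding distrib_left[symmetric] field_sum_of_halves .
  then have "q N \<le> e" using N d by simp
  then show ?thesis unfolding q_def using T0 by blast
qed

text \<open>Restricting to integer times makes the event of never hitting a countable intersection.
  Since absorbed paths stay absorbed, its probability is at most that of
  \<open>J t \<noteq> a\<close> for every t, which becomes arbitrarily small.\<close>

lemma AE_hits:
  fixes g :: "nat \<Rightarrow> real"
  assumes g: "\<And>i. i < n \<Longrightarrow> i \<noteq> a \<Longrightarrow> (\<Sum>j<n. G $$ (i, j) * g j) = - 1"
  shows "AE \<omega> in M. \<exists>k::nat. J (real k) \<omega> = a"
proof -
  let ?N = "\<Inter>k::nat. {\<omega>\<in>space M. J (real k) \<omega> \<noteq> a}"
  have ev: "{\<omega>\<in>space M. J (real k) \<omega> \<noteq> a} \<in> events" for k :: nat by (rule J_event) simp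
  have evN: "?N \<in> events"
  proof (rule sets.countable_INT)
    show "range (\<lambda>k::nat. {\<omega>\<in>space M. J (real k) \<omega> \<noteq> a}) \<subseteq> events" using ev by blast
  qed simp
  have "prob ?N \<le> e" if "e > 0" for e
  proof -
    have "\<exists>t\<ge>0. prob {\<omega>\<in>space M. J t \<omega> \<noteq> a} \<le> e"
      by (rule alive_prob_small[of g e]) (rule g, assumption+, rule that)
    then obtain t where t: "0 \<le> t" "prob {\<omega>\<in>space M. J t \<omega> \<noteq> a} \<le> e" by blast
    define k where "k = nat \<lceil>t\<rceil> + 1"
    have k: "t < real k" unfolding k_def by linarith
    have "prob ?N \<le> prob {\<omega>\<in>space M. J (real k) \<omega> \<noteq> a}"
      by (rule finite_measure_mono[OF _ ev]) auto
    also have "\<dots> \<le> prob {\<omega>\<in>space M. J t \<omega> \<noteq> a}"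
    proof (rule finite_measure_mono_AE)
      show "AE \<omega> in M. \<omega> \<in> {\<omega>\<in>space M. J (real k) \<omega> \<noteq> a} \<longrightarrow> \<omega> \<in> {\<omega>\<in>space M. J t \<omega> \<noteq> a}"
        using AE_stays[OF t(1) k] by eventually_elim auto
    qed (rule J_event[OF t(1)])
    finally show ?thesis using t(2) by linarith
  qed
  then have "prob ?N \<le> 0 + e" if "e > 0" for e using that by simp
  then have "prob ?N \<le> 0" by (rule field_le_epsilon)
  then have "prob ?N = 0" using measure_nonneg[of M ?N] by linarith
  then have "?N \<in> null_sets M" using evN by (simp add: null_sets_def emeasure_eq_measure)
  then show ?thesis by (rule AE_I') auto
qed

section \<open>Absorption time and total rewards\<close>

lemma absorption_time_nonneg: "0 \<le> absorption_time a J \<omega>"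
  unfolding absorption_time_def by (rule INF_greatest) auto

text \<open>The infimum may be taken over rational times: after any t with
  \<open>J t \<omega> = a\<close> the path stays in a for a while, so there are rational times in a
  arbitrarily close to t. This holds for every path, not merely almost surely.\<close>

lemma absorption_time_measurable: "absorption_time a J \<in> borel_measurable M"
proof -
  let ?f = "\<lambda>q \<omega>. if J (real_of_rat q) \<omega> = a then ereal (real_of_rat q) else \<infinity>"
  have eq: "absorption_time a J \<omega> = (INF q\<in>{q::rat. 0 \<le> q}. ?f q \<omega>)" if \<omega>: "\<omega> \<in> space M" for \<omega>
  proof (rule antisym)
    show "absorption_time a J \<omega> \<le> (INF q\<in>{q::rat. 0 \<le> q}. ?f q \<omega>)"
      unfolding absorption_time_def by (rule INF_greatest) (auto intro!: INF_lower)
    show "(INF q\<in>{q::rat. 0 \<le> q}. ?f q \<omega>) \<le> absorption_time a J \<omega>"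
      unfolding absorption_time_def
    proof (rule INF_greatest, clarify)
      fix t assume t: "0 \<le> t" "a = J t \<omega>"
      obtain b where b: "b > t" "\<And>y. t < y \<Longrightarrow> y < b \<Longrightarrow> J y \<omega> = J t \<omega>"
        using J_right_continuous[OF t(1) \<omega>] unfolding eventually_at_right_field by auto
      show "(INF q\<in>{q::rat. 0 \<le> q}. if J (real_of_rat q) \<omega> = J t \<omega> then ereal (real_of_rat q) else \<infinity>) \<le> ereal t"
      proof (rule ereal_le_epsilon2)
        fix e :: real assume "0 < e"
        then obtain q where q: "t < real_of_rat q" "real_of_rat q < min b (t + e)"
          using of_rat_dense[of t "min b (t + e)"] b by auto
        then have "0 < real_of_rat q" using t by linarith
        then have "0 \<le> q" by simp
        then have "(INF q\<in>{q::rat. 0 \<le> q}. if J (real_of_rat q) \<omega> = J t \<omega> then ereal (real_of_rat q) else \<infinity>)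
           \<le> (if J (real_of_rat q) \<omega> = J t \<omega> then ereal (real_of_rat q) else \<infinity>)"
          by (intro INF_lower) simp
        also have "\<dots> \<le> ereal t + ereal e" using b(2)[of "real_of_rat q"] q by simp
        finally show "(INF q\<in>{q::rat. 0 \<le> q}. if J (real_of_rat q) \<omega> = J t \<omega> then ereal (real_of_rat q) else \<infinity>)
          \<le> ereal t + ereal e" .
      qed
    qed
  qed
  have "(\<lambda>\<omega>. INF q\<in>{q::rat. 0 \<le> q}. ?f q \<omega>) \<in> borel_measurable M"
  proof (rule borel_measurable_INF)
    show "countable {q::rat. 0 \<le> q}" by (rule countable_subset[OF subset_UNIV]) simp
    show "?f q \<in> borel_measurable M" if "q \<in> {q::rat. 0 \<le> q}" for q
    proof -
      have "0 \<le> real_of_rat q" using that by simp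
      note [measurable] = J_pred[OF this, of "\<lambda>x. x = a"]
      show ?thesis by measurable
    qed
  qed
  then show ?thesis by (subst measurable_cong[OF eq])
qed

text \<open>The absorption time is nonnegative, so the interval integral is not reversed, and inside
  the open interval \<open>max 0 u\<close> is u.\<close>

lemma total_reward_eq_integral:
  assumes "dim_col R = a"
  shows "total_reward R J i \<omega>
    = (\<integral>u. indicator (einterval 0 (absorption_time a J \<omega>)) u * reward_rate R i (J (max 0 u) \<omega>) \<partial>lborel)"
  unfolding total_reward_def interval_lebesgue_integral_def set_lebesgue_integral_def assms
  using absorption_time_nonneg[of \<omega>]
  by (auto intro!: Bochner_Integration.integral_cong simp: indicator_def einterval_def)

lemma total_reward_measurable:
  assumes "dim_col R = a"
  shows "total_reward R J i \<in> borel_measurable M"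
proof -
  note [measurable] = absorption_time_measurable
  note [measurable (raw)] = J_joint_measurable'[where f="reward_rate R i"]
  have ind: "indicator (einterval 0 (absorption_time a J \<omega>)) u = (if 0 < u \<and> ereal u < absorption_time a J \<omega> then 1 else 0 :: real)" for \<omega> u
    by (auto simp: indicator_def einterval_def)
  show ?thesis
    unfolding total_reward_eq_integral[OF assms, abs_def] ind by measurable
qed

lemma total_reward_nonneg:
  assumes "dim_col R = a" "\<And>j. j < a \<Longrightarrow> 0 \<le> R $$ (i, j)"
  shows "0 \<le> total_reward R J i \<omega>"
  unfolding total_reward_eq_integral[OF assms(1)]
  by (rule Bochner_Integration.integral_nonneg) (use assms in \<open>auto simp: indicator_def reward_rate_def\<close>)

text \<open>The reward rate is 0 in the absorbing state, so the range of integration may be extended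
  from the absorption time to any later T. This removes the random upper limit.\<close>

lemma total_reward_eq_acc:
  assumes dim: "dim_col R = a" and \<omega>: "\<omega> \<in> space M"
    and absd: "\<And>t u. 0 \<le> t \<Longrightarrow> t \<le> u \<Longrightarrow> J t \<omega> = a \<Longrightarrow> J u \<omega> = a"
    and T: "0 \<le> T" "J T \<omega> = a"
  shows "total_reward R J i \<omega> = acc (reward_rate R i) 0 T \<omega>"
proof -
  let ?\<tau> = "absorption_time a J \<omega>"
  note [measurable] = J_path_measurable[OF \<omega>, of "reward_rate R i"]
  have \<tau>T: "?\<tau> \<le> ereal T" unfolding absorption_time_def using T by (intro INF_lower) auto
  have ra: "reward_rate R i a = 0" by (simp add: reward_rate_def dim)
  have after: "J u \<omega> = a" if "?\<tau> < ereal u" for u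
  proof -
    obtain t where "0 \<le> t" "J t \<omega> = a" "ereal t < ereal u"
      using \<open>?\<tau> < ereal u\<close> unfolding absorption_time_def INF_less_iff by auto
    then show ?thesis using absd[of t u] by simp
  qed
  show ?thesis
    unfolding total_reward_eq_integral[OF dim] acc_def
  proof (rule integral_cong_AE)
    show "AE u in lborel. indicator (einterval 0 ?\<tau>) u * reward_rate R i (J (max 0 u) \<omega>)
        = indicator {0..<T} u * reward_rate R i (J (max 0 u) \<omega>)"
      \<comment> \<open>The two excluded points are the ends of the open interval;
        \<open>after\<close> covers only times strictly beyond the infimum.\<close>
      using AE_lborel_singleton[of 0] AE_lborel_singleton[of "real_of_ereal ?\<tau>"]
    proof eventually_elim
      case (elim u)
      show ?case
      proof (cases "0 < u")
        case u: True
        show ?thesis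
        proof (cases "ereal u < ?\<tau>")
          case True
          then have "ereal u < ereal T" using \<tau>T by (rule less_le_trans)
          then show ?thesis using True u by (simp add: einterval_def)
        next
          case False
          have "ereal u \<noteq> ?\<tau>" using elim(2) by (metis real_of_ereal.simps(1))
          then have "J u \<omega> = a" using False after[of u] by auto
          then show ?thesis using u False ra by (simp add: einterval_def)
        qed
      qed (use elim in \<open>auto simp: einterval_def\<close>)
    qed
  qed measurable
qed

text \<open>Along integer times the Feynman-Kac integrand is eventually constant on almost every
  path: after absorption h is 1 and the accumulated rewards are frozen at the total rewards. Since h
  takes finitely many values, dominated convergence applies.\<close>

lemma total_reward_laplace:
  fixes h :: "nat \<Rightarrow> real"
  assumes dim: "dim_col R = a"
    and R: "\<And>i j. i < 2 \<Longrightarrow> j < a \<Longrightarrow> 0 \<le> R $$ (i, j)" and xy: "0 \<le> x" "0 \<le> y"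
    and g: "\<And>i. i < n \<Longrightarrow> i \<noteq> a \<Longrightarrow> (\<Sum>j<n. G $$ (i, j) * g j) = - 1"
    and h: "\<And>i. i < n \<Longrightarrow> (\<Sum>j<n. G $$ (i, j) * h j)
      = (x * reward_rate R 0 i + y * reward_rate R 1 i) * h i"
    and ha: "h a = 1"
  shows "expectation (\<lambda>\<omega>. exp (- (x * total_reward R J 0 \<omega> + y * total_reward R J 1 \<omega>))) = expectation (\<lambda>\<omega>. h (J 0 \<omega>))"
proof -
  let ?r = "\<lambda>i. x * reward_rate R 0 i + y * reward_rate R 1 i"
  let ?Z = "\<lambda>\<omega>. exp (- (x * total_reward R J 0 \<omega> + y * total_reward R J 1 \<omega>))"
  have hits: "AE \<omega> in M. \<exists>k::nat. J (real k) \<omega> = a" by (rule AE_hits[of g]) (rule g)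
  have r: "0 \<le> ?r i" for i
    unfolding reward_rate_def using xy R by (simp add: dim)
  note [measurable] = total_reward_measurable[OF dim]
  have Jm[measurable]: "(\<lambda>\<omega>. h (J (real k) \<omega>)) \<in> borel_measurable M" for k by (rule J_fun_measurable) simp
  have "(\<lambda>k::nat. expectation (\<lambda>\<omega>. h (J (real k) \<omega>) * exp (- acc ?r 0 (real k) \<omega>))) \<longlonglongrightarrow> expectation ?Z"
  proof (rule integral_dominated_convergence[where w="\<lambda>_. \<Sum>j<n. \<bar>h j\<bar>"])
    show "AE \<omega> in M. (\<lambda>k. h (J (real k) \<omega>) * exp (- acc ?r 0 (real k) \<omega>)) \<longlonglongrightarrow> ?Z \<omega>"
      using AE_absorbed hits AE_space
    proof eventually_elim
      case (elim \<omega>)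
      obtain k0 where k0: "J (real k0) \<omega> = a" using elim by blast
      have absd: "J u \<omega> = a" if "0 \<le> t" "t \<le> u" "J t \<omega> = a" for t u using elim that by blast
      have "h (J (real k) \<omega>) * exp (- acc ?r 0 (real k) \<omega>) = ?Z \<omega>" if "k0 \<le> k" for k
      proof -
        have Jk: "J (real k) \<omega> = a" using absd[OF _ _ k0] that by simp
        have "total_reward R J i \<omega> = acc (reward_rate R i) 0 (real k) \<omega>" for i
          by (rule total_reward_eq_acc[OF dim \<open>\<omega> \<in> space M\<close> absd _ Jk]) auto
        then show ?thesis by (simp add: Jk ha acc_linear[OF \<open>\<omega> \<in> space M\<close>])
      qed
      then have "eventually (\<lambda>k. h (J (real k) \<omega>) * exp (- acc ?r 0 (real k) \<omega>) = ?Z \<omega>) sequentially"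
        unfolding eventually_sequentially by blast
      then show ?case by (rule tendsto_eventually)
    qed
    show "AE \<omega> in M. norm (h (J (real k) \<omega>) * exp (- acc ?r 0 (real k) \<omega>)) \<le> (\<Sum>j<n. \<bar>h j\<bar>)" for k
    proof (rule AE_I2)
      fix \<omega> assume \<omega>: "\<omega> \<in> space M"
      have "\<bar>h (J (real k) \<omega>)\<bar> * \<bar>exp (- acc ?r 0 (real k) \<omega>)\<bar> \<le> (\<Sum>j<n. \<bar>h j\<bar>) * 1"
        using acc_nonneg[OF \<omega>, of ?r 0 "real k"] r
        by (intro mult_mono J_fun_bound \<omega>) (auto intro: sum_nonneg)
      then show "norm (h (J (real k) \<omega>) * exp (- acc ?r 0 (real k) \<omega>)) \<le> (\<Sum>j<n. \<bar>h j\<bar>)"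
        by (simp add: abs_mult)
    qed
  qed auto
  moreover have "expectation (\<lambda>\<omega>. h (J (real k) \<omega>) * exp (- acc ?r 0 (real k) \<omega>)) = expectation (\<lambda>\<omega>. h (J 0 \<omega>))" for k
    by (rule feynman_kac) (use r h in auto)
  ultimately show ?thesis by (simp add: LIMSEQ_const_iff)
qed

end

section \<open>Subgenerators and block matrices\<close>

text \<open>Vectors are functions of which only the values below n count; this lets sums over states
  be split and re-indexed by blocks directly.\<close>

definition trivial_kernel :: "nat \<Rightarrow> real mat \<Rightarrow> bool" where
  "trivial_kernel n A \<longleftrightarrow>
    (\<forall>x. (\<forall>i<n. (\<Sum>j<n. A $$ (i, j) * x j) = 0) \<longrightarrow> (\<forall>i<n. x i = 0))"

lemma trivial_kernelI:
  "(\<And>x i. (\<And>i. i < n \<Longrightarrow> (\<Sum>j<n. A $$ (i, j) * x j) = 0) \<Longrightarrow> i < n \<Longrightarrow> x i = 0)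
    \<Longrightarrow> trivial_kernel n A"
  unfolding trivial_kernel_def by blast

text \<open>\<open>mat_inv\<close> is meaningful only where \<open>mat_inverse\<close> does not
  return \<open>None\<close>. A nonzero determinant, obtained from the trivial kernel, makes
  \<open>A\<close> a unit and thereby ensures this.\<close>

lemma mat_inv_inverts:
  assumes A: "A \<in> carrier_mat n n"
    and inj: "trivial_kernel n A"
  shows "invertible_mat A" "A * mat_inv A = 1\<^sub>m n" "mat_inv A * A = 1\<^sub>m n" "mat_inv A \<in> carrier_mat n n"
proof -
  have "Determinant.det A \<noteq> 0"
  proof
    assume "Determinant.det A = 0"
    then obtain v where v: "v \<in> carrier_vec n" "v \<noteq> 0\<^sub>v n" "A *\<^sub>v v = 0\<^sub>v n"
      using det_0_iff_vec_prod_zero_field[OF A] by blast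
    have "(\<Sum>j<n. A $$ (i, j) * Matrix.vec_index v j) = 0" if "i < n" for i
    proof -
      have "Matrix.vec_index (A *\<^sub>v v) i = (\<Sum>j<n. A $$ (i, j) * Matrix.vec_index v j)"
        using that A v(1) by (auto simp: scalar_prod_def lessThan_atLeast0 intro!: sum.cong)
      then show ?thesis using v(3) that by simp
    qed
    then have "Matrix.vec_index v i = 0" if "i < n" for i using inj that unfolding trivial_kernel_def by blast
    then have "v = 0\<^sub>v n" using v(1) by (intro eq_vecI) auto
    then show False using v(2) by simp
  qed
  then have "A \<in> Units (ring_mat TYPE(real) n ())" by (rule det_non_zero_imp_unit[OF A])
  then obtain B where B: "mat_inverse A = Some B" using mat_inverse(1)[OF A, of "()"] by (cases "mat_inverse A") auto
  then have "mat_inv A = B" by (simp add: mat_inv_def)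
  then show 1: "A * mat_inv A = 1\<^sub>m n" "mat_inv A * A = 1\<^sub>m n" "mat_inv A \<in> carrier_mat n n"
    using mat_inverse(2)[OF A B] by auto
  then show "invertible_mat A"
    unfolding invertible_mat_def inverts_mat_def using A by auto
qed

lemma mat_inv_unique:
  assumes A: "A \<in> carrier_mat n n" and B: "B \<in> carrier_mat n n" and AB: "A * B = 1\<^sub>m n"
  shows "mat_inv A = B"
proof -
  have BA: "B * A = 1\<^sub>m n" by (rule mat_mult_left_right_inverse[OF A B AB])
  have "trivial_kernel n A"
  proof (rule trivial_kernelI)
    fix x i assume x: "\<And>i. i < n \<Longrightarrow> (\<Sum>j<n. A $$ (i, j) * x j) = 0" and i: "i < n"
    have "x i = (\<Sum>j<n. (B * A) $$ (i, j) * x j)"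
      unfolding BA using i by (simp add: if_distrib[where f="\<lambda>y. y * _"] cong: if_cong)
    also have "\<dots> = (\<Sum>j<n. \<Sum>l<n. B $$ (i, l) * A $$ (l, j) * x j)"
      by (intro sum.cong refl) (simp add: mat_mult_index_sum[OF B A i] sum_distrib_right del: index_mult_mat)
    also have "\<dots> = (\<Sum>l<n. B $$ (i, l) * (\<Sum>j<n. A $$ (l, j) * x j))"
      by (subst sum.swap) (simp add: sum_distrib_left mult_ac)
    also have "\<dots> = 0" using x by simp
    finally show "x i = 0" .
  qed
  note inv = mat_inv_inverts[OF A this]
  have "mat_inv A = mat_inv A * (A * B)" using AB inv(4) by simp
  also have "\<dots> = (mat_inv A * A) * B" by (rule assoc_mult_mat[OF inv(4) A B, symmetric])
  also have "\<dots> = B" using inv(3) B by simp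
  finally show ?thesis .
qed

lemma invertible_mat_kernel:
  fixes Q :: "real mat"
  assumes Q: "Q \<in> carrier_mat m m" and inv: "invertible_mat Q"
    and x: "\<And>i. i < m \<Longrightarrow> (\<Sum>j<m. Q $$ (i, j) * x j) = 0" and i: "i < m"
  shows "x i = 0"
proof -
  obtain P where "P * Q = 1\<^sub>m (dim_row P)" "Q * P = 1\<^sub>m m"
    using inv Q unfolding invertible_mat_def inverts_mat_def by auto
  then have P: "P \<in> carrier_mat m m" and PQ: "P * Q = 1\<^sub>m m"
    using Q by (metis carrier_matD carrier_matI index_mult_mat(2,3) index_one_mat(2,3))+
  have "x i = (\<Sum>j<m. (P * Q) $$ (i, j) * x j)"
    unfolding PQ using i by (simp add: if_distrib[where f="\<lambda>y. y * _"] cong: if_cong)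
  also have "\<dots> = (\<Sum>j<m. \<Sum>l<m. P $$ (i, l) * Q $$ (l, j) * x j)"
    by (intro sum.cong refl) (simp add: mat_mult_index_sum[OF P Q i] sum_distrib_right del: index_mult_mat)
  also have "\<dots> = (\<Sum>l<m. P $$ (i, l) * (\<Sum>j<m. Q $$ (l, j) * x j))"
    by (subst sum.swap) (simp add: sum_distrib_left mult_ac)
  also have "\<dots> = 0" using x by simp
  finally show ?thesis .
qed

lemma linear_system_solvable:
  fixes A :: "real mat"
  assumes A: "A \<in> carrier_mat n n"
    and inj: "trivial_kernel n A"
  obtains x where "\<And>i. i < n \<Longrightarrow> (\<Sum>j<n. A $$ (i, j) * x j) = b i"
proof
  note inv = mat_inv_inverts[OF A inj]
  let ?b = "Matrix.mat n 1 (\<lambda>(i, _). b i)"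
  fix i assume i: "i < n"
  have b: "?b \<in> carrier_mat n 1" by simp
  have Pb: "mat_inv A * ?b \<in> carrier_mat n 1" by (rule mult_carrier_mat[OF inv(4) b])
  have "(\<Sum>j<n. A $$ (i, j) * (mat_inv A * ?b) $$ (j, 0)) = (A * (mat_inv A * ?b)) $$ (i, 0)"
    by (rule mat_mult_index_sum[OF A Pb i, symmetric]) simp
  also have "A * (mat_inv A * ?b) = (A * mat_inv A) * ?b"
    by (rule assoc_mult_mat[OF A inv(4) b, symmetric])
  also have "\<dots> = ?b" using inv(2) b by simp
  finally show "(\<Sum>j<n. A $$ (i, j) * (mat_inv A * ?b) $$ (j, 0)) = b i" using i by simp
qed

text \<open>Replace the rows of \<open>Q\<close> in \<open>S\<close> by unit rows to get \<open>A\<close>. A kernel vector of \<open>A\<close>, or else the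
  solution of \<open>A x = indicator S\<close>, is a nonzero kernel vector of \<open>Q\<close>.\<close>

lemma subgenerator_no_closed_class:
  fixes Q :: "real mat"
  assumes Q: "Q \<in> carrier_mat m m" and inv: "invertible_mat Q"
    and S: "S \<subseteq> {..<m}" "S \<noteq> {}"
    and closed: "\<And>i j. i \<in> S \<Longrightarrow> j < m \<Longrightarrow> j \<notin> S \<Longrightarrow> Q $$ (i, j) = 0"
    and row: "\<And>i. i \<in> S \<Longrightarrow> (\<Sum>j<m. Q $$ (i, j)) = 0"
  shows False
proof -
  define A where "A = Matrix.mat m m (\<lambda>(i, j). if i \<in> S then (if i = j then 1 else 0) else Q $$ (i, j))"
  have A: "A \<in> carrier_mat m m" by (simp add: A_def)
  have As: "(\<Sum>j<m. A $$ (i, j) * x j) = (if i \<in> S then x i else (\<Sum>j<m. Q $$ (i, j) * x j))"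
    if "i < m" for i x
    using that by (simp add: A_def if_distrib[where f="\<lambda>y. y * _"] cong: if_cong)
  have inj: "trivial_kernel m A"
  proof (rule trivial_kernelI, rule invertible_mat_kernel[OF Q inv])
    fix x :: "nat \<Rightarrow> real" and i assume x: "\<And>i. i < m \<Longrightarrow> (\<Sum>j<m. A $$ (i, j) * x j) = 0" and i: "i < m"
    show "i < m" by (rule i)
    have xS: "x j = 0" if "j \<in> S" for j using x[of j] As[of j x] that S(1) by auto
    fix l assume l: "l < m"
    show "(\<Sum>j<m. Q $$ (l, j) * x j) = 0"
    proof (cases "l \<in> S")
      case True
      show ?thesis
      proof (rule sum.neutral, rule ballI)
        fix j assume "j \<in> {..<m}"
        then show "Q $$ (l, j) * x j = 0"
          using closed[OF True, of j] xS[of j] by (cases "j \<in> S") auto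
      qed
    next
      case False
      then show ?thesis using x[OF l] As[OF l, of x] by simp
    qed
  qed
  obtain x where x: "\<And>i. i < m \<Longrightarrow> (\<Sum>j<m. A $$ (i, j) * x j) = (if i \<in> S then 1 else 0)"
    using linear_system_solvable[OF A inj, of "\<lambda>i. if i \<in> S then 1 else 0"] by blast
  have xS: "x j = 1" if "j \<in> S" for j using x[of j] As[of j x] that S(1) by auto
  have "(\<Sum>j<m. Q $$ (l, j) * x j) = 0" if l: "l < m" for l
  proof (cases "l \<in> S")
    case True
    have "(\<Sum>j<m. Q $$ (l, j) * x j) = (\<Sum>j<m. Q $$ (l, j))"
      by (rule sum.cong) (use closed[OF True] xS in fastforce)+
    then show ?thesis using row[OF True] by simp
  next
    case False
    then show ?thesis using x[OF l] As[OF l, of x] by simp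
  qed
  then have "x i = 0" if "i < m" for i using invertible_mat_kernel[OF Q inv, of x] that by blast
  then show False using xS S by force
qed

text \<open>Maximum principle: a nonzero solution would attain its maximal modulus on a closed class.\<close>

lemma subgenerator_kernel:
  fixes Q :: "real mat" and d v :: "nat \<Rightarrow> real"
  assumes Q: "Q \<in> carrier_mat m m" and inv: "invertible_mat Q"
    and off: "\<And>i j. i < m \<Longrightarrow> j < m \<Longrightarrow> i \<noteq> j \<Longrightarrow> 0 \<le> Q $$ (i, j)"
    and row: "\<And>i. i < m \<Longrightarrow> (\<Sum>j<m. Q $$ (i, j)) \<le> 0"
    and d: "\<And>i. i < m \<Longrightarrow> 0 \<le> d i"
    and v: "\<And>i. i < m \<Longrightarrow> v i \<noteq> 0 \<Longrightarrow> (\<Sum>j<m. Q $$ (i, j) * v j) = d i * v i"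
    and i: "i < m"
  shows "v i = 0"
proof (rule ccontr)
  assume "v i \<noteq> 0"
  define c where "c = Max ((\<lambda>j. \<bar>v j\<bar>) ` {..<m})"
  have le: "\<bar>v j\<bar> \<le> c" if "j < m" for j unfolding c_def using that by (intro Max_ge) auto
  have c: "0 < c" using le[OF i] \<open>v i \<noteq> 0\<close> by linarith
  define S where "S = {j. j < m \<and> \<bar>v j\<bar> = c}"
  have "c \<in> (\<lambda>j. \<bar>v j\<bar>) ` {..<m}" unfolding c_def using i by (intro Max_in) auto
  then have S: "S \<subseteq> {..<m}" "S \<noteq> {}" unfolding S_def by auto
  have key: "(\<Sum>j<m. Q $$ (k, j)) = 0 \<and> (\<forall>j<m. j \<notin> S \<longrightarrow> Q $$ (k, j) = 0)" if "k \<in> S" for k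
  proof -
    have k: "k < m" "\<bar>v k\<bar> = c" using that by (auto simp: S_def)
    define s where "s = sgn (v k)"
    have sv: "s * v k = c" unfolding s_def using k by (simp add: abs_sgn mult.commute)
    have s1: "\<bar>s\<bar> = 1" unfolding s_def using k c by (simp add: abs_sgn_eq)
    have sle: "s * v j \<le> \<bar>v j\<bar>" for j using s1 abs_ge_self[of "s * v j"] by (simp add: abs_mult)
    have "s * (\<Sum>j<m. Q $$ (k, j) * v j) = s * (d k * v k)"
      using v[of k] k c by auto
    then have 1: "(\<Sum>j<m. Q $$ (k, j) * (s * v j)) = d k * c"
      using sv by (simp add: sum_distrib_left mult_ac)
    \<comment> \<open>All summands on the left are \<ge> 0: the factor vanishes at j = k, and the
      other entries are off-diagonal. The right side is \<le> 0. Hence every summand is 0, the row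
      sum is 0, and Q (k, j) = 0 where |v j| < c.\<close>
    have 2: "(\<Sum>j<m. Q $$ (k, j) * (c - s * v j)) = c * (\<Sum>j<m. Q $$ (k, j)) - d k * c"
      unfolding 1[symmetric] by (simp add: sum_distrib_left algebra_simps sum_subtractf)
    have nn: "0 \<le> Q $$ (k, j) * (c - s * v j)" if "j < m" for j
    proof (cases "j = k")
      case False
      have "s * v j \<le> c" using sle[of j] le[OF that] by linarith
      then show ?thesis using off[OF k(1) that] False by simp
    qed (simp add: sv)
    have a: "c * (\<Sum>j<m. Q $$ (k, j)) \<le> 0" using row[OF k(1)] c by (simp add: mult_nonneg_nonpos)
    have b: "0 \<le> d k * c" using d[OF k(1)] c by simp
    have "0 \<le> (\<Sum>j<m. Q $$ (k, j) * (c - s * v j))" using nn by (intro sum_nonneg) auto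
    then have z: "(\<Sum>j<m. Q $$ (k, j) * (c - s * v j)) = 0" "c * (\<Sum>j<m. Q $$ (k, j)) = 0"
      using 2 a b by linarith+
    have "Q $$ (k, j) = 0" if "j < m" "j \<notin> S" for j
    proof -
      have "Q $$ (k, j) * (c - s * v j) = 0"
        using z(1) nn that(1) by (subst (asm) sum_nonneg_eq_0_iff) auto
      moreover have "\<bar>v j\<bar> < c" using le[OF that(1)] that by (auto simp: S_def less_le)
      then have "c - s * v j \<noteq> 0" using sle[of j] by linarith
      ultimately show ?thesis by simp
    qed
    then show ?thesis using z(2) c by simp
  qed
  show False
    by (rule subgenerator_no_closed_class[OF Q inv S]) (use key in auto)
qed

section \<open>Indices and entries of blocks\<close>

definition index_in :: "nat set \<Rightarrow> nat \<Rightarrow> nat" where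
  "index_in I i = card {a\<in>I. a < i}"

lemma pick_index_in: "i \<in> I \<Longrightarrow> pick I (index_in I i) = i"
  unfolding index_in_def by (rule pick_card_in_set)

lemma index_in_pick: "k < card I \<Longrightarrow> index_in I (pick I k) = k"
  unfolding index_in_def by (rule card_pick_le)

lemma index_in_less: "finite I \<Longrightarrow> i \<in> I \<Longrightarrow> index_in I i < card I"
  unfolding index_in_def by (intro psubset_card_mono) auto

lemma sum_pick:
  assumes "finite I"
  shows "(\<Sum>k<card I. f (pick I k)) = sum f I"
proof (rule sum.reindex_bij_witness[where i="index_in I" and j="pick I"])
qed (use assms in \<open>auto simp: pick_index_in index_in_pick index_in_less pick_in_set_le\<close>)

lemma submatrix_carrier:
  assumes "A \<in> carrier_mat m n" "I \<subseteq> {..<m}" "J \<subseteq> {..<n}"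
  shows "submatrix A I J \<in> carrier_mat (card I) (card J)"
proof -
  have "{i. i < m \<and> i \<in> I} = I" "{j. j < n \<and> j \<in> J} = J" using assms by auto
  then show ?thesis using assms(1) by (intro carrier_matI) (simp_all add: dim_submatrix)
qed

lemma submatrix_entry:
  assumes "A \<in> carrier_mat m n" "I \<subseteq> {..<m}" "J \<subseteq> {..<n}" "i < card I" "j < card J"
  shows "submatrix A I J $$ (i, j) = A $$ (pick I i, pick J j)"
proof -
  have "{i. i < m \<and> i \<in> I} = I" "{j. j < n \<and> j \<in> J} = J" using assms by auto
  then show ?thesis using assms by (intro submatrix_index) simp_all
qed

lemma submatrix_UNIV_right:
  assumes "A \<in> carrier_mat m n" "I \<subseteq> {..<m}"
  shows "submatrix A I UNIV \<in> carrier_mat (card I) n"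
    and "i < card I \<Longrightarrow> j < n \<Longrightarrow> submatrix A I UNIV $$ (i, j) = A $$ (pick I i, j)"
proof -
  have e: "{i. i < m \<and> i \<in> I} = I" "{j. j < n \<and> j \<in> UNIV} = {..<n}" using assms by auto
  then show "submatrix A I UNIV \<in> carrier_mat (card I) n"
    using assms(1) by (intro carrier_matI) (simp_all add: dim_submatrix)
  show "submatrix A I UNIV $$ (i, j) = A $$ (pick I i, j)" if "i < card I" "j < n"
    using submatrix_index[of i A I j UNIV] that e assms(1) by (simp add: pick_UNIV)
qed

lemma submatrix_UNIV_left:
  assumes "A \<in> carrier_mat m n" "J \<subseteq> {..<n}"
  shows "submatrix A UNIV J \<in> carrier_mat m (card J)"
    and "i < m \<Longrightarrow> j < card J \<Longrightarrow> submatrix A UNIV J $$ (i, j) = A $$ (i, pick J j)"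
proof -
  have e: "{j. j < n \<and> j \<in> J} = J" "{i. i < m \<and> i \<in> UNIV} = {..<m}" using assms by auto
  then show "submatrix A UNIV J \<in> carrier_mat m (card J)"
    using assms(1) by (intro carrier_matI) (simp_all add: dim_submatrix)
  show "submatrix A UNIV J $$ (i, j) = A $$ (i, pick J j)" if "i < m" "j < card J"
    using submatrix_index[of i A UNIV j J] that e assms(1) by (simp add: pick_UNIV)
qed

section \<open>The linear system split by positivity of the first reward\<close>

locale reward_blocks =
  fixes m :: nat and Q R :: "real mat"
  assumes Q: "Q \<in> carrier_mat m m" "invertible_mat Q" and R: "R \<in> carrier_mat 2 m"
    and off: "\<And>i j. i < m \<Longrightarrow> j < m \<Longrightarrow> i \<noteq> j \<Longrightarrow> 0 \<le> Q $$ (i, j)"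
    and row: "\<And>i. i < m \<Longrightarrow> (\<Sum>j<m. Q $$ (i, j)) \<le> 0"
    and R_nonneg: "\<And>i j. i < 2 \<Longrightarrow> j < m \<Longrightarrow> 0 \<le> R $$ (i, j)"
begin

definition "E0 = {j. j < m \<and> R $$ (0, j) = 0}"
definition "Ep = {j. j < m \<and> R $$ (0, j) > 0}"
definition "Q00 = submatrix Q E0 E0"
definition "Q0p = submatrix Q E0 Ep"
definition "Qp0 = submatrix Q Ep E0"
definition "Qpp = submatrix Q Ep Ep"
definition "\<eta> = - (Q * ones_col m)"
definition "\<eta>0 = submatrix \<eta> E0 UNIV"
definition "\<eta>p = submatrix \<eta> Ep UNIV"
definition "Rp = reward_diag R 0 Ep"
definition "Dp = reward_diag R 1 Ep"
definition "D0 = reward_diag R 1 E0"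
definition "B s = mat_inv (s \<cdot>\<^sub>m D0 - Q00)"
definition "W s = mat_inv Rp * ((Qpp - s \<cdot>\<^sub>m Dp) - Qp0 * mat_inv (Q00 - s \<cdot>\<^sub>m D0) * Q0p)"
definition "\<eta>_fun s = mat_inv Rp * (Qp0 * B s * \<eta>0 + \<eta>p)"

abbreviation "k0 \<equiv> card E0"
abbreviation "kp \<equiv> card Ep"

lemma E_sub: "E0 \<subseteq> {..<m}" "Ep \<subseteq> {..<m}"
  by (auto simp: E0_def Ep_def)

lemma E_finite: "finite E0" "finite Ep"
  using E_sub finite_subset by blast+

lemma E_partition: "E0 \<union> Ep = {..<m}" "E0 \<inter> Ep = {}"
  using R_nonneg[of 0] by (fastforce simp: E0_def Ep_def less_le)+

lemma sum_E:
  fixes f :: "nat \<Rightarrow> real"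
  shows "(\<Sum>j<m. f j) = (\<Sum>k<k0. f (pick E0 k)) + (\<Sum>k<kp. f (pick Ep k))"
  unfolding sum_pick[OF E_finite(1)] sum_pick[OF E_finite(2)] E_partition(1)[symmetric]
  by (rule sum.union_disjoint[OF E_finite E_partition(2)])

lemma pick_E: "k < k0 \<Longrightarrow> pick E0 k \<in> E0" "k < kp \<Longrightarrow> pick Ep k \<in> Ep"
  by (simp_all add: pick_in_set_le)

lemma \<eta>_carrier: "\<eta> \<in> carrier_mat m 1"
  using Q by (simp add: \<eta>_def ones_col_def)

lemma \<eta>_index: "i < m \<Longrightarrow> \<eta> $$ (i, 0) = - (\<Sum>j<m. Q $$ (i, j))"
  using mat_mult_index_sum[OF Q(1), of "ones_col m" 1 i 0] Q
  by (simp add: \<eta>_def ones_col_def)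

lemma carriers:
  "Q00 \<in> carrier_mat k0 k0" "Q0p \<in> carrier_mat k0 kp" "Qp0 \<in> carrier_mat kp k0" "Qpp \<in> carrier_mat kp kp"
  "\<eta>0 \<in> carrier_mat k0 1" "\<eta>p \<in> carrier_mat kp 1"
  "Rp \<in> carrier_mat kp kp" "Dp \<in> carrier_mat kp kp" "D0 \<in> carrier_mat k0 k0"
  unfolding Q00_def Q0p_def Qp0_def Qpp_def \<eta>0_def \<eta>p_def Rp_def Dp_def D0_def reward_diag_def
  by (intro submatrix_carrier[OF Q(1)] E_sub submatrix_UNIV_right(1)[OF \<eta>_carrier] mat_diag_dim)+

text \<open>Extend v by 0 outside F. The equation may then fail outside F, which is why
  \<open>subgenerator_kernel\<close> asks for it only where v is nonzero; the argument about closed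
  classes can thus use the full invertible matrix \<open>Q\<close>.\<close>

lemma kernel_restricted:
  assumes F: "F \<subseteq> {..<m}" and d: "\<And>i. i < m \<Longrightarrow> 0 \<le> d i"
    and v: "\<And>i. i \<in> F \<Longrightarrow> (\<Sum>j\<in>F. Q $$ (i, j) * v j) = d i * v i" and i: "i \<in> F"
  shows "v i = 0"
proof -
  let ?v = "\<lambda>i. if i \<in> F then v i else 0"
  have "(\<Sum>j<m. Q $$ (i, j) * ?v j) = d i * ?v i" if "i < m" "?v i \<noteq> 0" for i
  proof -
    have iF: "i \<in> F" using that by (auto split: if_splits)
    have "(\<Sum>j<m. Q $$ (i, j) * ?v j) = (\<Sum>j\<in>F. Q $$ (i, j) * v j)"
      by (rule sum.mono_neutral_cong_right) (use F in auto)
    then show ?thesis using v[OF iF] iF by simp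
  qed
  then have "?v i = 0"
    using i F by (intro subgenerator_kernel[OF Q off row d]) auto
  then show ?thesis using i by simp
qed

lemma A_carrier: "s \<cdot>\<^sub>m D0 - Q00 \<in> carrier_mat k0 k0"
  using carriers by auto

text \<open>A kernel vector x satisfies Q00 x = s D0 x, the situation of
  \<open>kernel_restricted\<close> on \<open>E0\<close> with d equal to s times the second
  reward.\<close>

lemma D0_Q00_trivial_kernel:
  assumes s: "0 \<le> s"
  shows "trivial_kernel k0 (s \<cdot>\<^sub>m D0 - Q00)"
proof (rule trivial_kernelI)
  fix x i
  assume x: "\<And>i. i < k0 \<Longrightarrow> (\<Sum>j<k0. (s \<cdot>\<^sub>m D0 - Q00) $$ (i, j) * x j) = 0" and i: "i < k0"
  let ?v = "\<lambda>i. x (index_in E0 i)"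
  have "?v (pick E0 i) = 0"
  proof (rule kernel_restricted[OF E_sub(1), where d="\<lambda>i. s * R $$ (1, i)" and v="?v"])
    show "0 \<le> s * R $$ (1, i)" if "i < m" for i using s R_nonneg[of 1 i] that by simp
    show "pick E0 i \<in> E0" by (rule pick_E(1)[OF i])
    fix l assume l: "l \<in> E0"
    let ?l = "index_in E0 l"
    have ll: "?l < k0" "pick E0 ?l = l" using index_in_less[OF E_finite(1) l] pick_index_in[OF l] by auto
    have "0 = (\<Sum>j<k0. (s \<cdot>\<^sub>m D0 - Q00) $$ (?l, j) * x j)" using x[OF ll(1)] by simp
    also have "\<dots> = (\<Sum>j<k0. (if ?l = j then s * R $$ (1, l) * x j else 0) - Q $$ (l, pick E0 j) * ?v (pick E0 j))"
    proof (rule sum.cong[OF refl])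
      fix j assume j: "j \<in> {..<k0}"
      have "Q00 $$ (?l, j) = Q $$ (l, pick E0 j)"
        unfolding Q00_def using submatrix_entry[OF Q(1) E_sub(1) E_sub(1) ll(1), of j] j ll(2) by simp
      then show "(s \<cdot>\<^sub>m D0 - Q00) $$ (?l, j) * x j
        = (if ?l = j then s * R $$ (1, l) * x j else 0) - Q $$ (l, pick E0 j) * ?v (pick E0 j)"
        using j ll carriers(1,9) index_in_pick[of j E0]
        by (auto simp: D0_def reward_diag_def mat_diag_def algebra_simps)
    qed
    also have "\<dots> = s * R $$ (1, l) * ?v l - (\<Sum>j<k0. Q $$ (l, pick E0 j) * ?v (pick E0 j))"
      using ll(1) by (simp add: sum_subtractf)
    also have "(\<Sum>j<k0. Q $$ (l, pick E0 j) * ?v (pick E0 j)) = (\<Sum>j\<in>E0. Q $$ (l, j) * ?v j)"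
      by (rule sum_pick[OF E_finite(1)])
    finally show "(\<Sum>j\<in>E0. Q $$ (l, j) * ?v j) = s * R $$ (1, l) * ?v l" by simp
  qed
  then show "x i = 0" using index_in_pick[OF i] by simp
qed

text \<open>\<open>W s\<close> is stated with the inverse of \<open>Q00 - s D0\<close>, the other
  formulas with that of the negative. Expressing both through \<open>B s\<close> lets the
  elimination run with a single matrix.\<close>

lemma B_inverse:
  assumes s: "0 \<le> s"
  shows "invertible_mat (s \<cdot>\<^sub>m D0 - Q00)" "(s \<cdot>\<^sub>m D0 - Q00) * B s = 1\<^sub>m k0" "B s \<in> carrier_mat k0 k0"
    and "mat_inv (Q00 - s \<cdot>\<^sub>m D0) = - B s"
proof -
  let ?A = "s \<cdot>\<^sub>m D0 - Q00"
  note inv = mat_inv_inverts[OF A_carrier D0_Q00_trivial_kernel[OF s], folded B_def]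
  show "invertible_mat ?A" "?A * B s = 1\<^sub>m k0" "B s \<in> carrier_mat k0 k0" by (fact inv)+
  have nA: "Q00 - s \<cdot>\<^sub>m D0 = - ?A"
    by (rule eq_matI) (use carriers in auto)
  have "(- ?A) * (- B s) = ?A * B s"
  proof (rule eq_matI)
    fix i j assume ij: "i < dim_row (?A * B s)" "j < dim_col (?A * B s)"
    then have ij': "i < k0" "j < k0" using inv(4) carriers by auto
    have "(- ?A * - B s) $$ (i, j) = (\<Sum>p<k0. (- ?A) $$ (i, p) * (- B s) $$ (p, j))"
      by (rule mat_mult_index_sum[OF _ _ ij']) (use A_carrier inv(4) in auto)
    also have "\<dots> = (\<Sum>p<k0. ?A $$ (i, p) * B s $$ (p, j))"
      by (rule sum.cong) (use ij' inv(4) carriers in \<open>auto simp: algebra_simps\<close>)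
    also have "\<dots> = (?A * B s) $$ (i, j)"
      by (rule mat_mult_index_sum[OF A_carrier inv(4) ij', symmetric])
    finally show "(- ?A * - B s) $$ (i, j) = (?A * B s) $$ (i, j)" .
  qed (use carriers inv(4) in auto)
  then show "mat_inv (Q00 - s \<cdot>\<^sub>m D0) = - B s"
    unfolding nA using inv(2,4) A_carrier by (intro mat_inv_unique[of _ k0]) auto
qed

lemma Rp_inverse:
  shows "Rp * mat_inv Rp = 1\<^sub>m kp" "mat_inv Rp \<in> carrier_mat kp kp"
proof -
  let ?I = "mat_diag kp (\<lambda>k. 1 / R $$ (0, pick Ep k))"
  have "Rp * ?I = mat_diag kp (\<lambda>k. R $$ (0, pick Ep k) * (1 / R $$ (0, pick Ep k)))"
    unfolding Rp_def reward_diag_def by (rule mat_diag_diag)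
  also have "\<dots> = 1\<^sub>m kp"
  proof (rule eq_matI)
    fix i j assume ij: "i < dim_row (1\<^sub>m kp :: real mat)" "j < dim_col (1\<^sub>m kp :: real mat)"
    then have "0 < R $$ (0, pick Ep j)" using pick_E(2)[of j] by (simp add: Ep_def)
    then show "mat_diag kp (\<lambda>k. R $$ (0, pick Ep k) * (1 / R $$ (0, pick Ep k))) $$ (i, j) = 1\<^sub>m kp $$ (i, j)"
      using ij by (simp add: mat_diag_def)
  qed (simp_all add: mat_diag_def)
  finally have 1: "Rp * ?I = 1\<^sub>m kp" .
  have "mat_inv Rp = ?I" by (rule mat_inv_unique[OF carriers(7) _ 1]) simp
  then show "Rp * mat_inv Rp = 1\<^sub>m kp" "mat_inv Rp \<in> carrier_mat kp kp" using 1 by simp_all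
qed

lemma W_carrier:
  assumes "0 \<le> s"
  shows "W s \<in> carrier_mat kp kp" "\<eta>_fun s \<in> carrier_mat kp 1"
proof -
  have X: "(Qpp - s \<cdot>\<^sub>m Dp) - Qp0 * mat_inv (Q00 - s \<cdot>\<^sub>m D0) * Q0p \<in> carrier_mat kp kp"
    unfolding B_inverse(4)[OF assms] using carriers by (intro carrier_matI) auto
  show "W s \<in> carrier_mat kp kp" unfolding W_def by (rule mult_carrier_mat[OF Rp_inverse(2) X])
  have Y: "Qp0 * B s * \<eta>0 + \<eta>p \<in> carrier_mat kp 1" using carriers by (intro carrier_matI) auto
  show "\<eta>_fun s \<in> carrier_mat kp 1" unfolding \<eta>_fun_def by (rule mult_carrier_mat[OF Rp_inverse(2) Y])
qed

text \<open>The values of h on \<open>Ep\<close>: the inverse of \<theta> - W(s) applied to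
  \<eta>(s), already in the form of a Laplace transform in \<theta>.\<close>

definition vp :: "real \<Rightarrow> real \<Rightarrow> real mat" where
  "vp s \<theta> = Matrix.mat kp kp (\<lambda>(i, j). laplace_mat (W s) \<theta> i j) * \<eta>_fun s"

text \<open>The values of h on \<open>E0\<close>, from the rows of G h = r h there. The first reward
  vanishes on \<open>E0\<close>, so \<theta> enters only through
  \<open>vp s \<theta>\<close>.\<close>

definition v0 :: "real \<Rightarrow> real \<Rightarrow> real mat" where
  "v0 s \<theta> = B s * (\<eta>0 + Q0p * vp s \<theta>)"

lemma v_carrier:
  assumes "0 \<le> s"
  shows "vp s \<theta> \<in> carrier_mat kp 1" "v0 s \<theta> \<in> carrier_mat k0 1"
proof -
  show 1: "vp s \<theta> \<in> carrier_mat kp 1"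
    unfolding vp_def by (rule mult_carrier_mat[OF _ W_carrier(2)[OF assms]]) simp
  show "v0 s \<theta> \<in> carrier_mat k0 1"
    unfolding v0_def
    by (rule mult_carrier_mat[OF B_inverse(3)[OF assms]], rule add_carrier_mat)
      (rule mult_carrier_mat[OF carriers(2) 1])
qed

lemma vp_equation:
  assumes s: "0 \<le> s" and \<theta>: "mat_bound (W s) < \<theta>"
  shows "\<theta> \<cdot>\<^sub>m vp s \<theta> = W s * vp s \<theta> + \<eta>_fun s"
proof -
  note W = W_carrier(1)[OF s] and E = W_carrier(2)[OF s]
  let ?L = "Matrix.mat kp kp (\<lambda>(i, j). laplace_mat (W s) \<theta> i j)"
  have L: "?L \<in> carrier_mat kp kp" by simp
  have "\<theta> \<cdot>\<^sub>m ?L = W s * ?L + 1\<^sub>m kp"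
  proof (rule eq_matI)
    fix i j assume "i < dim_row (W s * ?L + 1\<^sub>m kp)" "j < dim_col (W s * ?L + 1\<^sub>m kp)"
    then have ij: "i < kp" "j < kp" by auto
    have "(W s * ?L) $$ (i, j) = (\<Sum>p<kp. W s $$ (i, p) * laplace_mat (W s) \<theta> p j)"
      unfolding mat_mult_index_sum[OF W L ij] using ij by (intro sum.cong) auto
    then show "(\<theta> \<cdot>\<^sub>m ?L) $$ (i, j) = (W s * ?L + 1\<^sub>m kp) $$ (i, j)"
      using laplace_mat_resolvent[OF W ij \<theta>] ij W by (simp del: index_mult_mat(1))
  qed (use W in auto)
  then have "(\<theta> \<cdot>\<^sub>m ?L) * \<eta>_fun s = (W s * ?L + 1\<^sub>m kp) * \<eta>_fun s" by simp
  also have "\<dots> = W s * ?L * \<eta>_fun s + 1\<^sub>m kp * \<eta>_fun s"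
    by (rule add_mult_distrib_mat[OF mult_carrier_mat[OF W L] one_carrier_mat E])
  also have "W s * ?L * \<eta>_fun s = W s * vp s \<theta>"
    unfolding vp_def by (rule assoc_mult_mat[OF W L E])
  also have "1\<^sub>m kp * \<eta>_fun s = \<eta>_fun s" using E by simp
  also have "(\<theta> \<cdot>\<^sub>m ?L) * \<eta>_fun s = \<theta> \<cdot>\<^sub>m vp s \<theta>"
    unfolding vp_def by (rule mult_smult_assoc_mat[OF L E])
  finally show ?thesis .
qed

text \<open>Undoes the elimination: multiplying by \<open>Rp\<close> clears its inverse from W and
  \<eta>, and the terms containing \<open>B s\<close> recombine to
  \<open>Qp0 * v0 s \<theta>\<close>. What results are the rows of the original system on
  \<open>Ep\<close>.\<close>

lemma Rp_vp:
  assumes s: "0 \<le> s" and \<theta>: "mat_bound (W s) < \<theta>"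
  shows "\<theta> \<cdot>\<^sub>m (Rp * vp s \<theta>) = (Qpp - s \<cdot>\<^sub>m Dp) * vp s \<theta> + Qp0 * v0 s \<theta> + \<eta>p"
proof -
  let ?v = "vp s \<theta>"
  note c = carriers and v = v_carrier(1)[OF s, of \<theta>] and Bc = B_inverse(3)[OF s]
  note W = W_carrier(1)[OF s] and E = W_carrier(2)[OF s]
  note RI = Rp_inverse
  have cancel: "Rp * (mat_inv Rp * X) = X" if "X \<in> carrier_mat kp j" for X j
    using assoc_mult_mat[OF c(7) RI(2) that] RI(1) that by simp
  let ?D = "Qpp - s \<cdot>\<^sub>m Dp"
  have D: "?D \<in> carrier_mat kp kp" using c by auto
  have QB: "Qp0 * B s \<in> carrier_mat kp k0" by (rule mult_carrier_mat[OF c(3) Bc])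
  have QBQ: "Qp0 * B s * Q0p \<in> carrier_mat kp kp" by (rule mult_carrier_mat[OF QB c(2)])
  have QBe: "Qp0 * B s * \<eta>0 \<in> carrier_mat kp 1" by (rule mult_carrier_mat[OF QB c(5)])
  have Qv: "Q0p * ?v \<in> carrier_mat k0 1" by (rule mult_carrier_mat[OF c(2) v])
  have neg: "?D - Qp0 * mat_inv (Q00 - s \<cdot>\<^sub>m D0) * Q0p = ?D + Qp0 * B s * Q0p"
  proof -
    have "Qp0 * mat_inv (Q00 - s \<cdot>\<^sub>m D0) * Q0p = - (Qp0 * B s * Q0p)"
      unfolding B_inverse(4)[OF s] using c Bc QB by simp
    then show ?thesis using D QBQ by (intro eq_matI) auto
  qed
  have RW: "Rp * W s = ?D + Qp0 * B s * Q0p"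
    unfolding W_def neg by (rule cancel[of _ kp]) (use D QBQ in auto)
  have RE: "Rp * \<eta>_fun s = Qp0 * B s * \<eta>0 + \<eta>p"
    unfolding \<eta>_fun_def by (rule cancel[of _ 1]) (use c QBe in auto)
  have "\<theta> \<cdot>\<^sub>m (Rp * ?v) = Rp * (\<theta> \<cdot>\<^sub>m ?v)"
    by (rule mult_smult_distrib[OF c(7) v, symmetric])
  also have "\<dots> = Rp * (W s * ?v) + Rp * \<eta>_fun s"
    unfolding vp_equation[OF s \<theta>] by (rule mult_add_distrib_mat[OF c(7) mult_carrier_mat[OF W v] E])
  also have "Rp * (W s * ?v) = Rp * W s * ?v"
    by (rule assoc_mult_mat[OF c(7) W v, symmetric])
  also have "\<dots> = ?D * ?v + Qp0 * B s * Q0p * ?v"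
    unfolding RW by (rule add_mult_distrib_mat[OF D QBQ v])
  also have "Qp0 * B s * Q0p * ?v = Qp0 * B s * (Q0p * ?v)"
    by (rule assoc_mult_mat[OF QB c(2) v])
  also note RE
  finally have 1: "\<theta> \<cdot>\<^sub>m (Rp * ?v) = ?D * ?v + Qp0 * B s * (Q0p * ?v) + (Qp0 * B s * \<eta>0 + \<eta>p)" .
  have "Qp0 * v0 s \<theta> = Qp0 * B s * (\<eta>0 + Q0p * ?v)"
    unfolding v0_def by (rule assoc_mult_mat[OF c(3) Bc, symmetric]) (use c Qv in auto)
  also have "\<dots> = Qp0 * B s * \<eta>0 + Qp0 * B s * (Q0p * ?v)"
    by (rule mult_add_distrib_mat[OF QB c(5) Qv])
  finally have 2: "Qp0 * v0 s \<theta> = Qp0 * B s * \<eta>0 + Qp0 * B s * (Q0p * ?v)" .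
  have X: "?D * ?v \<in> carrier_mat kp 1" "Qp0 * B s * (Q0p * ?v) \<in> carrier_mat kp 1"
    by (rule mult_carrier_mat[OF D v], rule mult_carrier_mat[OF QB Qv])
  show ?thesis unfolding 1 2
    by (rule eq_matI) (use X QBe c(6) in \<open>auto simp del: index_mult_mat(1)\<close>)
qed

lemma A_v0:
  assumes s: "0 \<le> s"
  shows "(s \<cdot>\<^sub>m D0 - Q00) * v0 s \<theta> = \<eta>0 + Q0p * vp s \<theta>"
proof -
  have X: "\<eta>0 + Q0p * vp s \<theta> \<in> carrier_mat k0 1"
    using mult_carrier_mat[OF carriers(2) v_carrier(1)[OF s]] by auto
  show ?thesis
    unfolding v0_def assoc_mult_mat[OF A_carrier B_inverse(3)[OF s] X, symmetric] B_inverse(2)[OF s]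
    by (rule left_mult_one_mat[OF X])
qed

definition v :: "real \<Rightarrow> real \<Rightarrow> nat \<Rightarrow> real" where
  "v s \<theta> i = (if i \<in> E0 then v0 s \<theta> $$ (index_in E0 i, 0) else vp s \<theta> $$ (index_in Ep i, 0))"

lemma v_pick:
  "k < k0 \<Longrightarrow> v s \<theta> (pick E0 k) = v0 s \<theta> $$ (k, 0)"
  "k < kp \<Longrightarrow> v s \<theta> (pick Ep k) = vp s \<theta> $$ (k, 0)"
  using pick_E[of k] E_partition(2) by (auto simp: v_def index_in_pick)

text \<open>This is G h = r h at the transient states: \<eta> is the column of the generator for the
  absorbing state, where h is 1.\<close>

lemma v_equation:
  assumes s: "0 \<le> s" and \<theta>: "mat_bound (W s) < \<theta>" and i: "i < m"
  shows "(\<Sum>j<m. Q $$ (i, j) * v s \<theta> j) + \<eta> $$ (i, 0) = (\<theta> * R $$ (0, i) + s * R $$ (1, i)) * v s \<theta> i"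
proof -
  note c = carriers and vc = v_carrier[OF s, of \<theta>]
  have sum: "(\<Sum>j<m. Q $$ (i, j) * v s \<theta> j)
      = (\<Sum>k<k0. Q $$ (i, pick E0 k) * v0 s \<theta> $$ (k, 0)) + (\<Sum>k<kp. Q $$ (i, pick Ep k) * vp s \<theta> $$ (k, 0))"
    unfolding sum_E by (simp add: v_pick)
  show ?thesis
  proof (cases "i \<in> E0")
    case True
    let ?i = "index_in E0 i"
    have ii: "?i < k0" "pick E0 ?i = i" using index_in_less[OF E_finite(1) True] pick_index_in[OF True] by auto
    have "((s \<cdot>\<^sub>m D0 - Q00) * v0 s \<theta>) $$ (?i, 0)
        = (\<Sum>k<k0. (s \<cdot>\<^sub>m D0 - Q00) $$ (?i, k) * v0 s \<theta> $$ (k, 0))"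
      by (rule mat_mult_index_sum[OF A_carrier vc(2) ii(1)]) simp
    also have "\<dots> = (\<Sum>k<k0. (if ?i = k then s * R $$ (1, i) * v0 s \<theta> $$ (k, 0) else 0) - Q $$ (i, pick E0 k) * v0 s \<theta> $$ (k, 0))"
    proof (rule sum.cong[OF refl])
      fix k assume k: "k \<in> {..<k0}"
      have "Q00 $$ (?i, k) = Q $$ (i, pick E0 k)"
        unfolding Q00_def using submatrix_entry[OF Q(1) E_sub(1) E_sub(1) ii(1), of k] k ii(2) by simp
      then show "(s \<cdot>\<^sub>m D0 - Q00) $$ (?i, k) * v0 s \<theta> $$ (k, 0)
        = (if ?i = k then s * R $$ (1, i) * v0 s \<theta> $$ (k, 0) else 0) - Q $$ (i, pick E0 k) * v0 s \<theta> $$ (k, 0)"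
        using k ii c(1,9) by (auto simp: D0_def reward_diag_def mat_diag_def algebra_simps)
    qed
    also have "\<dots> = s * R $$ (1, i) * v s \<theta> i - (\<Sum>k<k0. Q $$ (i, pick E0 k) * v0 s \<theta> $$ (k, 0))"
      using ii True by (simp add: sum_subtractf v_def)
    finally have 1: "((s \<cdot>\<^sub>m D0 - Q00) * v0 s \<theta>) $$ (?i, 0) = \<dots>" .
    have "(Q0p * vp s \<theta>) $$ (?i, 0) = (\<Sum>k<kp. Q0p $$ (?i, k) * vp s \<theta> $$ (k, 0))"
      by (rule mat_mult_index_sum[OF c(2) vc(1) ii(1)]) simp
    also have "\<dots> = (\<Sum>k<kp. Q $$ (i, pick Ep k) * vp s \<theta> $$ (k, 0))"
      unfolding Q0p_def using submatrix_entry[OF Q(1) E_sub(1) E_sub(2) ii(1)] ii(2) by simp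
    finally have 2: "(Q0p * vp s \<theta>) $$ (?i, 0) = \<dots>" .
    have 3: "\<eta>0 $$ (?i, 0) = \<eta> $$ (i, 0)"
      unfolding \<eta>0_def using submatrix_UNIV_right(2)[OF \<eta>_carrier E_sub(1) ii(1), of 0] ii(2) by simp
    have "((s \<cdot>\<^sub>m D0 - Q00) * v0 s \<theta>) $$ (?i, 0) = \<eta>0 $$ (?i, 0) + (Q0p * vp s \<theta>) $$ (?i, 0)"
      unfolding A_v0[OF s] using ii(1) c vc by (simp del: index_mult_mat(1))
    then show ?thesis
      unfolding 1 2 3 sum using True by (simp add: E0_def)
  next
    case False
    then have iP: "i \<in> Ep" using i E_partition(1) by auto
    let ?i = "index_in Ep i"
    have ii: "?i < kp" "pick Ep ?i = i" using index_in_less[OF E_finite(2) iP] pick_index_in[OF iP] by auto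
    have D: "Qpp - s \<cdot>\<^sub>m Dp \<in> carrier_mat kp kp" using c by auto
    have "(Rp * vp s \<theta>) $$ (?i, 0) = (\<Sum>k<kp. Rp $$ (?i, k) * vp s \<theta> $$ (k, 0))"
      by (rule mat_mult_index_sum[OF c(7) vc(1) ii(1)]) simp
    also have "\<dots> = (\<Sum>k<kp. if ?i = k then R $$ (0, i) * vp s \<theta> $$ (k, 0) else 0)"
      by (rule sum.cong) (use ii in \<open>auto simp: Rp_def reward_diag_def mat_diag_def\<close>)
    also have "\<dots> = R $$ (0, i) * v s \<theta> i" using ii False by (simp add: v_def)
    finally have 0: "(Rp * vp s \<theta>) $$ (?i, 0) = R $$ (0, i) * v s \<theta> i" .
    have "((Qpp - s \<cdot>\<^sub>m Dp) * vp s \<theta>) $$ (?i, 0)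
        = (\<Sum>k<kp. (Qpp - s \<cdot>\<^sub>m Dp) $$ (?i, k) * vp s \<theta> $$ (k, 0))"
      by (rule mat_mult_index_sum[OF D vc(1) ii(1)]) simp
    also have "\<dots> = (\<Sum>k<kp. Q $$ (i, pick Ep k) * vp s \<theta> $$ (k, 0) - (if ?i = k then s * R $$ (1, i) * vp s \<theta> $$ (k, 0) else 0))"
    proof (rule sum.cong[OF refl])
      fix k assume k: "k \<in> {..<kp}"
      have "Qpp $$ (?i, k) = Q $$ (i, pick Ep k)"
        unfolding Qpp_def using submatrix_entry[OF Q(1) E_sub(2) E_sub(2) ii(1), of k] k ii(2) by simp
      then show "(Qpp - s \<cdot>\<^sub>m Dp) $$ (?i, k) * vp s \<theta> $$ (k, 0)
        = Q $$ (i, pick Ep k) * vp s \<theta> $$ (k, 0) - (if ?i = k then s * R $$ (1, i) * vp s \<theta> $$ (k, 0) else 0)"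
        using k ii c(4,8) by (auto simp: Dp_def reward_diag_def mat_diag_def algebra_simps)
    qed
    also have "\<dots> = (\<Sum>k<kp. Q $$ (i, pick Ep k) * vp s \<theta> $$ (k, 0)) - s * R $$ (1, i) * v s \<theta> i"
      using ii False by (simp add: sum_subtractf v_def)
    finally have 1: "((Qpp - s \<cdot>\<^sub>m Dp) * vp s \<theta>) $$ (?i, 0) = \<dots>" .
    have "(Qp0 * v0 s \<theta>) $$ (?i, 0) = (\<Sum>k<k0. Qp0 $$ (?i, k) * v0 s \<theta> $$ (k, 0))"
      by (rule mat_mult_index_sum[OF c(3) vc(2) ii(1)]) simp
    also have "\<dots> = (\<Sum>k<k0. Q $$ (i, pick E0 k) * v0 s \<theta> $$ (k, 0))"
      unfolding Qp0_def using submatrix_entry[OF Q(1) E_sub(2) E_sub(1) ii(1)] ii(2) by simp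
    finally have 2: "(Qp0 * v0 s \<theta>) $$ (?i, 0) = \<dots>" .
    have 3: "\<eta>p $$ (?i, 0) = \<eta> $$ (i, 0)"
      unfolding \<eta>p_def using submatrix_UNIV_right(2)[OF \<eta>_carrier E_sub(2) ii(1), of 0] ii(2) by simp
    have "(\<theta> \<cdot>\<^sub>m (Rp * vp s \<theta>)) $$ (?i, 0) = \<theta> * (Rp * vp s \<theta>) $$ (?i, 0)"
      using ii(1) c vc by (simp del: index_mult_mat(1))
    moreover have "((Qpp - s \<cdot>\<^sub>m Dp) * vp s \<theta> + Qp0 * v0 s \<theta> + \<eta>p) $$ (?i, 0)
        = ((Qpp - s \<cdot>\<^sub>m Dp) * vp s \<theta>) $$ (?i, 0) + (Qp0 * v0 s \<theta>) $$ (?i, 0) + \<eta>p $$ (?i, 0)"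
      using ii(1) c vc by (simp del: index_mult_mat(1))
    ultimately have "\<theta> * (Rp * vp s \<theta>) $$ (?i, 0)
        = ((Qpp - s \<cdot>\<^sub>m Dp) * vp s \<theta>) $$ (?i, 0) + (Qp0 * v0 s \<theta>) $$ (?i, 0) + \<eta>p $$ (?i, 0)"
      using Rp_vp[OF s \<theta>] by simp
    then show ?thesis
      unfolding 0 1 2 3 sum by (simp add: algebra_simps)
  qed
qed

section \<open>Initial distribution and candidate density\<close>

definition "\<alpha>0 \<alpha> = submatrix \<alpha> UNIV E0"
definition "\<alpha>p \<alpha> = submatrix \<alpha> UNIV Ep"
definition "\<alpha>_fun \<alpha> s = \<alpha>0 \<alpha> * B s * Q0p + \<alpha>p \<alpha>"
definition "dens \<alpha> s y = (\<alpha>_fun \<alpha> s * mat_exp (y \<cdot>\<^sub>m W s) * \<eta>_fun s) $$ (0, 0)"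

context
  fixes \<alpha> :: "real mat"
  assumes \<alpha>: "\<alpha> \<in> carrier_mat 1 m"
begin

lemma \<alpha>_carriers:
  "\<alpha>0 \<alpha> \<in> carrier_mat 1 k0" "\<alpha>p \<alpha> \<in> carrier_mat 1 kp"
  unfolding \<alpha>0_def \<alpha>p_def by (intro submatrix_UNIV_left(1)[OF \<alpha>] E_sub)+

lemma \<alpha>_fun_carrier: "\<alpha>_fun \<alpha> s \<in> carrier_mat 1 kp"
  unfolding \<alpha>_fun_def using \<alpha>_carriers carriers by (intro carrier_matI) auto

text \<open>Separates the mean of h over transient initial states into a term free of \<theta>,
  which will belong to the atom, and one that is a Laplace transform in \<theta>.\<close>

lemma \<alpha>_v:
  assumes s: "0 \<le> s"
  shows "(\<Sum>j<m. \<alpha> $$ (0, j) * v s \<theta> j) = (\<alpha>0 \<alpha> * B s * \<eta>0) $$ (0, 0) + (\<alpha>_fun \<alpha> s * vp s \<theta>) $$ (0, 0)"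
proof -
  note c = carriers and vc = v_carrier[OF s, of \<theta>] and ac = \<alpha>_carriers and Bc = B_inverse(3)[OF s]
  have aB: "\<alpha>0 \<alpha> * B s \<in> carrier_mat 1 k0" by (rule mult_carrier_mat[OF ac(1) Bc])
  have aBQ: "\<alpha>0 \<alpha> * B s * Q0p \<in> carrier_mat 1 kp" by (rule mult_carrier_mat[OF aB c(2)])
  have Qv: "Q0p * vp s \<theta> \<in> carrier_mat k0 1" by (rule mult_carrier_mat[OF c(2) vc(1)])
  have "\<alpha>0 \<alpha> * v0 s \<theta> = \<alpha>0 \<alpha> * B s * (\<eta>0 + Q0p * vp s \<theta>)"
    unfolding v0_def by (rule assoc_mult_mat[OF ac(1) Bc, symmetric]) (use c Qv in auto)
  also have "\<dots> = \<alpha>0 \<alpha> * B s * \<eta>0 + \<alpha>0 \<alpha> * B s * (Q0p * vp s \<theta>)"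
    by (rule mult_add_distrib_mat[OF aB c(5) Qv])
  also have "\<alpha>0 \<alpha> * B s * (Q0p * vp s \<theta>) = \<alpha>0 \<alpha> * B s * Q0p * vp s \<theta>"
    by (rule assoc_mult_mat[OF aB c(2) vc(1), symmetric])
  finally have 1: "\<alpha>0 \<alpha> * v0 s \<theta> = \<alpha>0 \<alpha> * B s * \<eta>0 + \<alpha>0 \<alpha> * B s * Q0p * vp s \<theta>" .
  have 2: "\<alpha>_fun \<alpha> s * vp s \<theta> = \<alpha>0 \<alpha> * B s * Q0p * vp s \<theta> + \<alpha>p \<alpha> * vp s \<theta>"
    unfolding \<alpha>_fun_def by (rule add_mult_distrib_mat[OF aBQ ac(2) vc(1)])
  have "(\<Sum>j<m. \<alpha> $$ (0, j) * v s \<theta> j)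
      = (\<Sum>k<k0. \<alpha>0 \<alpha> $$ (0, k) * v0 s \<theta> $$ (k, 0)) + (\<Sum>k<kp. \<alpha>p \<alpha> $$ (0, k) * vp s \<theta> $$ (k, 0))"
    unfolding sum_E \<alpha>0_def \<alpha>p_def
    by (simp add: v_pick submatrix_UNIV_left(2)[OF \<alpha> E_sub(1)] submatrix_UNIV_left(2)[OF \<alpha> E_sub(2)])
  also have "\<dots> = (\<alpha>0 \<alpha> * v0 s \<theta>) $$ (0, 0) + (\<alpha>p \<alpha> * vp s \<theta>) $$ (0, 0)"
    by (simp only: mat_mult_index_sum[OF ac(1) vc(2)] mat_mult_index_sum[OF ac(2) vc(1)] zero_less_one)
  finally show ?thesis
    unfolding 1 2 using aB aBQ ac c vc by (simp del: index_mult_mat(1))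
qed

text \<open>The density is a finite linear combination of entries of exp(y W(s)), so its transform
  is computed entrywise, with integrability included.\<close>

lemma dens_laplace:
  assumes s: "0 \<le> s" and \<theta>: "mat_bound (W s) < \<theta>"
  shows "has_bochner_integral lborel (\<lambda>y. indicator {0<..} y * (exp (- \<theta> * y) * dens \<alpha> s y))
    ((\<alpha>_fun \<alpha> s * vp s \<theta>) $$ (0, 0))"
proof -
  note W = W_carrier(1)[OF s] and E = W_carrier(2)[OF s] and a = \<alpha>_fun_carrier[of s]
  let ?e = "\<lambda>y i j. mat_exp (y \<cdot>\<^sub>m W s) $$ (i, j)"
  let ?L = "Matrix.mat kp kp (\<lambda>(i, j). laplace_mat (W s) \<theta> i j)"
  have quad: "(\<alpha>_fun \<alpha> s * (X * \<eta>_fun s)) $$ (0, 0) = (\<Sum>i<kp. \<Sum>j<kp. \<alpha>_fun \<alpha> s $$ (0, i) * \<eta>_fun s $$ (j, 0) * X $$ (i, j))"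
    if X: "X \<in> carrier_mat kp kp" for X
  proof -
    have "(\<alpha>_fun \<alpha> s * (X * \<eta>_fun s)) $$ (0, 0) = (\<Sum>i<kp. \<alpha>_fun \<alpha> s $$ (0, i) * (X * \<eta>_fun s) $$ (i, 0))"
      by (rule mat_mult_index_sum[OF a mult_carrier_mat[OF X E]]) auto
    also have "\<dots> = (\<Sum>i<kp. \<alpha>_fun \<alpha> s $$ (0, i) * (\<Sum>j<kp. X $$ (i, j) * \<eta>_fun s $$ (j, 0)))"
      by (intro sum.cong refl) (simp add: mat_mult_index_sum[OF X E] del: index_mult_mat(1))
    finally show ?thesis by (simp add: sum_distrib_left mult_ac)
  qed
  have ec: "mat_exp (y \<cdot>\<^sub>m W s) \<in> carrier_mat kp kp" for y using W by (intro carrier_matI) auto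
  have d: "dens \<alpha> s y = (\<Sum>i<kp. \<Sum>j<kp. \<alpha>_fun \<alpha> s $$ (0, i) * \<eta>_fun s $$ (j, 0) * ?e y i j)" for y
    unfolding dens_def assoc_mult_mat[OF a ec E] by (rule quad[OF ec])
  have r: "(\<alpha>_fun \<alpha> s * vp s \<theta>) $$ (0, 0)
      = (\<Sum>i<kp. \<Sum>j<kp. \<alpha>_fun \<alpha> s $$ (0, i) * \<eta>_fun s $$ (j, 0) * laplace_mat (W s) \<theta> i j)"
    unfolding vp_def by (subst quad) auto
  have t: "indicator {0<..} y * (exp (- \<theta> * y) * dens \<alpha> s y)
      = (\<Sum>i<kp. \<Sum>j<kp. \<alpha>_fun \<alpha> s $$ (0, i) * \<eta>_fun s $$ (j, 0) * (indicator {0<..} y * (exp (- \<theta> * y) * ?e y i j)))" for y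
    unfolding d sum_distrib_left by (intro sum.cong refl) (simp add: mult_ac)
  show ?thesis unfolding t r
    by (intro has_bochner_integral_sum has_bochner_integral_mult_right laplace_mat_exp[OF W _ _ \<theta>]) auto
qed

end

end

section \<open>The joint law\<close>

lemma absorbing_generator_index:
  assumes Q: "Q \<in> carrier_mat m m"
  shows "i < m \<Longrightarrow> j < m \<Longrightarrow> absorbing_generator Q $$ (i, j) = Q $$ (i, j)"
    and "i < m \<Longrightarrow> absorbing_generator Q $$ (i, m) = - (\<Sum>j<m. Q $$ (i, j))"
    and "j < m + 1 \<Longrightarrow> absorbing_generator Q $$ (m, j) = 0"
proof -
  have o: "ones_col m \<in> carrier_mat m 1" by (simp add: ones_col_def)
  have Q1: "(Q * ones_col m) $$ (i, 0) = (\<Sum>j<m. Q $$ (i, j))" if "i < m" for i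
    using mat_mult_index_sum[OF Q o that, of 0] by (simp add: ones_col_def)
  show "i < m \<Longrightarrow> j < m \<Longrightarrow> absorbing_generator Q $$ (i, j) = Q $$ (i, j)"
    and "i < m \<Longrightarrow> absorbing_generator Q $$ (i, m) = - (\<Sum>j<m. Q $$ (i, j))"
    and "j < m + 1 \<Longrightarrow> absorbing_generator Q $$ (m, j) = 0"
    using Q o Q1[of i] unfolding absorbing_generator_def Let_def
    by (simp_all add: index_mat_four_block del: index_mult_mat(1))
qed

text \<open>The atom at \<open>0\<close> of the law with mass \<open>c\<close> on \<open>{0}\<close> and density \<open>f\<close> on \<open>{0<..}\<close> is
  realised as the image of \<open>{-1..0}\<close> under \<open>max 0\<close>.\<close>

lemma laplace_atom_density:
  fixes w Z :: "'a \<Rightarrow> real" and f :: "real \<Rightarrow> real"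
  assumes w: "integrable M w" and Z: "Z \<in> borel_measurable M" "\<And>x. x \<in> space M \<Longrightarrow> 0 \<le> Z x"
    and f: "integrable lborel (\<lambda>y. indicator {0<..} y * f y)"
    and eq: "\<And>k::nat. (\<integral>x. w x * exp (- real k * Z x) \<partial>M)
      = c + (\<integral>y. indicator {0<..} y * (exp (- real k * y) * f y) \<partial>lborel)"
  shows "(\<integral>x. w x * indicator {0} (Z x) \<partial>M) = c"
    and "B \<in> sets borel \<Longrightarrow> B \<subseteq> {0<..} \<Longrightarrow>
      (\<integral>x. w x * indicator B (Z x) \<partial>M) = (\<integral>y. indicator B y * f y \<partial>lborel)"
proof -
  let ?w = "\<lambda>y. indicator {-1..0} y * c + indicator {0<..} y * f y"
  have ci: "integrable lborel (\<lambda>y. indicator {-1..0::real} y * c)"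
    by (intro integrable_mult_left) auto
  have wi: "integrable lborel ?w" by (rule Bochner_Integration.integrable_add[OF ci f])
  have ti: "(\<integral>x. w x * indicator B (Z x) \<partial>M) = (\<integral>y. ?w y * indicator B (max 0 y) \<partial>lborel)" if "B \<in> sets borel" for B
  proof (rule laplace_transform_unique[OF w Z wi _ _ _ that])
    fix k :: nat
    have "integrable lborel (\<lambda>y. (indicator {0<..} y * f y) * exp (- real k * max 0 y))"
      by (rule integrable_mult_bounded[OF f, where K=1]) auto
    moreover have "(\<lambda>y. (indicator {0<..} y * f y) * exp (- real k * max 0 y))
        = (\<lambda>y. indicator {0<..} y * (exp (- real k * y) * f y))"
      by (rule ext) (auto simp: indicator_def)
    ultimately have i: "integrable lborel (\<lambda>y. indicator {0<..} y * (exp (- real k * y) * f y))"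
      by (simp only:)
    have "(\<lambda>y. ?w y * exp (- real k * max 0 y))
        = (\<lambda>y. indicator {-1..0} y * c + indicator {0<..} y * (exp (- real k * y) * f y))"
      by (rule ext) (auto simp: indicator_def)
    then have "(\<integral>y. ?w y * exp (- real k * max 0 y) \<partial>lborel)
        = (\<integral>y. indicator {-1..0::real} y * c \<partial>lborel) + (\<integral>y. indicator {0<..} y * (exp (- real k * y) * f y) \<partial>lborel)"
      by (simp only: Bochner_Integration.integral_add[OF ci i])
    then show "(\<integral>x. w x * exp (- real k * Z x) \<partial>M) = (\<integral>y. ?w y * exp (- real k * max 0 y) \<partial>lborel)"
      unfolding eq by simp
  qed auto
  have "(\<lambda>y. ?w y * indicator {0} (max 0 y)) = (\<lambda>y. indicator {-1..0} y * c)"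
    by (rule ext) (auto simp: indicator_def max_def)
  then show "(\<integral>x. w x * indicator {0} (Z x) \<partial>M) = c"
    using ti[of "{0}"] by (simp del: of_bool_eq_iff)
  show "(\<integral>x. w x * indicator B (Z x) \<partial>M) = (\<integral>y. indicator B y * f y \<partial>lborel)"
    if B: "B \<in> sets borel" "B \<subseteq> {0<..}"
  proof -
    have "(\<lambda>y. ?w y * indicator B (max 0 y)) = (\<lambda>y. indicator B y * f y)"
      by (rule ext) (use B(2) in \<open>auto simp: indicator_def max_def split: if_splits\<close>)
    then show ?thesis using ti[OF B(1)] by (simp only:)
  qed
qed

theorem theorem1:
  fixes M :: "'w measure" and J :: "real \<Rightarrow> 'w \<Rightarrow> nat"
    and m :: nat and Q \<alpha> R :: "real mat" and \<alpha>_abs :: real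
  assumes Q: "Q \<in> carrier_mat m m" "invertible_mat Q"
    and \<alpha>: "\<alpha> \<in> carrier_mat 1 m"
    and R: "R \<in> carrier_mat 2 m"
    and R_nonneg: "\<And>i j. i < 2 \<Longrightarrow> j < m \<Longrightarrow> 0 \<le> R $$ (i, j)"
    and R_pos: "\<And>i. i < 2 \<Longrightarrow> 0 < (\<Sum>j<m. R $$ (i, j))"
    and J: "markov_process M J (m + 1) (absorbing_generator Q)"
    and init: "\<And>j. j < m \<Longrightarrow> \<P>(\<omega> in M. J 0 \<omega> = j) = \<alpha> $$ (0, j)"
    and init_abs: "\<P>(\<omega> in M. J 0 \<omega> = m) = \<alpha>_abs" "\<alpha>_abs < 1"
  defines "Z1 \<equiv> total_reward R J 0" and "Z2 \<equiv> total_reward R J 1"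
  defines "E0 \<equiv> {j. j < m \<and> R $$ (0, j) = 0}" and "Ep \<equiv> {j. j < m \<and> R $$ (0, j) > 0}"
  defines "Q00 \<equiv> submatrix Q E0 E0" and "Q0p \<equiv> submatrix Q E0 Ep"
    and "Qp0 \<equiv> submatrix Q Ep E0" and "Qpp \<equiv> submatrix Q Ep Ep"
  defines "\<alpha>0 \<equiv> submatrix \<alpha> UNIV E0" and "\<alpha>p \<equiv> submatrix \<alpha> UNIV Ep"
  defines "\<eta> \<equiv> - (Q * ones_col m)"
  defines "\<eta>0 \<equiv> submatrix \<eta> E0 UNIV" and "\<eta>p \<equiv> submatrix \<eta> Ep UNIV"
  defines "Rp \<equiv> reward_diag R 0 Ep" and "Dp \<equiv> reward_diag R 1 Ep" and "D0 \<equiv> reward_diag R 1 E0"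
  defines "\<alpha>_fun \<equiv> \<lambda>s. \<alpha>0 * mat_inv (s \<cdot>\<^sub>m D0 - Q00) * Q0p + \<alpha>p"
    and "W \<equiv> \<lambda>s. mat_inv Rp * ((Qpp - s \<cdot>\<^sub>m Dp) - Qp0 * mat_inv (Q00 - s \<cdot>\<^sub>m D0) * Q0p)"
    and "\<eta>_fun \<equiv> \<lambda>s. mat_inv Rp * (Qp0 * mat_inv (s \<cdot>\<^sub>m D0 - Q00) * \<eta>0 + \<eta>p)"
  shows "(\<forall>s\<ge>0. invertible_mat (s \<cdot>\<^sub>m D0 - Q00) \<and>
            (\<integral>\<omega>. exp (- s * Z2 \<omega>) * indicator {0} (Z1 \<omega>) \<partial>M)
              = \<alpha>_abs + (\<alpha>0 * mat_inv (s \<cdot>\<^sub>m D0 - Q00) * \<eta>0) $$ (0, 0)) \<and>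
         (\<forall>s\<ge>0.
            set_integrable lborel {0<..} (\<lambda>y. (\<alpha>_fun s * mat_exp (y \<cdot>\<^sub>m W s) * \<eta>_fun s) $$ (0, 0)) \<and>
            (\<forall>B\<in>sets borel. B \<subseteq> {0<..} \<longrightarrow>
               (\<integral>\<omega>. exp (- s * Z2 \<omega>) * indicator B (Z1 \<omega>) \<partial>M)
                 = (LBINT y:B. (\<alpha>_fun s * mat_exp (y \<cdot>\<^sub>m W s) * \<eta>_fun s) $$ (0, 0))))"
proof -
  let ?G = "absorbing_generator Q"
  note Gi = absorbing_generator_index[OF Q(1)]
  have gen: "generator_matrix (m + 1) ?G" using J unfolding markov_process_def by blast
  have off: "0 \<le> Q $$ (i, j)" if "i < m" "j < m" "i \<noteq> j" for i j
  proof -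
    have "0 \<le> ?G $$ (i, j)" using gen that unfolding generator_matrix_def by simp
    then show ?thesis using Gi(1)[OF that(1,2)] by simp
  qed
  \<comment> \<open>The deficit of row i is the transition rate into the absorbing state, an
    off-diagonal entry of the extended generator.\<close>
  have row: "(\<Sum>j<m. Q $$ (i, j)) \<le> 0" if "i < m" for i
  proof -
    have "0 \<le> ?G $$ (i, m)" using gen that unfolding generator_matrix_def by auto
    then show ?thesis using Gi(2)[OF that] by simp
  qed
  interpret K: reward_blocks m Q R
    by unfold_locales (use Q R R_nonneg off row in auto)
  interpret absorbing_markov M J "m + 1" ?G m
    by unfold_locales (use J Gi(3) in auto)
  have dim: "dim_col R = m" using R by simp
  have Z_measurable: "Z1 \<in> borel_measurable M" "Z2 \<in> borel_measurable M"
    unfolding Z1_def Z2_def by (rule total_reward_measurable[OF dim])+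
  note [measurable] = Z_measurable
  have Z_nonneg: "0 \<le> Z1 \<omega>" "0 \<le> Z2 \<omega>" for \<omega>
    unfolding Z1_def Z2_def by (rule total_reward_nonneg[OF dim], use R_nonneg in simp)+
  have kernel: "trivial_kernel m Q"
    by (rule trivial_kernelI, rule invertible_mat_kernel[OF Q])
  \<comment> \<open>x is the inverse of -Q applied to the column of ones, that is, the vector of
    expected absorption times. Extended by 0 to the absorbing state, it is the g that
    \<open>AE_hits\<close> works with.\<close>
  obtain x where x: "\<And>i. i < m \<Longrightarrow> (\<Sum>j<m. Q $$ (i, j) * x j) = - 1"
    using linear_system_solvable[OF Q(1) kernel, of "\<lambda>_. - 1"] by blast
  define g where "g j = (if j < m then x j else 0)" for j
  have g: "(\<Sum>j<m + 1. ?G $$ (i, j) * g j) = - 1" if "i < m + 1" "i \<noteq> m" for i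
    using x[of i] that by (simp add: g_def Gi(1))
  have laplace: "expectation (\<lambda>\<omega>. exp (- (\<theta> * Z1 \<omega> + s * Z2 \<omega>)))
      = \<alpha>_abs + (K.\<alpha>0 \<alpha> * K.B s * K.\<eta>0) $$ (0, 0)
        + (\<integral>y. indicator {0<..} y * (exp (- \<theta> * y) * K.dens \<alpha> s y) \<partial>lborel)"
    if s: "0 \<le> s" and \<theta>: "mat_bound (K.W s) < \<theta>" for s \<theta>
  proof -
    have \<theta>0: "0 \<le> \<theta>" using mat_bound_nonneg[of "K.W s"] \<theta> by linarith
    define h where "h j = (if j < m then K.v s \<theta> j else 1)" for j
    have h: "(\<Sum>j<m + 1. ?G $$ (i, j) * h j) = (\<theta> * reward_rate R 0 i + s * reward_rate R 1 i) * h i"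
      if "i < m + 1" for i
    proof (cases "i < m")
      case True
      have "(\<Sum>j<m + 1. ?G $$ (i, j) * h j) = (\<Sum>j<m. Q $$ (i, j) * K.v s \<theta> j) + K.\<eta> $$ (i, 0)"
        using True by (simp add: h_def Gi(1,2) K.\<eta>_index)
      then show ?thesis
        using K.v_equation[OF s \<theta> True] True by (simp add: h_def reward_rate_def dim)
    next
      case False
      then have "i = m" using that by simp
      then show ?thesis using Gi(3) by (simp add: reward_rate_def dim)
    qed
    have "expectation (\<lambda>\<omega>. exp (- (\<theta> * Z1 \<omega> + s * Z2 \<omega>))) = expectation (\<lambda>\<omega>. h (J 0 \<omega>))"
      unfolding Z1_def Z2_def
      by (rule total_reward_laplace[OF dim _ \<theta>0 s, of g h]) (use R_nonneg g h in \<open>auto simp: h_def\<close>)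
    also have "\<dots> = (\<Sum>j<m + 1. h j * prob {\<omega>\<in>space M. J 0 \<omega> = j})"
      by (rule expectation_finite_valued(2)) (use J_less J_event[of 0 "\<lambda>i. i = _"] in auto)
    \<comment> \<open>Since h is 1 at the absorbing state, starting there contributes exactly
      \<open>\<alpha>_abs\<close>, independently of \<theta> and s.\<close>
    also have "\<dots> = (\<Sum>j<m. \<alpha> $$ (0, j) * K.v s \<theta> j) + \<alpha>_abs"
      using init init_abs(1) by (simp add: h_def mult.commute)
    also have "(\<Sum>j<m. \<alpha> $$ (0, j) * K.v s \<theta> j) = (K.\<alpha>0 \<alpha> * K.B s * K.\<eta>0) $$ (0, 0) + (K.\<alpha>_fun \<alpha> s * K.vp s \<theta>) $$ (0, 0)"
      by (rule K.\<alpha>_v[OF \<alpha> s])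
    also have "(K.\<alpha>_fun \<alpha> s * K.vp s \<theta>) $$ (0, 0) = (\<integral>y. indicator {0<..} y * (exp (- \<theta> * y) * K.dens \<alpha> s y) \<partial>lborel)"
      using K.dens_laplace[OF \<alpha> s \<theta>] by (simp add: has_bochner_integral_iff)
    finally show ?thesis by simp
  qed
  have atom: "(\<integral>\<omega>. exp (- s * Z2 \<omega>) * indicator {0} (Z1 \<omega>) \<partial>M) = \<alpha>_abs + (K.\<alpha>0 \<alpha> * K.B s * K.\<eta>0) $$ (0, 0)" (is ?atom)
    and dens: "set_integrable lborel {0<..} (K.dens \<alpha> s)" (is ?int)
      "B \<in> sets borel \<Longrightarrow> B \<subseteq> {0<..} \<Longrightarrow>
        (\<integral>\<omega>. exp (- s * Z2 \<omega>) * indicator B (Z1 \<omega>) \<partial>M) = (LBINT y:B. K.dens \<alpha> s y)"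
    if s: "0 \<le> s" for s B
  proof -
    \<comment> \<open>Every argument N + k exceeds the threshold in \<open>laplace\<close>. Tilting
      by exp (- N Z1) thus turns agreement for large \<theta> into agreement at all natural numbers
      k, the form that \<open>laplace_atom_density\<close> takes.\<close>
    define N where "N = mat_bound (K.W s) + 1"
    have N: "mat_bound (K.W s) < N" "0 \<le> N" using mat_bound_nonneg[of "K.W s"] by (auto simp: N_def)
    let ?f = "\<lambda>y. exp (- N * y) * K.dens \<alpha> s y" and ?w = "\<lambda>\<omega>. exp (- s * Z2 \<omega>) * exp (- N * Z1 \<omega>)"
    have gi: "integrable M (\<lambda>\<omega>. exp (- s * Z2 \<omega>))"
      by (rule integrable_const_bound[where B=1]) (use s Z_nonneg in auto)
    have wi: "integrable M ?w"
      by (rule integrable_mult_bounded[OF gi, where K=1]) (use N Z_nonneg in auto)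
    have fi: "integrable lborel (\<lambda>y. indicator {0<..} y * ?f y)"
      using K.dens_laplace[OF \<alpha> s N(1)] unfolding has_bochner_integral_iff by blast
    have eq: "(\<integral>\<omega>. ?w \<omega> * exp (- real k * Z1 \<omega>) \<partial>M)
      = \<alpha>_abs + (K.\<alpha>0 \<alpha> * K.B s * K.\<eta>0) $$ (0, 0) + (\<integral>y. indicator {0<..} y * (exp (- real k * y) * ?f y) \<partial>lborel)" for k
    proof -
      have 1: "?w \<omega> * exp (- real k * Z1 \<omega>) = exp (- ((N + real k) * Z1 \<omega> + s * Z2 \<omega>))" for \<omega>
        by (simp add: algebra_simps flip: exp_add)
      have 2: "exp (- real k * y) * ?f y = exp (- (N + real k) * y) * K.dens \<alpha> s y" for y
        unfolding mult.assoc[symmetric] exp_add[symmetric] by (simp add: algebra_simps)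
      show ?thesis unfolding 1 2 by (rule laplace[OF s]) (use N in linarith)
    qed
    note LU = laplace_atom_density[OF wi Z_measurable(1) Z_nonneg(1) fi eq]
    \<comment> \<open>On the event Z1 = 0 the tilt exp (- N Z1) is 1, so the atom can be read off
      from the tilted law.\<close>
    have "(\<integral>\<omega>. exp (- s * Z2 \<omega>) * indicator {0} (Z1 \<omega>) \<partial>M) = (\<integral>\<omega>. ?w \<omega> * indicator {0} (Z1 \<omega>) \<partial>M)"
      by (rule Bochner_Integration.integral_cong) (auto simp: indicator_def)
    then show ?atom using LU(1) by simp
    note WD = weighted_law_imp_density[OF gi _ Z_measurable(1) Z_nonneg(1) N(2) fi]
    show ?int by (rule WD(1)) (use LU(2) in auto)
    show "(\<integral>\<omega>. exp (- s * Z2 \<omega>) * indicator B (Z1 \<omega>) \<partial>M) = (LBINT y:B. K.dens \<alpha> s y)"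
      if "B \<in> sets borel" "B \<subseteq> {0<..}"
      by (rule WD(2)[OF _ _ that]) (use LU(2) in auto)
  qed
  have E: "E0 = K.E0" "Ep = K.Ep" by (simp_all add: E0_def Ep_def K.E0_def K.Ep_def)
  have blocks: "Q00 = K.Q00" "Q0p = K.Q0p" "Qp0 = K.Qp0" "Qpp = K.Qpp" "\<alpha>0 = K.\<alpha>0 \<alpha>" "\<alpha>p = K.\<alpha>p \<alpha>"
    "\<eta>0 = K.\<eta>0" "\<eta>p = K.\<eta>p" "Rp = K.Rp" "Dp = K.Dp" "D0 = K.D0"
    unfolding Q00_def Q0p_def Qp0_def Qpp_def \<alpha>0_def \<alpha>p_def \<eta>0_def \<eta>p_def \<eta>_def Rp_def Dp_def D0_def E
      K.Q00_def K.Q0p_def K.Qp0_def K.Qpp_def K.\<alpha>0_def K.\<alpha>p_def K.\<eta>0_def K.\<eta>p_def K.\<eta>_def K.Rp_def K.Dp_def K.D0_def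
    by (rule refl)+
  have funs: "\<alpha>_fun s = K.\<alpha>_fun \<alpha> s" "W s = K.W s" "\<eta>_fun s = K.\<eta>_fun s" for s
    unfolding \<alpha>_fun_def W_def \<eta>_fun_def K.\<alpha>_fun_def K.W_def K.\<eta>_fun_def K.B_def blocks by (rule refl)+
  show ?thesis
    unfolding funs unfolding blocks K.dens_def[symmetric] K.B_def[symmetric]
    using K.B_inverse(1) atom dens by blast
qed

end
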